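(* Let $G$ be a complex simple Lie group not of type $A_\ell$ or $C_\ell$, with Lie algebra $\mathfrak{g}$, associated data $(W,\mathfrak{C})$ and $n=1+\dim W$. The flat $G$-contact structure $(J^1(\mathbb{C}^n,\mathbb{C}),\mathcal{C},\mathcal{V})$ described in the context admits the symmetry with generating function $$f=u(u-x^iu_i)-\tfrac12\mathfrak{C}(X^3)\,u_0+\tfrac12\mathfrak{C}^*(P^3)\,x^0+\tfrac94\,\mathfrak{C}_a(X^2)(\mathfrak{C}^* )^a(P^2),$$ where $X=x^a\mathsf{w}_a$ and $P=u_a\mathsf{w}^a$ (sums over $0\le i\le n-1$ and $1\le a\le n-1$), and $f$ spans the top slot $\mathfrak{g}_2$ of the contact grading $\mathfrak{g}=\mathfrak{g}_{-2}\oplus\dots\oplus\mathfrak{g}_2$ of the symmetry algebra. Via the Lagrange bracket, the functions $\{x^i,u_i,f\}_{0\le i\le n-1}$ generate all of $\mathfrak{g}$.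
   Context: Everything is complex; the summation convention is used. Data $(W,\mathfrak{C})$. To $G$ is associated a vector space $W$ (a Jordan algebra) with cubic form $\mathfrak{C}\in S^3W^*$: $B_\ell$ ($\ell\ge3$): $W=\mathcal{JS}_{2\ell-5}$; $D_\ell$ ($\ell\ge5$): $W=\mathcal{JS}_{2\ell-6}$; here $\mathcal{JS}_m=\mathbb{C}^m\oplus\mathbb{C}$ with $\mathbb{C}^m$ carrying a nondegenerate symmetric bilinear form $\langle\cdot,\cdot\rangle$ and $\mathfrak{C}(t^3)=\langle v,v\rangle\lambda$ for $t=(v,\lambda)$. $G_2$: $W=\mathbb{C}$, $\mathfrak{C}(t^3)=t^3/3$. $D_4$: $W$ = diagonal $3\times3$ matrices, $\mathfrak{C}(t^3)=\det t$. $F_4,E_6,E_7,E_8$: $W$ = $3\times 3$ $\mathbb{A}$-Hermitian matrices with $\mathbb{A}=\mathbb{A}_{\mathbb{R}}\otimes_{\mathbb{R}}\mathbb{C}$ and $\mathbb{A}_{\mathbb{R}}=\mathbb{R},\mathbb{C},\mathbb{H},\mathbb{O}$ respectively, $\mathfrak{C}(t^3)=\det(t)$ defined by $t^3-\mathrm{tr}(t)t^2-\frac12(\mathrm{tr}(t^2)-\mathrm{tr}(t)^2)t-\det(t)\,\mathrm{id}=0$. Fix a basis $\{\mathsf{w}_a\}_{a=1}^{n-1}$ of $W$ with dual basis $\{\mathsf{w}^a\}$. For $t=t^a\mathsf{w}_a$: $\mathfrak{C}(t^3)=\mathfrak{C}_{abc}t^at^bt^c$, $\mathfrak{C}_a(t^2)=\mathfrak{C}_{abc}t^bt^c$.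 The dual cubic $\mathfrak{C}^*\in S^3W$ is normalized by $(\mathfrak{C}^* )^{abc}\mathfrak{C}_{bde}\mathfrak{C}_{cfg}=\frac4{27}\mathfrak{C}_{(def}\delta_{g)}{}^a$, with analogous notation $\mathfrak{C}^*(s^3)$, $(\mathfrak{C}^* )^a(s^2)$ for $s=s_a\mathsf{w}^a\in W^*$. Flat $G$-contact structure. $J^1(\mathbb{C}^n,\mathbb{C})$ has coordinates $(x^i,u,u_i)$, $0\le i\le n-1$, $\mathcal{C}=\ker(du-u_idx^i)$, $\mathbf{X}_i=\partial_{x^i}+u_i\partial_u$, $\mathbf{U}^i=\partial_{u_i}$, and $\mathcal{V}=\{[\mathbf{V}(\lambda,t)]:[\lambda,t]\in\mathbb{P}(\mathbb{C}\oplus W)\}\subset\mathbb{P}(\mathcal{C})$ with $\mathbf{V}(\lambda,t)=\lambda^3\mathbf{X}_0-\lambda^2t^a\mathbf{X}_a-\frac12\mathfrak{C}(t^3)\mathbf{U}^0-\frac32\lambda\mathfrak{C}_a(t^2)\mathbf{U}^a$. Its symmetry algebra is isomorphic to $\mathfrak{g}$. Contact vector fields correspond to generating functions $f(x^i,u,u_i)$ via $\mathbf{S}_f=-f_{u_i}\frac{d}{dx^i}+f\partial_u+\frac{df}{dx^i}\partial_{u_i}$, $\frac{d}{dx^i}=\partial_{x^i}+u_i\partial_u$, and $[\mathbf{S}_f,\mathbf{S}_g]=\mathbf{S}_{[f,g]}$ with the Lagrange bracket $[f,g]=fg_u-gf_u+\frac{df}{dx^i}g_{u_i}-\frac{dg}{dx^i}f_{u_i}$.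 $\mathbf{S}_f$ (or $f$) is a symmetry if $[\mathbf{S}_f,\mathbf{V}(\lambda,t)]$ lies in the affine tangent space $\widehat{T}_{[\mathbf{V}(\lambda,t)]}\mathcal{V}$ (the span of the line and the tangent space of the cone over $\mathcal{V}$) for all $[\lambda,t]$. The contact grading is given by the eigenspaces of the grading element $\mathsf{Z}=2u-x^iu_i$: $\mathfrak{g}_k=\{g\in\mathfrak{g}:[\mathsf{Z},g]=kg\}$.
   Formalization: The normalization of the dual cubic is taken with its left-hand side symmetrized over d, e, f, g; as printed, without symmetrization on the left, no dual cubic exists in general (for example for D_4 with cubic t1 t2 t3). *)

theory Defs
  imports "HOL-Analysis.Analysis" "HOL-Library.Function_Algebras"
begin

section \<open>Complexified composition algebras\<close>

text \<open>
  The algebras $\mathbb{A} = \mathbb{A}_{\mathbb{R}} \otimes \mathbb{C}$ are obtained from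
  $\mathbb{C}$ by Cayley--Dickson doubling, which commutes with complexification.  The conjugation
  and the real part on $\mathbb{A}$ are the complex-linear extensions of those on
  $\mathbb{A}_{\mathbb{R}}$; on $\mathbb{R} \otimes \mathbb{C} = \mathbb{C}$ both are
  the identity, so \<^const>\<open>cnj\<close> and \<^const>\<open>Re\<close> must not appear here.
\<close>

class star_algebra = ab_group_add +
  fixes amult :: "'a \<Rightarrow> 'a \<Rightarrow> 'a"
    and aone :: 'a
    and ascale :: "complex \<Rightarrow> 'a \<Rightarrow> 'a"
    and aconj :: "'a \<Rightarrow> 'a"
    and areal :: "'a \<Rightarrow> complex"

instantiation complex :: star_algebra
begin

definition "amult a b = a * (b::complex)"
definition "aone = (1::complex)"
definition "ascale c a = c * (a::complex)"
definition "aconj a = (a::complex)"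
definition "areal a = (a::complex)"

instance ..

end

datatype 'a dbl = Dbl (dfst: 'a) (dsnd: 'a)

instantiation dbl :: (ab_group_add) ab_group_add
begin

definition "0 = Dbl 0 0"
definition "a + b = Dbl (dfst a + dfst b) (dsnd a + dsnd b)"
definition "a - b = Dbl (dfst a - dfst b) (dsnd a - dsnd b)"
definition "- a = Dbl (- dfst a) (- dsnd a)"

instance
  by standard
    (simp_all add: zero_dbl_def plus_dbl_def minus_dbl_def uminus_dbl_def algebra_simps)

end

instantiation dbl :: (star_algebra) star_algebra
begin

definition "amult a b =
  Dbl (amult (dfst a) (dfst b) - amult (aconj (dsnd b)) (dsnd a))
      (amult (dsnd b) (dfst a) + amult (dsnd a) (aconj (dfst b)))"
definition "aone = Dbl aone 0"
definition "ascale c a = Dbl (ascale c (dfst a)) (ascale c (dsnd a))"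
definition "aconj a = Dbl (aconj (dfst a)) (- dsnd a)"
definition "areal a = areal (dfst a)"

instance ..

end

type_synonym alg_R = complex
type_synonym alg_C = "complex dbl"
type_synonym alg_H = "complex dbl dbl"
type_synonym alg_O = "complex dbl dbl dbl"


section \<open>Hermitian matrices and their determinant\<close>

definition hermitian :: "('a::star_algebra ^ 3 ^ 3) set" where
  "hermitian = {t. \<forall>i j. t $ j $ i = aconj (t $ i $ j)}"

definition hscale :: "complex \<Rightarrow> 'a::star_algebra ^ 3 ^ 3 \<Rightarrow> 'a ^ 3 ^ 3" where
  "hscale c t = (\<chi> i j. ascale c (t $ i $ j))"

definition hmult :: "'a::star_algebra ^ 3 ^ 3 \<Rightarrow> 'a ^ 3 ^ 3 \<Rightarrow> 'a ^ 3 ^ 3" where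
  "hmult s t = (\<chi> i j. \<Sum>k\<in>UNIV. amult (s $ i $ k) (t $ k $ j))"

definition hone :: "'a::star_algebra ^ 3 ^ 3" where
  "hone = (\<chi> i j. if i = j then aone else 0)"

text \<open>The powers in the characteristic equation are those of the Jordan algebra.  For octonions
  the matrix products $t \cdot t^2$ and $t^2 \cdot t$ may differ; for associative $\mathbb{A}$ the
  Jordan powers are the matrix powers.\<close>

definition jordan :: "'a::star_algebra ^ 3 ^ 3 \<Rightarrow> 'a ^ 3 ^ 3 \<Rightarrow> 'a ^ 3 ^ 3" where
  "jordan s t = hscale (1/2) (hmult s t + hmult t s)"

text \<open>The diagonal entries of a Hermitian matrix are complex multiples of the unit of
  $\mathbb{A}$, so that its trace is a complex number.\<close>

definition htrace :: "'a::star_algebra ^ 3 ^ 3 \<Rightarrow> complex" where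
  "htrace t = (\<Sum>i\<in>UNIV. areal (t $ i $ i))"

definition hdet :: "'a::star_algebra ^ 3 ^ 3 \<Rightarrow> complex" where
  "hdet t = (THE d.
     let t2 = jordan t t; t3 = jordan t t2 in
     t3 - hscale (htrace t) t2 - hscale (1/2 * (htrace t2 - (htrace t)\<^sup>2)) t - hscale d hone = 0)"


section \<open>The data associated to a simple Lie group\<close>

text \<open>Trilinear coefficients \<open>C a b c\<close> with respect to a basis indexed by a finite type.\<close>

type_synonym 'm tensor3 = "'m \<Rightarrow> 'm \<Rightarrow> 'm \<Rightarrow> complex"

definition cubic :: "'m::finite tensor3 \<Rightarrow> ('m \<Rightarrow> complex) \<Rightarrow> complex" where
  "cubic C t = (\<Sum>a\<in>UNIV. \<Sum>b\<in>UNIV. \<Sum>c\<in>UNIV. C a b c * t a * t b * t c)"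

definition cubic1 :: "'m::finite tensor3 \<Rightarrow> 'm \<Rightarrow> ('m \<Rightarrow> complex) \<Rightarrow> complex" where
  "cubic1 C a t = (\<Sum>b\<in>UNIV. \<Sum>c\<in>UNIV. C a b c * t b * t c)"

definition symmetric3 :: "'m tensor3 \<Rightarrow> bool" where
  "symmetric3 C \<longleftrightarrow> (\<forall>a b c. C a b c = C b a c \<and> C a b c = C a c b)"

text \<open>\<open>C\<close> is the coefficient tensor of the cubic form \<open>N\<close> on the complex vector space \<open>W\<close> (with
  scalar multiplication \<open>sc\<close>) with respect to some basis \<open>w\<close> of \<open>W\<close>.\<close>

definition cubic_coeffs ::
  "(complex \<Rightarrow> 'v \<Rightarrow> 'v::ab_group_add) \<Rightarrow> 'v set \<Rightarrow> ('v \<Rightarrow> complex) \<Rightarrow> 'm::finite tensor3 \<Rightarrow> bool"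
where
  "cubic_coeffs sc W N C \<longleftrightarrow> symmetric3 C \<and>
     (\<exists>w. inj w \<and> \<not> module.dependent sc (range w) \<and> module.span sc (range w) = W \<and>
          (\<forall>t. N (\<Sum>a\<in>UNIV. sc (t a) (w a)) = cubic C t))"

text \<open>The space $\mathbb{C}^m$ is realized inside \<open>nat \<Rightarrow> complex\<close>, because $m$ varies with the
  type of the group.  A symmetric bilinear form on it is given by its Gram matrix \<open>B\<close>.\<close>

definition cspace :: "nat \<Rightarrow> (nat \<Rightarrow> complex) set" where
  "cspace m = {v. \<forall>i\<ge>m. v i = 0}"

definition bilin :: "nat \<Rightarrow> (nat \<Rightarrow> nat \<Rightarrow> complex) \<Rightarrow> (nat \<Rightarrow> complex) \<Rightarrow> (nat \<Rightarrow> complex) \<Rightarrow> complex"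
where
  "bilin m B v v' = (\<Sum>i<m. \<Sum>j<m. B i j * v i * v' j)"

definition nondegenerate_symmetric :: "nat \<Rightarrow> (nat \<Rightarrow> nat \<Rightarrow> complex) \<Rightarrow> bool" where
  "nondegenerate_symmetric m B \<longleftrightarrow>
     (\<forall>i<m. \<forall>j<m. B i j = B j i) \<and>
     (\<forall>v\<in>cspace m. (\<forall>v'\<in>cspace m. bilin m B v v' = 0) \<longrightarrow> v = 0)"

definition js_data :: "nat \<Rightarrow> 'm::finite tensor3 \<Rightarrow> bool" where
  "js_data m C \<longleftrightarrow> (\<exists>B. nondegenerate_symmetric m B \<and>
     cubic_coeffs (\<lambda>c (v, l). (\<lambda>i. c * v i, c * l)) (cspace m \<times> UNIV)
       (\<lambda>(v, l). bilin m B v v * l) C)"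

definition hermitian_data :: "'a::star_algebra itself \<Rightarrow> 'm::finite tensor3 \<Rightarrow> bool" where
  "hermitian_data A C \<longleftrightarrow>
     cubic_coeffs hscale (hermitian :: ('a ^ 3 ^ 3) set) hdet C"

definition diagonal_data :: "'m::finite tensor3 \<Rightarrow> bool" where
  "diagonal_data C \<longleftrightarrow>
     cubic_coeffs (\<lambda>c t. \<chi> i j. c * t $ i $ j)
       {t :: complex ^ 3 ^ 3. \<forall>i j. i \<noteq> j \<longrightarrow> t $ i $ j = 0} det C"

text \<open>The types of complex simple Lie groups other than $A_\ell$ and $C_\ell$, with the
  low-rank coincidences ($B_1$, $B_2$, $D_2$, $D_3$) excluded below by the bounds on $\ell$.\<close>

datatype simple_type = Type_B nat | Type_D nat | Type_E6 | Type_E7 | Type_E8 | Type_F4 | Type_G2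

fun cubic_data :: "simple_type \<Rightarrow> 'm::finite tensor3 \<Rightarrow> bool" where
  "cubic_data (Type_B l) C \<longleftrightarrow> l \<ge> 3 \<and> js_data (2 * l - 5) C"
| "cubic_data (Type_D l) C \<longleftrightarrow> l = 4 \<and> diagonal_data C \<or> l \<ge> 5 \<and> js_data (2 * l - 6) C"
| "cubic_data Type_E6 C \<longleftrightarrow> hermitian_data TYPE(alg_C) C"
| "cubic_data Type_E7 C \<longleftrightarrow> hermitian_data TYPE(alg_H) C"
| "cubic_data Type_E8 C \<longleftrightarrow> hermitian_data TYPE(alg_O) C"
| "cubic_data Type_F4 C \<longleftrightarrow> hermitian_data TYPE(alg_R) C"
| "cubic_data Type_G2 C \<longleftrightarrow> cubic_coeffs (*) (UNIV :: complex set) (\<lambda>t. t ^ 3 / 3) C"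

text \<open>Symmetrization of a 4-tensor, evaluated at the indices \<open>i 0, i 1, i 2, i 3\<close>.\<close>

definition sym4 :: "('m \<Rightarrow> 'm \<Rightarrow> 'm \<Rightarrow> 'm \<Rightarrow> complex) \<Rightarrow> (nat \<Rightarrow> 'm) \<Rightarrow> complex" where
  "sym4 T i =
     (\<Sum>\<pi> | \<pi> permutes {..<4::nat}. T (i (\<pi> 0)) (i (\<pi> 1)) (i (\<pi> 2)) (i (\<pi> 3))) / fact 4"

text \<open>The normalization of the dual cubic.  The left-hand side
  $(\mathfrak{C}^*)^{abc}\mathfrak{C}_{bde}\mathfrak{C}_{cfg}$ has to be symmetrized over $defg$,
  as the right-hand side is: already for $\mathfrak{C}(t^3) = t^1 t^2 t^3$ it is not symmetric.\<close>

definition dual_cubic :: "'m::finite tensor3 \<Rightarrow> 'm tensor3 \<Rightarrow> bool" where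
  "dual_cubic C D \<longleftrightarrow> symmetric3 D \<and>
     (\<forall>a i. sym4 (\<lambda>d e f g. \<Sum>b\<in>UNIV. \<Sum>c\<in>UNIV. D a b c * C b d e * C c f g) i =
            4/27 * sym4 (\<lambda>d e f g. C d e f * (if g = a then 1 else 0)) i)"


section \<open>The jet space\<close>

text \<open>With \<open>'m\<close> indexing the basis of $W$, the index set $\{0,\dots,n-1\}$ is \<open>'m option\<close>, where
  \<open>None\<close> is the index $0$ and \<open>Some a\<close> an index $a \ge 1$.  The same type serves for the points of
  $J^1(\mathbb{C}^n,\mathbb{C})$ and for its tangent vectors.\<close>

type_synonym 'm jet = "complex ^ ('m option + unit + 'm option)"

abbreviation cx :: "'m::finite jet \<Rightarrow> 'm option \<Rightarrow> complex" where
  "cx p i \<equiv> p $ Inl i"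

abbreviation cu :: "'m::finite jet \<Rightarrow> complex" where
  "cu p \<equiv> p $ Inr (Inl ())"

abbreviation cp :: "'m::finite jet \<Rightarrow> 'm option \<Rightarrow> complex" where
  "cp p i \<equiv> p $ Inr (Inr i)"

abbreviation d_u :: "'m::finite jet" where
  "d_u \<equiv> axis (Inr (Inl ())) 1"

definition vf_X :: "'m::finite option \<Rightarrow> 'm jet \<Rightarrow> 'm jet" where
  "vf_X i p = axis (Inl i) 1 + cp p i *s d_u"

definition vf_U :: "'m::finite option \<Rightarrow> 'm jet \<Rightarrow> 'm jet" where
  "vf_U i p = axis (Inr (Inr i)) 1"

definition holomorphic_fn :: "(complex ^ 'k \<Rightarrow> complex) \<Rightarrow> bool" where
  "holomorphic_fn f \<longleftrightarrow>
     (\<forall>p. \<exists>D. (f has_derivative D) (at p) \<and> (\<forall>c v. D (c *s v) = c * D v))"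

definition lie_bracket ::
  "(complex ^ 'k \<Rightarrow> complex ^ 'k) \<Rightarrow> (complex ^ 'k \<Rightarrow> complex ^ 'k) \<Rightarrow> complex ^ 'k \<Rightarrow> complex ^ 'k"
where
  "lie_bracket A B p = frechet_derivative B (at p) (A p) - frechet_derivative A (at p) (B p)"


section \<open>Contact vector fields and the Lagrange bracket\<close>

definition d_dx :: "'m::finite option \<Rightarrow> ('m jet \<Rightarrow> complex) \<Rightarrow> 'm jet \<Rightarrow> complex" where
  "d_dx i f p = frechet_derivative f (at p) (vf_X i p)"

definition d_du :: "('m::finite jet \<Rightarrow> complex) \<Rightarrow> 'm jet \<Rightarrow> complex" where
  "d_du f p = frechet_derivative f (at p) d_u"

definition d_dp :: "'m::finite option \<Rightarrow> ('m jet \<Rightarrow> complex) \<Rightarrow> 'm jet \<Rightarrow> complex" where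
  "d_dp i f p = frechet_derivative f (at p) (vf_U i p)"

definition contact_field :: "('m::finite jet \<Rightarrow> complex) \<Rightarrow> 'm jet \<Rightarrow> 'm jet" where
  "contact_field f p =
     - (\<Sum>i\<in>UNIV. d_dp i f p *s vf_X i p) + f p *s d_u + (\<Sum>i\<in>UNIV. d_dx i f p *s vf_U i p)"

definition lagrange ::
  "('m::finite jet \<Rightarrow> complex) \<Rightarrow> ('m jet \<Rightarrow> complex) \<Rightarrow> 'm jet \<Rightarrow> complex" where
  "lagrange f g p = f p * d_du g p - g p * d_du f p
     + (\<Sum>i\<in>UNIV. d_dx i f p * d_dp i g p - d_dx i g p * d_dp i f p)"


section \<open>The flat contact structure and its symmetries\<close>

definition vf_V :: "'m::finite tensor3 \<Rightarrow> complex \<Rightarrow> ('m \<Rightarrow> complex) \<Rightarrow> 'm jet \<Rightarrow> 'm jet" where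
  "vf_V C l t p =
     l ^ 3 *s vf_X None p - (\<Sum>a\<in>UNIV. (l\<^sup>2 * t a) *s vf_X (Some a) p)
     - (1/2 * cubic C t) *s vf_U None p
     - (\<Sum>a\<in>UNIV. (3/2 * l * cubic1 C a t) *s vf_U (Some a) p)"

definition cone_V :: "'m::finite tensor3 \<Rightarrow> 'm jet \<Rightarrow> 'm jet set" where
  "cone_V C p = {c *s vf_V C l t p | c l t. True}"

text \<open>The affine tangent space of a cone \<open>K\<close> at \<open>v\<close> is spanned by \<open>v\<close> and by the velocities at \<open>v\<close>
  of complex curves in \<open>K\<close>.  It may not be replaced by the span of the partial derivatives of
  $\mathbf{V}(\lambda,t)$, which is too small at $\lambda = 0$: the parametrization is not
  an immersion there.\<close>

definition affine_tangent :: "(complex ^ 'k) set \<Rightarrow> complex ^ 'k \<Rightarrow> (complex ^ 'k) set" where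
  "affine_tangent K v = vec.span (insert v
     {w. \<exists>\<gamma> :: complex \<Rightarrow> complex ^ 'k. \<gamma> 0 = v \<and> (\<forall>\<^sub>F z in nhds 0. \<gamma> z \<in> K) \<and>
           (\<forall>k. ((\<lambda>z. \<gamma> z $ k) has_field_derivative w $ k) (at 0))})"

definition is_symmetry :: "'m::finite tensor3 \<Rightarrow> ('m jet \<Rightarrow> complex) \<Rightarrow> bool" where
  "is_symmetry C f \<longleftrightarrow>
     (\<forall>l t p. lie_bracket (contact_field f) (vf_V C l t) p
                \<in> affine_tangent (cone_V C p) (vf_V C l t p))"

definition symmetry_algebra :: "'m::finite tensor3 \<Rightarrow> ('m jet \<Rightarrow> complex) set" where
  "symmetry_algebra C = {f. holomorphic_fn f \<and> is_symmetry C f}"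

definition grading_element :: "'m::finite jet \<Rightarrow> complex" where
  "grading_element p = 2 * cu p - (\<Sum>i\<in>UNIV. cx p i * cp p i)"

definition graded_part :: "'m::finite tensor3 \<Rightarrow> int \<Rightarrow> ('m jet \<Rightarrow> complex) set" where
  "graded_part C k =
     {g \<in> symmetry_algebra C. lagrange grading_element g = (\<lambda>p. of_int k * g p)}"

inductive_set lie_generated :: "('m::finite jet \<Rightarrow> complex) set \<Rightarrow> ('m jet \<Rightarrow> complex) set"
  for S where
  gen: "f \<in> S \<Longrightarrow> f \<in> lie_generated S"
| add: "\<lbrakk>f \<in> lie_generated S; g \<in> lie_generated S\<rbrakk> \<Longrightarrow> f + g \<in> lie_generated S"
| scale: "f \<in> lie_generated S \<Longrightarrow> (\<lambda>p. c * f p) \<in> lie_generated S"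
| bracket: "\<lbrakk>f \<in> lie_generated S; g \<in> lie_generated S\<rbrakk> \<Longrightarrow> lagrange f g \<in> lie_generated S"

end

theory Submission
  imports Defs "HOL-Complex_Analysis.Cauchy_Integral_Formula" "HOL-Combinatorics.Permutations"
begin

text \<open>Let \<open>V\<close> denote the contact field \<open>V(1,t)\<close>. The cone swept out by the \<open>V(\<lambda>,t)\<close> is
  Legendrian: its tangent space at \<open>V\<close> lies in the symplectic complement of \<open>V\<close> inside the
  contact distribution. Since the symplectic product of \<open>V\<close> with \<open>[S\<^sub>f, V]\<close> is \<open>- V(V f)\<close>, a
  symmetry satisfies \<open>V(V f) = 0\<close> for all \<open>t\<close> (\<open>symmetry_imp_square\<close>). Differentiating this
  equation in \<open>t\<close> shows conversely that \<open>[S\<^sub>f, V]\<close> is tangent (\<open>square_imp_symmetry\<close>), and that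
  \<open>V(V [f,g]) = 0\<close> follows from the same equation for \<open>f\<close> and \<open>g\<close> (\<open>square_lagrange\<close>), so that
  symmetries are closed under the Lagrange bracket.

  The expansion of \<open>V(V f) = 0\<close> in powers of \<open>t\<close> is a list of linear second-order equations, the
  structure equations. They leave free only a vector \<open>X\<^sub>0 U\<^sup>b f\<close> of \<open>W\<close>, a covector \<open>X\<^sub>b U\<^sup>0 f\<close> and
  the matrix \<open>X\<^sub>a U\<^sup>b f + 1/2 \<delta> f\<^sub>u\<close>, which has to be an infinitesimal similarity of the cubic. The
  normalization of the dual cubic enters through one identity, the formula \<open>dual_cubic_star\<close> for
  \<open>C\<^sup>*(C(x,t), C(t\<^sup>2))\<close>; it takes the place of computations in Jordan algebras, it yields the
  quartic part of the structure equations, and it is what makes the top generator satisfy them.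

  The system is of finite type. Commuting derivatives in the structure equations shows that the
  second derivatives of \<open>f\<^sub>u\<close> along the contact distribution vanish apart from the commutator
  term, and hence that \<open>f\<^sub>u\<^sub>u\<close> is constant (\<open>du_hessian\<close>, \<open>du_du_constant\<close>). Subtracting a multiple
  of the top generator and then brackets of it with the coordinates \<open>x\<^sup>i\<close>, \<open>u\<^sub>i\<close>, one reaches a
  symmetry with constant \<open>f\<^sub>u\<close>. Its second derivatives are constant, and its quadratic part is a
  vector, a covector and a similarity. Vectors and covectors come from double brackets of the top
  generator with coordinates. So do the similarities, because every similarity is inner
  (\<open>similarity_is_inner\<close>): this is an argument about the endomorphism \<open>C\<^sup>*\<^sup>a\<^sup>b\<^sup>c C\<^sub>c\<^sub>f\<^sub>a\<close> of \<open>W\<close>, which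
  satisfies an explicit quadratic equation and does not have the eigenvalue \<open>-2/9\<close>. What remains
  is affine. This proves generation and the decomposition into degrees \<open>-2, ..., 2\<close> at once, and
  exhibits the top generator as the only contribution of degree \<open>2\<close>.

  The classification of the groups enters through the fact that each of the listed cubic forms is
  nonzero.\<close>

section \<open>Entire functions of several variables\<close>

abbreviation dird :: "(complex ^ 'k::finite \<Rightarrow> complex) \<Rightarrow> complex ^ 'k \<Rightarrow> complex ^ 'k \<Rightarrow> complex" where
  "dird g p v \<equiv> frechet_derivative g (at p) v"

lemma holomorphic_fnI:
  assumes "\<And>p. (g has_derivative D p) (at p)" "\<And>p c v. D p (c *s v) = c * D p v"
  shows "holomorphic_fn g"
  using assms unfolding holomorphic_fn_def by blast

lemma holomorphic_fn_has_derivative: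
  "holomorphic_fn g \<Longrightarrow> (g has_derivative dird g p) (at p)"
  unfolding holomorphic_fn_def frechet_derivative_def
  by (metis (mono_tags, lifting) someI_ex)

lemma dird_eqI: "(g has_derivative D) (at p) \<Longrightarrow> dird g p v = D v"
  using frechet_derivative_at by metis

lemma dird_scale:
  assumes "holomorphic_fn g" shows "dird g p (c *s v) = c * dird g p v"
  using assms dird_eqI unfolding holomorphic_fn_def by metis

lemma dird_vadd:
  assumes "holomorphic_fn g" shows "dird g p (v + w) = dird g p v + dird g p w"
  using holomorphic_fn_has_derivative[OF assms] has_derivative_linear linear_add by blast

lemma dird_vsum:
  assumes "holomorphic_fn g" shows "dird g p (\<Sum>i\<in>A. v i) = (\<Sum>i\<in>A. dird g p (v i))"
  using holomorphic_fn_has_derivative[OF assms] has_derivative_linear linear_sum by blast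

lemma dird_expand:
  assumes "holomorphic_fn g" shows "dird g p v = (\<Sum>k\<in>UNIV. v $ k * dird g p (axis k 1))"
proof -
  have "v = (\<Sum>k\<in>UNIV. v $ k *s axis k 1)"
    by (simp add: vec_eq_iff axis_def if_distrib cong: if_cong)
  then have "dird g p v = dird g p (\<Sum>k\<in>UNIV. v $ k *s axis k 1)" by simp
  then show ?thesis by (simp add: dird_vsum dird_scale assms)
qed

named_theorems holo

lemma holo_const [holo]: "holomorphic_fn (\<lambda>p. c)"
  by (rule holomorphic_fnI[where D="\<lambda>_ _. 0"]) auto

lemma holo_nth [holo]: "holomorphic_fn (\<lambda>p. p $ k)"
  by (rule holomorphic_fnI[where D="\<lambda>_ v. v $ k"])
     (auto intro: bounded_linear_imp_has_derivative bounded_linear_vec_nth)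

lemma holo_add [holo]:
  assumes "holomorphic_fn f" "holomorphic_fn g" shows "holomorphic_fn (\<lambda>p. f p + g p)"
  by (rule holomorphic_fnI[where D="\<lambda>p v. dird f p v + dird g p v"])
     (auto simp: dird_scale assms algebra_simps intro!: derivative_intros holomorphic_fn_has_derivative assms)

lemma holo_mult [holo]:
  assumes "holomorphic_fn f" "holomorphic_fn g" shows "holomorphic_fn (\<lambda>p. f p * g p)"
proof (rule holomorphic_fnI)
  show "((\<lambda>p. f p * g p) has_derivative (\<lambda>v. f p * dird g p v + dird f p v * g p)) (at p)" for p
    by (intro has_derivative_mult holomorphic_fn_has_derivative assms)
qed (simp add: dird_scale assms algebra_simps)

lemma holo_minus [holo]:
  assumes "holomorphic_fn f" shows "holomorphic_fn (\<lambda>p. - f p)"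
  using holo_mult[OF holo_const[of "-1"] assms] by simp

lemma holo_diff [holo]:
  assumes "holomorphic_fn f" "holomorphic_fn g" shows "holomorphic_fn (\<lambda>p. f p - g p)"
  using holo_add[OF assms(1) holo_minus[OF assms(2)]] by simp

lemma holo_sum [holo]:
  assumes "\<And>i. i \<in> A \<Longrightarrow> holomorphic_fn (f i)" shows "holomorphic_fn (\<lambda>p. \<Sum>i\<in>A. f i p)"
  using assms by (induction A rule: infinite_finite_induct) (auto intro!: holo)

lemma dird_const: "dird (\<lambda>p. c) p v = 0"
  by (rule dird_eqI[where D="\<lambda>_. 0"]) auto

lemma dird_nth: "dird (\<lambda>p. p $ k) p v = v $ k"
  by (rule dird_eqI) (auto intro: bounded_linear_imp_has_derivative bounded_linear_vec_nth)

lemma dird_add: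
  assumes "holomorphic_fn f" "holomorphic_fn g"
  shows "dird (\<lambda>p. f p + g p) p v = dird f p v + dird g p v"
  by (rule dird_eqI) (auto intro!: derivative_intros holomorphic_fn_has_derivative assms)

lemma dird_mult:
  assumes "holomorphic_fn f" "holomorphic_fn g"
  shows "dird (\<lambda>p. f p * g p) p v = dird f p v * g p + f p * dird g p v"
  by (subst dird_eqI[OF has_derivative_mult]) (auto intro!: holomorphic_fn_has_derivative assms)

lemma dird_minus:
  assumes "holomorphic_fn f" shows "dird (\<lambda>p. - f p) p v = - dird f p v"
  by (rule dird_eqI) (auto intro!: derivative_intros holomorphic_fn_has_derivative assms)

lemma dird_diff:
  assumes "holomorphic_fn f" "holomorphic_fn g"
  shows "dird (\<lambda>p. f p - g p) p v = dird f p v - dird g p v"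
  by (rule dird_eqI) (auto intro!: derivative_intros holomorphic_fn_has_derivative assms)

lemma dird_sum:
  assumes "\<And>i. i \<in> A \<Longrightarrow> holomorphic_fn (f i)"
  shows "dird (\<lambda>p. \<Sum>i\<in>A. f i p) p v = (\<Sum>i\<in>A. dird (f i) p v)"
  by (rule dird_eqI) (auto intro!: has_derivative_sum holomorphic_fn_has_derivative assms)

lemma bounded_linear_vscale: "bounded_linear (\<lambda>z::complex. z *s (v :: complex ^ 'k::finite))"
  by (rule linear_conv_bounded_linear[THEN iffD1], rule linearI) (auto simp: vec_eq_iff algebra_simps)

lemma holomorphic_line:
  assumes "holomorphic_fn g"
  shows "((\<lambda>z. g (q + z *s v)) has_field_derivative dird g (q + z *s v) v) (at z)"
proof -
  have "((\<lambda>z. q + z *s v) has_derivative (\<lambda>z. z *s v)) (at z)"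
    using bounded_linear_vscale[of v]
    by (auto intro!: derivative_eq_intros bounded_linear_imp_has_derivative)
  from has_derivative_compose[OF this holomorphic_fn_has_derivative[OF assms]]
  have "((\<lambda>z. g (q + z *s v)) has_derivative (\<lambda>h. dird g (q + z *s v) (h *s v))) (at z)" by simp
  moreover have "(\<lambda>h. dird g (q + z *s v) (h *s v)) = (*) (dird g (q + z *s v) v)"
    by (simp add: dird_scale[OF assms] fun_eq_iff)
  ultimately show ?thesis
    unfolding has_field_derivative_def by simp
qed

abbreviation circ :: "real \<Rightarrow> complex" where "circ x \<equiv> exp (2 * of_real pi * \<i> * of_real x)"

text \<open>Cauchy's formula on the unit circle of the complex line through \<open>q\<close> in direction \<open>v\<close>. It
  writes a derivative as an integral of values, so that regularity of derivatives becomes a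
  question of differentiation under the integral sign.\<close>

lemma dird_circle:
  assumes "holomorphic_fn g"
  shows "((\<lambda>x. g (q + circ x *s v) * inverse (circ x)) has_integral dird g q v) {0..1}"
proof -
  define h where "h z = g (q + z *s v)" for z
  have der: "(h has_field_derivative dird g (q + z *s v) v) (at z)" for z
    unfolding h_def by (rule holomorphic_line[OF assms])
  then have hol: "h holomorphic_on UNIV" unfolding holomorphic_on_def field_differentiable_def by (blast intro: has_field_derivative_at_within)
  have "(h has_field_derivative (1 / (2 * of_real pi * \<i>) * contour_integral (circlepath 0 1) (\<lambda>u. h u / (u-0)^2))) (at 0)"
    by (rule Cauchy_derivative_integral_circlepath(2))
       (auto intro: holomorphic_on_subset[OF hol] holomorphic_on_imp_continuous_on)
  with der[of 0] have eq: "dird g q v = 1 / (2 * of_real pi * \<i>) * contour_integral (circlepath 0 1) (\<lambda>u. h u / (u-0)^2)"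
    using DERIV_unique by force
  have "(\<lambda>u. h u / (u-0)^2) contour_integrable_on (circlepath 0 1)"
    by (rule Cauchy_derivative_integral_circlepath(1))
       (auto intro: holomorphic_on_subset[OF hol] holomorphic_on_imp_continuous_on)
  then have "((\<lambda>u. h u / (u-0)^2) has_contour_integral (2 * of_real pi * \<i> * dird g q v)) (circlepath 0 1)"
    using has_contour_integral_integral eq by (simp add: has_contour_integral_integral)
  then have "((\<lambda>x. h (circ x) / (circ x)^2 * (2 * of_real pi * \<i> * circ x)) has_integral (2 * of_real pi * \<i> * dird g q v)) {0..1}"
    unfolding has_contour_integral_def
    by (rule has_integral_eq[rotated])
       (simp only: atLeastAtMost_iff vector_derivative_circlepath01, simp add: circlepath)
  then have int: "((\<lambda>x. 1 / (2 * of_real pi * \<i>) * (h (circ x) / (circ x)^2 * (2 * of_real pi * \<i> * circ x)))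
      has_integral 1 / (2 * of_real pi * \<i>) * (2 * of_real pi * \<i> * dird g q v)) {0..1}"
    by (rule has_integral_mult_right)
  have 1: "1 / (2 * of_real pi * \<i>) * (a / e^2 * (2 * of_real pi * \<i> * e)) = a * inverse e"
    if "e \<noteq> 0" for a e :: complex
    using that by (simp add: divide_simps power2_eq_square)
  have 2: "1 / (2 * of_real pi * \<i>) * (2 * of_real pi * \<i> * a) = a" for a :: complex
    by simp
  show ?thesis using int unfolding 1[OF exp_not_eq_zero] 2 unfolding h_def .
qed

lemma continuous_on_holomorphic:
  assumes "holomorphic_fn g" shows "continuous_on A g"
  using holomorphic_fn_has_derivative[OF assms] 
  by (meson has_derivative_continuous continuous_at_imp_continuous_on)

lemma continuous_on_vscale:
  assumes "continuous_on A c" shows "continuous_on A (\<lambda>x. c x *s (v :: complex ^ 'k))"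
proof -
  have *: "(\<lambda>x. c x *s v) = (\<lambda>x. \<chi> i. c x * v $ i)" by (auto simp: vec_eq_iff)
  show ?thesis unfolding * by (intro continuous_intros assms)
qed

text \<open>The integrand of \<open>dird_circle\<close> depends continuously on \<open>q\<close>.\<close>

lemma continuous_dird:
  assumes "holomorphic_fn g" shows "continuous_on UNIV (\<lambda>q. dird g q v)"
proof -
  have "dird g q v = integral {0..1} (\<lambda>x. g (q + circ x *s v) * inverse (circ x))" for q
    by (rule integral_unique[OF dird_circle[OF assms], symmetric])
  moreover have "continuous_on UNIV (\<lambda>q. integral (cbox 0 1) (\<lambda>x. g (q + circ x *s v) * inverse (circ x)))"
  proof (rule integral_continuous_on_param)
    show "continuous_on (UNIV \<times> cbox 0 1) (\<lambda>(q, x). g (q + circ x *s v) * inverse (circ x))"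
      unfolding case_prod_beta
      by (intro continuous_intros continuous_on_vscale
          continuous_on_compose2[OF continuous_on_holomorphic[OF assms, of UNIV]] subset_UNIV ballI
          exp_not_eq_zero)
  qed
  ultimately show ?thesis by simp
qed

text \<open>Leibniz's rule needs a continuous derivative of the integrand; \<open>continuous_dird\<close> supplies
  it in each direction, which suffices in finite dimension.\<close>

lemma dird_circle_derivative:
  assumes "holomorphic_fn g"
  shows "((\<lambda>q. dird g q v) has_derivative
           (\<lambda>w. integral {0..1} (\<lambda>x. dird g (q + circ x *s v) w * inverse (circ x)))) (at q)"
proof -
  define Dg where "Dg q = Blinfun (dird g q)" for q
  have Dg: "blinfun_apply (Dg q) = dird g q" for q
    unfolding Dg_def
    by (rule bounded_linear_Blinfun_apply)
       (use holomorphic_fn_has_derivative[OF assms] has_derivative_bounded_linear in blast)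
  have contDg: "continuous_on UNIV Dg"
    by (rule continuous_on_blinfun_componentwise) (simp add: Dg continuous_dird assms)
  define F where "F q x = g (q + circ x *s v) * inverse (circ x)" for q x
  define F' where "F' q x = (blinfun_mult_left (inverse (circ x)) o\<^sub>L Dg (q + circ x *s v))" for q x
  have F'_apply: "blinfun_apply (F' q x) w = dird g (q + circ x *s v) w * inverse (circ x)" for q x w
    by (simp add: F'_def Dg)
  have F_der: "((\<lambda>q. F q x) has_derivative blinfun_apply (F' q x)) (at q within UNIV)" for q x
  proof -
    have "((\<lambda>q. q + circ x *s v) has_derivative (\<lambda>w. w)) (at q)"
      by (auto intro!: derivative_eq_intros)
    from has_derivative_compose[OF this holomorphic_fn_has_derivative[OF assms]]
    have "((\<lambda>q. g (q + circ x *s v)) has_derivative dird g (q + circ x *s v)) (at q)" by simp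
    from has_derivative_mult_left[OF this]
    show ?thesis unfolding F_def by (simp add: F'_apply[abs_def] )
  qed
  have cont: "continuous_on (UNIV \<times> cbox 0 1) (\<lambda>(q, x). F' q x)"
    unfolding F'_def case_prod_beta
    by (intro continuous_intros continuous_on_compose2[OF contDg] continuous_on_vscale subset_UNIV ballI exp_not_eq_zero)
  have integ: "F q integrable_on cbox 0 1" for q
    using dird_circle[OF assms, of q v] unfolding F_def by auto
  have lr: "((\<lambda>q. integral (cbox 0 1) (F q)) has_derivative blinfun_apply (integral (cbox 0 1) (F' q))) (at q within UNIV)"
    by (rule leibniz_rule[OF F_der integ cont]) auto
  have eqF: "integral (cbox 0 1) (F q) = dird g q v" for q
    using dird_circle[OF assms, of q v] unfolding F_def by (auto intro: integral_unique)
  have "continuous_on (cbox 0 1) (F' q)"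
    unfolding F'_def
    by (intro continuous_intros continuous_on_compose2[OF contDg] continuous_on_vscale subset_UNIV ballI exp_not_eq_zero)
  then have iF': "F' q integrable_on cbox 0 1" by (rule integrable_continuous)
  have "blinfun_apply (integral (cbox 0 1) (F' q)) w
      = integral (cbox 0 1) (\<lambda>x. blinfun_apply (F' q x) w)" for w
    by (rule integral_linear[OF iF' blinfun.bounded_linear_left, unfolded o_def, symmetric])
  note apply_integral = this
  have *: "blinfun_apply (integral (cbox 0 1) (F' q))
      = (\<lambda>w. integral {0..1} (\<lambda>x. dird g (q + circ x *s v) w * inverse (circ x)))"
    unfolding cbox_interval[symmetric] by (intro ext) (simp only: apply_integral F'_apply)
  show ?thesis using lr unfolding eqF * .
qed

lemma holo_dird [holo]:
  assumes "holomorphic_fn g" shows "holomorphic_fn (\<lambda>q. dird g q v)"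
  by (rule holomorphic_fnI[OF dird_circle_derivative[OF assms]])
     (simp add: dird_scale assms mult.assoc)

text \<open>Differentiating the circle integral for the direction \<open>v\<close> along \<open>w\<close> leaves the circle
  integral of the function \<open>dird g q w\<close>, which Cauchy's formula identifies with its derivative
  along \<open>v\<close>.\<close>

lemma dird_commute:
  assumes "holomorphic_fn g"
  shows "dird (\<lambda>q. dird g q v) p w = dird (\<lambda>q. dird g q w) p v"
proof -
  have "dird (\<lambda>q. dird g q v) p w = integral {0..1} (\<lambda>x. dird g (p + circ x *s v) w * inverse (circ x))"
    by (rule dird_eqI[OF dird_circle_derivative[OF assms]])
  also have "\<dots> = dird (\<lambda>q. dird g q w) p v"
    using dird_circle[OF holo_dird[OF assms, of w], of p v] by (rule integral_unique)
  finally show ?thesis .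
qed

lemma dird_zero_imp_const:
  assumes "holomorphic_fn g" "\<And>p k. dird g p (axis k 1) = 0"
  shows "g p = g q"
proof -
  have "frechet_derivative g (at x) = (\<lambda>v. 0)" for x
    by (intro ext, subst dird_expand[OF assms(1)]) (simp add: assms(2))
  then have "(g has_derivative (\<lambda>_. 0)) (at x within UNIV)" for x
    using holomorphic_fn_has_derivative[OF assms(1), of x] by simp
  then show ?thesis
    using has_derivative_zero_unique[of UNIV g p q] by auto
qed

section \<open>The dual cubic\<close>

lemma sym4_expand:
  fixes T :: "'m \<Rightarrow> 'm \<Rightarrow> 'm \<Rightarrow> 'm \<Rightarrow> complex"
  assumes s: "i 0 = d" "i (Suc 0) = e" "i 2 = f" "i 3 = g"
  shows "24 * sym4 T i =
    T d e f g + T d e g f + T d f e g + T d f g e + T d g e f + T d g f e +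
    T e d f g + T e d g f + T e f d g + T e f g d + T e g d f + T e g f d +
    T f d e g + T f d g e + T f e d g + T f e g d + T f g d e + T f g e d +
    T g d e f + T g d f e + T g e d f + T g e f d + T g f d e + T g f e d"
proof -
  have *: "{..<4::nat} = insert 0 (insert 1 (insert 2 (insert 3 {})))" by auto
  have "sym4 T i * 24 = (\<Sum>\<pi> | \<pi> permutes {..<4::nat}. T (i (\<pi> 0)) (i (\<pi> 1)) (i (\<pi> 2)) (i (\<pi> 3)))"
    by (simp add: sym4_def fact_numeral)
  also have "\<dots> = T d e f g + T d e g f + T d f e g + T d f g e + T d g e f + T d g f e +
    T e d f g + T e d g f + T e f d g + T e f g d + T e g d f + T e g f d +
    T f d e g + T f d g e + T f e d g + T f e g d + T f g d e + T f g e d +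
    T g d e f + T g d f e + T g e d f + T g e f d + T g f d e + T g f e d"
    unfolding * by (simp add: sum_over_permutations_insert transpose_def s)
  finally show ?thesis by (simp add: mult.commute)
qed

definition polar :: "'m::finite tensor3 \<Rightarrow> ('m \<Rightarrow> complex) \<Rightarrow> ('m \<Rightarrow> complex) \<Rightarrow> 'm \<Rightarrow> complex" where
  "polar T x y a = (\<Sum>b\<in>UNIV. \<Sum>c\<in>UNIV. T a b c * x b * y c)"

definition dot :: "('m::finite \<Rightarrow> complex) \<Rightarrow> ('m \<Rightarrow> complex) \<Rightarrow> complex" where
  "dot x y = (\<Sum>a\<in>UNIV. x a * y a)"

definition delta :: "'m \<Rightarrow> 'm \<Rightarrow> complex" where "delta a b = (if a = b then 1 else 0)"

lemma sum_delta [simp]: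
  fixes h :: "'m::finite \<Rightarrow> complex"
  shows "(\<Sum>a\<in>UNIV. delta a b * h a) = h b" "(\<Sum>a\<in>UNIV. delta b a * h a) = h b"
    "(\<Sum>a\<in>UNIV. h a * delta a b) = h b" "(\<Sum>a\<in>UNIV. h a * delta b a) = h b"
  by (simp_all add: delta_def if_distrib[of "\<lambda>x. x * _"] if_distrib[of "\<lambda>x. _ * x"] cong: if_cong)

lemma sum_delta_mid [simp]:
  fixes h k :: "'m::finite \<Rightarrow> complex"
  shows "(\<Sum>a\<in>UNIV. h a * (delta a b * k a)) = h b * k b" "(\<Sum>a\<in>UNIV. h a * (delta b a * k a)) = h b * k b"
    "(\<Sum>a\<in>UNIV. h a * delta a b * k a) = h b * k b" "(\<Sum>a\<in>UNIV. h a * delta b a * k a) = h b * k b"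
    "(\<Sum>a\<in>UNIV. h a * (k a * delta a b)) = h b * k b" "(\<Sum>a\<in>UNIV. h a * (k a * delta b a)) = h b * k b"
    "(\<Sum>a\<in>UNIV. delta a b * h a * k a) = h b * k b" "(\<Sum>a\<in>UNIV. delta b a * h a * k a) = h b * k b"
  using sum_delta[where h="\<lambda>a. h a * k a" and b=b] by (simp_all add: mult_ac)

lemma symmetric3_swap:
  assumes "symmetric3 C" shows "C a b c = C b a c" "C a b c = C a c b"
  using assms unfolding symmetric3_def by blast+

text \<open>The tensor \<open>D\<^sup>a\<^sup>b\<^sup>c C\<^sub>b\<^sub>d\<^sub>e C\<^sub>c\<^sub>f\<^sub>g\<close> is invariant under the exchanges \<open>d \<leftrightarrow> e\<close>, \<open>f \<leftrightarrow> g\<close> and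
  \<open>de \<leftrightarrow> fg\<close>, so its 24 permutations are three pairings counted eight times. On the other side
  each of the four positions of the Kronecker symbol is counted six times, and
  \<open>4/27 \<cdot> 6/8 = 1/9\<close>.\<close>

lemma dual_cubic_index:
  fixes C D :: "'m::finite tensor3"
  assumes C: "symmetric3 C" and dual: "dual_cubic C D"
  shows "(\<Sum>b\<in>UNIV. \<Sum>c\<in>UNIV. D a b c * C b d e * C c f g) + (\<Sum>b\<in>UNIV. \<Sum>c\<in>UNIV. D a b c * C b d f * C c e g)
       + (\<Sum>b\<in>UNIV. \<Sum>c\<in>UNIV. D a b c * C b d g * C c e f)
       = 1/9 * (C d e f * delta g a + C d e g * delta f a + C d f g * delta e a + C e f g * delta d a)"
proof -
  define F where "F d e f g = (\<Sum>b\<in>UNIV. \<Sum>c\<in>UNIV. D a b c * C b d e * C c f g)" for d e f g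
  have D: "symmetric3 D" using dual unfolding dual_cubic_def by blast
  have F1: "F d e f g = F e d f g" for d e f g unfolding F_def by (simp add: symmetric3_swap(2)[OF C, of _ d e])
  have F2: "F d e f g = F d e g f" for d e f g unfolding F_def by (simp add: symmetric3_swap(2)[OF C, of _ f g])
  have F3: "F d e f g = F f g d e" for d e f g
    unfolding F_def by (subst sum.swap) (simp add: symmetric3_swap(2)[OF D, of a] mult_ac)
  define i :: "nat \<Rightarrow> 'm" where "i n = (if n = 0 then d else if n = 1 then e else if n = 2 then f else g)" for n
  have i: "i 0 = d" "i (Suc 0) = e" "i 2 = f" "i 3 = g" by (auto simp: i_def)
  have Fs: "F d e g f = F d e f g" "F d f g e = F d f e g" "F d g f e = F d g e f" "F e d f g = F d e f g"
      "F e d g f = F d e f g" "F e f d g = F d g e f" "F e f g d = F d g e f" "F e g d f = F d f e g"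
      "F e g f d = F d f e g" "F f d e g = F d f e g" "F f d g e = F d f e g" "F f e d g = F d g e f"
      "F f e g d = F d g e f" "F f g d e = F d e f g" "F f g e d = F d e f g" "F g d e f = F d g e f"
      "F g d f e = F d g e f" "F g e d f = F d f e g" "F g e f d = F d f e g" "F g f d e = F d e f g"
      "F g f e d = F d e f g"
    by (metis F1 F2 F3)+
  have Cs: "C d f e = C d e f" "C e d f = C d e f" "C e f d = C d e f" "C f d e = C d e f"
      "C f e d = C d e f" "C d g e = C d e g" "C e d g = C d e g" "C e g d = C d e g"
      "C g d e = C d e g" "C g e d = C d e g" "C d g f = C d f g" "C f d g = C d f g"
      "C f g d = C d f g" "C g d f = C d f g" "C g f d = C d f g" "C e g f = C e f g"
      "C f e g = C e f g" "C f g e = C e f g" "C g e f = C e f g" "C g f e = C e f g"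
    by (simp add: symmetric3_swap[OF C])+
  have "sym4 F i = 4/27 * sym4 (\<lambda>d e f g. C d e f * delta g a) i"
    using dual unfolding dual_cubic_def F_def delta_def by blast
  then have "24 * sym4 F i = 4/27 * (24 * sym4 (\<lambda>d e f g. C d e f * delta g a) i)"
    by (simp only: mult.left_commute)
  then have "8 * (F d e f g + F d f e g + F d g e f)
     = 4/27 * (6 * (C d e f * delta g a + C d e g * delta f a + C d f g * delta e a + C e f g * delta d a))"
    unfolding sym4_expand[of i, OF i] Fs Cs by (simp add: algebra_simps)
  moreover have "8 * x = 4/27 * (6 * y) \<Longrightarrow> x = 1/9 * y" for x y :: complex
    by (simp add: field_simps)
  ultimately show ?thesis unfolding F_def by blast
qed

lemma sum_pull2:
  fixes w :: "'m::finite \<Rightarrow> complex"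
  shows "(\<Sum>g\<in>UNIV. w g * (\<Sum>b\<in>UNIV. \<Sum>c\<in>UNIV. h b c g))
     = (\<Sum>b\<in>(UNIV::'m set). \<Sum>c\<in>(UNIV::'m set). \<Sum>g\<in>UNIV. w g * h b c g)"
proof -
  have "(\<Sum>g\<in>UNIV. w g * (\<Sum>b\<in>UNIV. \<Sum>c\<in>UNIV. h b c g))
     = (\<Sum>g\<in>UNIV. \<Sum>b\<in>(UNIV::'m set). \<Sum>c\<in>(UNIV::'m set). w g * h b c g)"
    by (simp add: sum_distrib_left)
  also have "\<dots> = (\<Sum>b\<in>(UNIV::'m set). \<Sum>g\<in>UNIV. \<Sum>c\<in>(UNIV::'m set). w g * h b c g)"
    by (rule sum.swap)
  also have "\<dots> = (\<Sum>b\<in>(UNIV::'m set). \<Sum>c\<in>(UNIV::'m set). \<Sum>g\<in>UNIV. w g * h b c g)"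
    by (rule sum.cong[OF refl], rule sum.swap)
  finally show ?thesis .
qed

definition quad4 :: "('m::finite \<Rightarrow> complex) \<Rightarrow> ('m \<Rightarrow> complex) \<Rightarrow> ('m \<Rightarrow> 'm \<Rightarrow> 'm \<Rightarrow> 'm \<Rightarrow> complex) \<Rightarrow> complex" where
  "quad4 x t h = (\<Sum>d\<in>UNIV. x d * (\<Sum>e\<in>UNIV. t e * (\<Sum>f\<in>UNIV. t f * (\<Sum>g\<in>UNIV. t g * h d e f g))))"

lemma quad4_add: "quad4 x t (\<lambda>d e f g. h d e f g + k d e f g) = quad4 x t h + quad4 x t k"
  by (simp add: quad4_def algebra_simps sum.distrib)

lemma quad4_scale: "quad4 x t (\<lambda>d e f g. c * h d e f g) = c * quad4 x t h"
  by (simp add: quad4_def sum_distrib_left mult_ac)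

lemma quad4_swap_ef: "quad4 x t (\<lambda>d e f g. h d f e g) = quad4 x t h"
proof -
  have "(\<Sum>e\<in>UNIV. t e * (\<Sum>f\<in>UNIV. t f * (\<Sum>g\<in>UNIV. t g * h d f e g)))
      = (\<Sum>e\<in>UNIV. t e * (\<Sum>f\<in>UNIV. t f * (\<Sum>g\<in>UNIV. t g * h d e f g)))" for d
    unfolding sum_distrib_left by (subst sum.swap) (simp add: mult_ac)
  then show ?thesis by (simp add: quad4_def)
qed

lemma quad4_swap_fg: "quad4 x t (\<lambda>d e f g. h d e g f) = quad4 x t h"
proof -
  have "(\<Sum>f\<in>UNIV. t f * (\<Sum>g\<in>UNIV. t g * h d e g f))
      = (\<Sum>f\<in>UNIV. t f * (\<Sum>g\<in>UNIV. t g * h d e f g))" for d e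
    unfolding sum_distrib_left by (subst sum.swap) (simp add: mult_ac)
  then show ?thesis by (simp add: quad4_def)
qed

lemma quad4_polar:
  "quad4 x t (\<lambda>d e f g. \<Sum>b\<in>UNIV. \<Sum>c\<in>UNIV. D a b c * C b d e * C c f g) = polar D (polar C x t) (polar C t t) a"
proof -
  have 1: "(\<Sum>f\<in>UNIV. t f * (\<Sum>g\<in>UNIV. t g * (k * C c f g))) = k * polar C t t c" for k c
    by (simp add: polar_def sum_distrib_left mult_ac)
  have 2: "(\<Sum>d\<in>UNIV. x d * (\<Sum>e\<in>UNIV. t e * (k * C b d e * l))) = k * polar C x t b * l" for k l b
    by (simp add: polar_def sum_distrib_left mult_ac)
  show ?thesis
    unfolding quad4_def sum_pull2 1 2 by (simp add: polar_def[of D])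
qed

lemma polar_commute: "symmetric3 T \<Longrightarrow> polar T x y a = polar T y x a"
  unfolding polar_def by (subst sum.swap) (simp add: symmetric3_swap(2)[of T a] mult_ac)

lemma dot_commute: "dot x y = dot y x"
  by (simp add: dot_def mult.commute)

lemma dot_polar_commute:
  assumes "symmetric3 T" shows "dot x (polar T y z) = dot y (polar T x z)"
proof -
  have "dot x (polar T y z) = (\<Sum>a\<in>UNIV. \<Sum>b\<in>UNIV. \<Sum>c\<in>UNIV. x a * T a b c * y b * z c)"
    by (simp add: dot_def polar_def sum_distrib_left mult_ac)
  also have "\<dots> = (\<Sum>b\<in>UNIV. \<Sum>a\<in>UNIV. \<Sum>c\<in>UNIV. x a * T a b c * y b * z c)"
    by (rule sum.swap)
  also have "\<dots> = dot y (polar T x z)"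
    by (simp add: dot_def polar_def sum_distrib_left mult_ac symmetric3_swap(1)[OF assms])
  finally show ?thesis .
qed

lemma cubic_dot: "cubic T t = dot t (polar T t t)"
  by (simp add: cubic_def dot_def polar_def sum_distrib_left mult_ac)

lemma cubic1_polar: "cubic1 T a t = polar T t t a"
  by (simp add: cubic1_def polar_def)

text \<open>Contracting \<open>dual_cubic_index\<close> with \<open>x, t, t, t\<close> makes the three pairings equal. For
  \<open>x = t\<close> the identity reads \<open>D(C(t\<^sup>2)\<^sup>2) = 4/27 C(t\<^sup>3) t\<close>, the counterpart of the adjoint identity
  of cubic Jordan algebras.\<close>

theorem dual_cubic_star:
  assumes C: "symmetric3 C" and dual: "dual_cubic C D"
  shows "polar D (polar C x t) (polar C t t) a = 1/9 * dot x (polar C t t) * t a + 1/27 * cubic C t * x a"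
proof -
  define h where "h d e f g = (\<Sum>b\<in>UNIV. \<Sum>c\<in>UNIV. D a b c * C b d e * C c f g)" for d e f g
  have 1: "quad4 x t (\<lambda>d e f g. h d e f g + h d f e g + h d g e f) = 3 * polar D (polar C x t) (polar C t t) a"
  proof -
    have "quad4 x t (\<lambda>d e f g. h d g e f) = quad4 x t (\<lambda>d e f g. h d f e g)"
      by (rule quad4_swap_fg[of x t "\<lambda>d e f g. h d f e g"])
    then show ?thesis
      unfolding quad4_add quad4_swap_ef[of x t h] using quad4_polar[of x t D a C]
      by (simp add: h_def[abs_def])
  qed
  have "quad4 x t (\<lambda>d e f g. h d e f g + h d f e g + h d g e f)
     = quad4 x t (\<lambda>d e f g. 1/9 * (C d e f * delta g a + C d e g * delta f a + C d f g * delta e a + C e f g * delta d a))"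
    unfolding h_def by (simp only: dual_cubic_index[OF C dual])
  also have "\<dots> = 1/9 * (3 * quad4 x t (\<lambda>d e f g. C d e f * delta g a) + quad4 x t (\<lambda>d e f g. C e f g * delta d a))"
    unfolding quad4_scale quad4_add
    using quad4_swap_fg[of x t "\<lambda>d e f g. C d e f * delta g a"]
      quad4_swap_ef[of x t "\<lambda>d e f g. C d e g * delta f a"] by simp
  also have "quad4 x t (\<lambda>d e f g. C d e f * delta g a) = dot x (polar C t t) * t a"
  proof -
    have "(\<Sum>g\<in>UNIV. t g * (k * delta g a)) = k * t a" for k
      using sum_delta(3)[of "\<lambda>g. t g * k" a] by (simp add: mult_ac)
    then show ?thesis
      unfolding quad4_def by (simp only:) (simp add: dot_def polar_def sum_distrib_left sum_distrib_right mult_ac)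
  qed
  also have "quad4 x t (\<lambda>d e f g. C e f g * delta d a) = cubic C t * x a"
  proof -
    have "(\<Sum>e\<in>UNIV. t e * (\<Sum>f\<in>UNIV. t f * (\<Sum>g\<in>UNIV. t g * (C e f g * delta d a)))) = delta d a * cubic C t" for d
      by (simp add: cubic_def sum_distrib_left mult_ac)
    then show ?thesis unfolding quad4_def by (simp only:) (simp add: mult_ac)
  qed
  finally show ?thesis using 1 by (simp add: field_simps)
qed

section \<open>Infinitesimal similarities\<close>

text \<open>The derivative of the cubic along the linear vector field \<open>x \<mapsto> B x\<close> is \<open>c\<close> times the
  cubic, in polarized form.\<close>

definition similarity :: "'m::finite tensor3 \<Rightarrow> ('m \<Rightarrow> 'm \<Rightarrow> complex) \<Rightarrow> complex \<Rightarrow> bool" where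
  "similarity C B c \<longleftrightarrow>
     (\<forall>d e f. (\<Sum>k\<in>UNIV. C k e f * B k d + C d k f * B k e + C d e k * B k f) = c * C d e f)"

definition mat_trace :: "('m::finite \<Rightarrow> 'm \<Rightarrow> complex) \<Rightarrow> complex" where "mat_trace B = (\<Sum>a\<in>UNIV. B a a)"

definition mat_mult :: "('m::finite \<Rightarrow> 'm \<Rightarrow> complex) \<Rightarrow> ('m \<Rightarrow> 'm \<Rightarrow> complex) \<Rightarrow> 'm \<Rightarrow> 'm \<Rightarrow> complex" where
  "mat_mult A B a b = (\<Sum>k\<in>UNIV. A a k * B k b)"

text \<open>This operator on matrices is the contribution of the term \<open>9/4 C\<^sub>a(X\<^sup>2) D\<^sup>a(P\<^sup>2)\<close> of the top
  generator to the symmetries of degree zero.\<close>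

definition twist :: "'m::finite tensor3 \<Rightarrow> 'm tensor3 \<Rightarrow> ('m \<Rightarrow> 'm \<Rightarrow> complex) \<Rightarrow> 'm \<Rightarrow> 'm \<Rightarrow> complex" where
  "twist C D B b f = (\<Sum>a\<in>UNIV. \<Sum>c\<in>UNIV. \<Sum>g\<in>UNIV. D a b c * C c f g * B g a)"

text \<open>The image of the identity under \<open>twist\<close>. It need not be a multiple of the identity: for
  the form \<open>\<langle>v,v\<rangle>\<lambda>\<close> on \<open>\<complex>\<^sup>m \<oplus> \<complex>\<close> its eigenvalues are \<open>2/9\<close> and \<open>m/9\<close>.\<close>

definition ricci :: "'m::finite tensor3 \<Rightarrow> 'm tensor3 \<Rightarrow> 'm \<Rightarrow> 'm \<Rightarrow> complex" where
  "ricci C D b f = (\<Sum>a\<in>UNIV. \<Sum>c\<in>UNIV. D a b c * C c f a)"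

lemma sum_swap3:
  "(\<Sum>a\<in>A. \<Sum>b\<in>B. \<Sum>c\<in>E. h a b c) = (\<Sum>c\<in>E. \<Sum>a\<in>A. \<Sum>b\<in>B. h a b c)"
proof -
  have "(\<Sum>a\<in>A. \<Sum>b\<in>B. \<Sum>c\<in>E. h a b c) = (\<Sum>a\<in>A. \<Sum>c\<in>E. \<Sum>b\<in>B. h a b c)"
    by (rule sum.cong[OF refl], rule sum.swap)
  also have "\<dots> = (\<Sum>c\<in>E. \<Sum>a\<in>A. \<Sum>b\<in>B. h a b c)" by (rule sum.swap)
  finally show ?thesis .
qed

lemma similarity_lin:
  assumes "similarity C A c" "similarity C B d"
  shows "similarity C (\<lambda>a b. r * A a b + s * B a b) (r * c + s * d)"
proof -
  have "(\<Sum>k\<in>UNIV. C k e f * (r * A k d + s * B k d) + C d k f * (r * A k e + s * B k e) + C d e k * (r * A k f + s * B k f))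
      = r * (\<Sum>k\<in>UNIV. C k e f * A k d + C d k f * A k e + C d e k * A k f)
      + s * (\<Sum>k\<in>UNIV. C k e f * B k d + C d k f * B k e + C d e k * B k f)" for d e f
    by (simp add: sum.distrib sum_distrib_left algebra_simps)
  then show ?thesis using assms unfolding similarity_def by (simp only:) (simp add: algebra_simps)
qed

lemma similarity_delta: "similarity C delta 3"
  by (simp add: similarity_def sum.distrib)

lemma twist_delta: "twist C D delta = ricci C D"
  by (intro ext) (simp add: twist_def ricci_def)

text \<open>Contract two of the three lower indices of the similarity equation with \<open>D\<close>. The terms in
  which \<open>B\<close> acts on a contracted index give \<open>twist C D B\<close>, the third one a matrix product.\<close>

lemma twist_of_similarity:
  assumes C: "symmetric3 C" and D: "symmetric3 D" and B: "similarity C B c"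
  shows "2 * twist C D B h f = c * ricci C D h f - mat_mult (ricci C D) B h f"
proof -
  have "(\<Sum>d\<in>UNIV. \<Sum>e\<in>UNIV. D d h e * (\<Sum>k\<in>UNIV. C k e f * B k d + C d k f * B k e + C d e k * B k f))
      = (\<Sum>d\<in>UNIV. \<Sum>e\<in>UNIV. D d h e * (c * C d e f))"
    using B unfolding similarity_def by simp
  also have "\<dots> = c * ricci C D h f"
    unfolding ricci_def sum_distrib_left
    by (intro sum.cong refl) (simp add: symmetric3_swap[OF C] mult_ac)
  also have "(\<Sum>d\<in>UNIV. \<Sum>e\<in>UNIV. D d h e * (\<Sum>k\<in>UNIV. C k e f * B k d + C d k f * B k e + C d e k * B k f))
     = (\<Sum>d\<in>UNIV. \<Sum>e\<in>UNIV. \<Sum>k\<in>UNIV. D d h e * C k e f * B k d)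
     + (\<Sum>d\<in>UNIV. \<Sum>e\<in>UNIV. \<Sum>k\<in>UNIV. D d h e * C d k f * B k e)
     + (\<Sum>d\<in>UNIV. \<Sum>e\<in>UNIV. \<Sum>k\<in>UNIV. D d h e * C d e k * B k f)"
    by (simp add: sum.distrib sum_distrib_left algebra_simps)
  also have "(\<Sum>d\<in>UNIV. \<Sum>e\<in>UNIV. \<Sum>k\<in>UNIV. D d h e * C k e f * B k d) = twist C D B h f"
    unfolding twist_def by (intro sum.cong refl) (simp add: symmetric3_swap[OF C])
  also have "(\<Sum>d\<in>UNIV. \<Sum>e\<in>UNIV. \<Sum>k\<in>UNIV. D d h e * C d k f * B k e) = twist C D B h f"
    unfolding twist_def by (subst sum.swap, intro sum.cong refl) (simp add: symmetric3_swap[OF C] symmetric3_swap[OF D])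
  also have "(\<Sum>d\<in>UNIV. \<Sum>e\<in>UNIV. \<Sum>k\<in>UNIV. D d h e * C d e k * B k f) = mat_mult (ricci C D) B h f"
    unfolding mat_mult_def ricci_def sum_distrib_right
    by (subst sum_swap3, intro sum.cong refl) (simp add: symmetric3_swap[OF C])
  finally show ?thesis by (simp add: algebra_simps)
qed

text \<open>Contract \<open>dual_cubic_index\<close> with \<open>B\<close>: the three pairings become the action of
  \<open>twist C D B\<close> on the cubic, and the four terms on the right become, up to the factor \<open>1/9\<close>, the
  cubic multiplied by the trace of \<open>B\<close> plus the action of \<open>B\<close> on the cubic.\<close>

lemma similarity_twist:
  assumes C: "symmetric3 C" and D: "symmetric3 D" and dual: "dual_cubic C D" and B: "similarity C B c"
  shows "similarity C (twist C D B) ((mat_trace B + c) / 9)"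
  unfolding similarity_def
proof (intro allI)
  fix d e f
  have contr: "(\<Sum>a\<in>UNIV. \<Sum>g\<in>UNIV. B g a * (\<Sum>b\<in>UNIV. \<Sum>c\<in>UNIV. D a b c * C b d e * C c f g))
     = (\<Sum>k\<in>UNIV. C k d e * twist C D B k f)" for d e f
  proof -
    have "(\<Sum>a\<in>UNIV. \<Sum>g\<in>UNIV. B g a * (\<Sum>b\<in>UNIV. \<Sum>c\<in>UNIV. D a b c * C b d e * C c f g))
      = (\<Sum>a\<in>UNIV. \<Sum>b\<in>UNIV. \<Sum>c\<in>UNIV. \<Sum>g\<in>UNIV. B g a * (D a b c * C b d e * C c f g))"
      unfolding sum_pull2 ..
    also have "\<dots> = (\<Sum>b\<in>UNIV. \<Sum>a\<in>UNIV. \<Sum>c\<in>UNIV. \<Sum>g\<in>UNIV. B g a * (D a b c * C b d e * C c f g))"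
      by (rule sum.swap)
    also have "\<dots> = (\<Sum>k\<in>UNIV. C k d e * twist C D B k f)"
      unfolding twist_def sum_distrib_left by (simp add: mult_ac)
    finally show ?thesis .
  qed
  have inv: "(\<Sum>k\<in>UNIV. C k e f * B k d) + (\<Sum>k\<in>UNIV. C d k f * B k e) + (\<Sum>k\<in>UNIV. C d e k * B k f) = c * C d e f"
    using B unfolding similarity_def by (simp add: sum.distrib)
  have rhs: "(\<Sum>a\<in>UNIV. \<Sum>g\<in>UNIV. B g a * (1/9 * (C d e f * delta g a + C d e g * delta f a + C d f g * delta e a + C e f g * delta d a)))
     = 1/9 * ((\<Sum>a\<in>UNIV. \<Sum>g\<in>UNIV. B g a * C d e f * delta g a) + (\<Sum>g\<in>UNIV. \<Sum>a\<in>UNIV. B g a * C d e g * delta f a)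
       + (\<Sum>g\<in>UNIV. \<Sum>a\<in>UNIV. B g a * C d f g * delta e a) + (\<Sum>g\<in>UNIV. \<Sum>a\<in>UNIV. B g a * C e f g * delta d a))"
    unfolding sum.swap[of "\<lambda>g a. B g a * C _ _ g * delta _ a"]
    by (simp only: sum.distrib sum_distrib_left distrib_left mult_ac)
  also have "\<dots> = 1/9 * (mat_trace B * C d e f + ((\<Sum>k\<in>UNIV. C d e k * B k f) + (\<Sum>k\<in>UNIV. C d f k * B k e) + (\<Sum>k\<in>UNIV. C e f k * B k d)))"
    by (simp add: mat_trace_def sum_distrib_left mult_ac)
  also have "\<dots> = (mat_trace B + c) / 9 * C d e f"
    using inv symmetric3_swap[OF C] by (simp add: algebra_simps)
  finally have rhs: "(\<Sum>a\<in>UNIV. \<Sum>g\<in>UNIV. B g a * (1/9 * (C d e f * delta g a + C d e g * delta f a + C d f g * delta e a + C e f g * delta d a)))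
     = (mat_trace B + c) / 9 * C d e f" .
  have "(\<Sum>k\<in>UNIV. C k d e * twist C D B k f) + (\<Sum>k\<in>UNIV. C k d f * twist C D B k e)
      + (\<Sum>k\<in>UNIV. C k e f * twist C D B k d) = (mat_trace B + c) / 9 * C d e f"
  proof -
    have sw: "(\<Sum>b\<in>UNIV. \<Sum>c\<in>UNIV. D a b c * C b d g * C c e f) = (\<Sum>b\<in>UNIV. \<Sum>c\<in>UNIV. D a b c * C b e f * C c d g)" for a g
      by (subst sum.swap) (simp add: symmetric3_swap(2)[OF D, of a] mult_ac)
    show ?thesis
      unfolding rhs[symmetric] dual_cubic_index[OF C dual, symmetric] contr[symmetric]
      by (simp only: sw distrib_left sum.distrib)
  qed
  then show "(\<Sum>k\<in>UNIV. C k e f * twist C D B k d + C d k f * twist C D B k e + C d e k * twist C D B k f)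
      = (mat_trace B + c) / 9 * C d e f"
    unfolding sum.distrib using symmetric3_swap[OF C] by (simp add: add_ac)
qed

lemma mat_mult_delta [simp]: "mat_mult A delta = A" "mat_mult delta A = A"
  by (intro ext, simp add: mat_mult_def)+

lemma mat_mult_assoc: "mat_mult (mat_mult A B) E = mat_mult A (mat_mult B E)"
  by (intro ext) (simp add: mat_mult_def sum_distrib_left sum_distrib_right mult_ac sum.swap[of "\<lambda>i j. A _ j * _ j i"])

lemma mat_trace_delta: "mat_trace (delta :: 'm::finite \<Rightarrow> 'm \<Rightarrow> complex) = of_nat CARD('m)"
  by (simp add: mat_trace_def delta_def)

lemma similarity_ricci:
  fixes C D :: "'m::finite tensor3"
  assumes C: "symmetric3 C" and D: "symmetric3 D" and dual: "dual_cubic C D"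
  shows "similarity C (ricci C D) ((of_nat CARD('m) + 3) / 9)"
  using similarity_twist[OF assms similarity_delta] by (simp add: twist_delta mat_trace_delta)

lemma similarity_ricci_mat_mult:
  assumes C: "symmetric3 C" and D: "symmetric3 D" and dual: "dual_cubic C D" and B: "similarity C B c"
  shows "\<exists>c'. similarity C (mat_mult (ricci C D) B) c'"
proof -
  have "mat_mult (ricci C D) B = (\<lambda>h f. c * ricci C D h f + (- 2) * twist C D B h f)"
    using twist_of_similarity[OF C D B] by (intro ext) (simp add: algebra_simps)
  then show ?thesis
    using similarity_lin[OF similarity_ricci[OF C D dual] similarity_twist[OF C D dual B], of c "- 2"]
    by (simp only:) blast
qed

text \<open>Contract three lower indices of \<open>dual_cubic_index\<close> with \<open>D\<close>; each of the three pairings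
  then gives \<open>twist C D (ricci C D)\<close>.\<close>

lemma twist_ricci:
  fixes C D :: "'m::finite tensor3"
  assumes C: "symmetric3 C" and D: "symmetric3 D" and dual: "dual_cubic C D"
  shows "27 * twist C D (ricci C D) h f = 3 * ricci C D h f + mat_trace (ricci C D) * delta h f"
proof -
  let ?M = "ricci C D"
  let ?S = "\<lambda>h :: 'm \<Rightarrow> 'm \<Rightarrow> 'm \<Rightarrow> complex. \<Sum>d\<in>UNIV. \<Sum>e\<in>UNIV. \<Sum>g\<in>UNIV. D d e g * h d e g"
  have 1: "?S (\<lambda>d e g. \<Sum>b\<in>UNIV. \<Sum>c\<in>UNIV. D h b c * C b d e * C c f g) = twist C D ?M h f"
    unfolding twist_def ricci_def sum_distrib_left sum.cartesian_product
    by (rule sum.reindex_bij_witness[where i="\<lambda>(b,c,g,d,e). (d,e,g,b,c)" and j="\<lambda>(d,e,g,b,c). (b,c,g,d,e)"])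
       (auto simp: mult_ac symmetric3_swap[OF C] symmetric3_swap[OF D])
  have 2: "?S (\<lambda>d e g. \<Sum>b\<in>UNIV. \<Sum>c\<in>UNIV. D h b c * C b d f * C c e g) = twist C D ?M h f"
    unfolding twist_def ricci_def sum_distrib_left sum.cartesian_product
    by (rule sum.reindex_bij_witness[where i="\<lambda>(c,b,d,e,g). (d,e,g,b,c)" and j="\<lambda>(d,e,g,b,c). (c,b,d,e,g)"])
       (auto simp: mult_ac symmetric3_swap[OF C] symmetric3_swap[OF D])
  have 3: "?S (\<lambda>d e g. \<Sum>b\<in>UNIV. \<Sum>c\<in>UNIV. D h b c * C b d g * C c e f) = twist C D ?M h f"
    unfolding twist_def ricci_def sum_distrib_left sum.cartesian_product
    by (rule sum.reindex_bij_witness[where i="\<lambda>(b,c,e,d,g). (d,e,g,b,c)" and j="\<lambda>(d,e,g,b,c). (b,c,e,d,g)"])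
       (auto simp: mult_ac symmetric3_swap[OF C] symmetric3_swap[OF D])
  have "27 * twist C D ?M h f = 9 * ?S (\<lambda>d e g. (\<Sum>b\<in>UNIV. \<Sum>c\<in>UNIV. D h b c * C b d e * C c f g)
     + (\<Sum>b\<in>UNIV. \<Sum>c\<in>UNIV. D h b c * C b d f * C c e g) + (\<Sum>b\<in>UNIV. \<Sum>c\<in>UNIV. D h b c * C b d g * C c e f))"
    by (simp only: distrib_left sum.distrib 1 2 3) simp
  also have "\<dots> = 9 * ?S (\<lambda>d e g. 1/9 * (C d e f * delta g h + C d e g * delta f h + C d f g * delta e h + C e f g * delta d h))"
    unfolding dual_cubic_index[OF C dual] ..
  also have "\<dots> = ?S (\<lambda>d e g. C d e f * delta g h) + ?S (\<lambda>d e g. C d e g * delta f h)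
       + ?S (\<lambda>d e g. C d f g * delta e h) + ?S (\<lambda>d e g. C e f g * delta d h)"
    by (simp add: sum_distrib_left algebra_simps sum.distrib)
  also have "?S (\<lambda>d e g. C d e f * delta g h) = ?M h f"
    unfolding ricci_def by (simp, intro sum.cong refl) (simp add: symmetric3_swap[OF C] symmetric3_swap[OF D])
  also have "?S (\<lambda>d e g. C d f g * delta e h) = ?M h f"
  proof -
    have "?S (\<lambda>d e g. C d f g * delta e h) = (\<Sum>d\<in>UNIV. \<Sum>g\<in>UNIV. \<Sum>e\<in>UNIV. D d e g * (C d f g * delta e h))"
      by (rule sum.cong[OF refl], rule sum.swap)
    also have "\<dots> = ?M h f"
      unfolding ricci_def by (simp, intro sum.cong refl) (simp add: symmetric3_swap[OF C] symmetric3_swap[OF D])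
    finally show ?thesis .
  qed
  also have "?S (\<lambda>d e g. C e f g * delta d h) = ?M h f"
    unfolding ricci_def by (subst sum_swap3[symmetric], simp, intro sum.cong refl) (simp add: symmetric3_swap[OF C] symmetric3_swap[OF D])
  also have "?S (\<lambda>d e g. C d e g * delta f h) = mat_trace ?M * delta h f"
    unfolding ricci_def mat_trace_def sum_distrib_right
    by (subst sum.swap, intro sum.cong refl) (simp add: symmetric3_swap[OF C] symmetric3_swap[OF D] delta_def mult_ac)
  finally show ?thesis by simp
qed

text \<open>As \<open>ricci C D\<close> is itself a similarity, its twist is known in two ways, from
  \<open>twist_of_similarity\<close> and from \<open>twist_ricci\<close>.\<close>

lemma ricci_quadratic:
  fixes C D :: "'m::finite tensor3"
  assumes C: "symmetric3 C" and D: "symmetric3 D" and dual: "dual_cubic C D"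
  shows "mat_mult (ricci C D) (ricci C D) h f
    = (of_nat CARD('m) + 1) / 9 * ricci C D h f - 2/27 * mat_trace (ricci C D) * delta h f"
proof -
  have "mat_mult (ricci C D) (ricci C D) h f
      = (of_nat CARD('m) + 3) / 9 * ricci C D h f - 2 * twist C D (ricci C D) h f"
    using twist_of_similarity[OF C D similarity_ricci[OF C D dual], of h f] by (simp add: algebra_simps)
  moreover have "twist C D (ricci C D) h f = (3 * ricci C D h f + mat_trace (ricci C D) * delta h f) / 27"
    using twist_ricci[OF C D dual, of h f] by (simp add: field_simps)
  ultimately show ?thesis by (simp only:) (simp add: field_simps)
qed

definition trilin :: "'m::finite tensor3 \<Rightarrow> ('m \<Rightarrow> complex) \<Rightarrow> ('m \<Rightarrow> complex) \<Rightarrow> ('m \<Rightarrow> complex) \<Rightarrow> complex" where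
  "trilin T x y z = (\<Sum>a\<in>UNIV. \<Sum>b\<in>UNIV. \<Sum>c\<in>UNIV. T a b c * x a * y b * z c)"

definition mat_app :: "('m::finite \<Rightarrow> 'm \<Rightarrow> complex) \<Rightarrow> ('m \<Rightarrow> complex) \<Rightarrow> 'm \<Rightarrow> complex" where
  "mat_app B x a = (\<Sum>b\<in>UNIV. B a b * x b)"

lemma trilin_lin:
  "trilin T (\<lambda>a. r * x a + s * x' a) y z = r * trilin T x y z + s * trilin T x' y z"
  "trilin T x (\<lambda>a. r * y a + s * y' a) z = r * trilin T x y z + s * trilin T x y' z"
  "trilin T x y (\<lambda>a. r * z a + s * z' a) = r * trilin T x y z + s * trilin T x y z'"
  by (simp_all add: trilin_def sum_distrib_left sum.distrib algebra_simps)

lemma trilin_commute: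
  assumes "symmetric3 T"
  shows "trilin T x y z = trilin T y x z" "trilin T x y z = trilin T x z y"
proof -
  show "trilin T x y z = trilin T y x z"
    unfolding trilin_def by (subst sum.swap) (simp add: symmetric3_swap(1)[OF assms] mult_ac)
  have "(\<Sum>b\<in>UNIV. \<Sum>c\<in>UNIV. T a b c * x a * y b * z c) = (\<Sum>b\<in>UNIV. \<Sum>c\<in>UNIV. T a b c * x a * z b * y c)" for a
    by (subst sum.swap) (simp add: symmetric3_swap(2)[OF assms] mult_ac)
  then show "trilin T x y z = trilin T x z y" by (simp add: trilin_def)
qed

lemma cubic_trilin: "cubic T t = trilin T t t t"
  by (simp add: cubic_def trilin_def)

lemma trilin_delta: "trilin T (delta a) (delta b) (delta c) = T a b c"
  by (simp only: trilin_def sum_delta)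

text \<open>Expanding the cubic at \<open>x + y\<close> and at \<open>x + y + z\<close> isolates \<open>6 T(x,y,z)\<close>.\<close>

lemma polarization3:
  assumes T: "symmetric3 T" and 0: "\<And>t. cubic T t = 0"
  shows "T a b c = 0"
proof -
  have add: "trilin T (\<lambda>a. x a + x' a) y z = trilin T x y z + trilin T x' y z"
     "trilin T x (\<lambda>a. y a + y' a) z = trilin T x y z + trilin T x y' z"
     "trilin T x y (\<lambda>a. z a + z' a) = trilin T x y z + trilin T x y z'" for x x' y y' z z'
    using trilin_lin(1)[where r=1 and s=1] trilin_lin(2)[where r=1 and s=1] trilin_lin(3)[where r=1 and s=1] by simp_all
  have sq: "trilin T x x x = 0" for x using 0[of x] by (simp add: cubic_trilin)
  have 3: "trilin T x x y + trilin T x y y = 0" for x y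
  proof -
    have p: "trilin T x y x = trilin T x x y" "trilin T y x x = trilin T x x y" "trilin T y x y = trilin T x y y" "trilin T y y x = trilin T x y y"
      by (rule trilin_commute[OF T] | rule trans[OF trilin_commute(1)[OF T] trilin_commute(2)[OF T]]
        | rule trans[OF trilin_commute(2)[OF T] trilin_commute(1)[OF T]])+
    have "3 * (trilin T x x y + trilin T x y y) = 0"
      using sq[of "\<lambda>a. x a + y a"] by (simp add: add sq p algebra_simps)
    then show ?thesis unfolding mult_eq_0_iff by simp
  qed
  have "trilin T (delta a) (delta b) (delta c) = 0"
  proof -
    have "trilin T (\<lambda>i. u i + v i + w i) (\<lambda>i. u i + v i + w i) (\<lambda>i. u i + v i + w i) = 6 * trilin T u v w" for u v w
    proof -
      have p: "trilin T u v u = trilin T u u v" "trilin T v u u = trilin T u u v" "trilin T v u v = trilin T u v v" "trilin T v v u = trilin T u v v"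
        "trilin T u w u = trilin T u u w" "trilin T w u u = trilin T u u w" "trilin T w u w = trilin T u w w" "trilin T w w u = trilin T u w w"
        "trilin T w v w = trilin T v w w" "trilin T v w v = trilin T v v w" "trilin T w v v = trilin T v v w" "trilin T w w v = trilin T v w w"
        by (rule trilin_commute[OF T] | rule trans[OF trilin_commute(1)[OF T] trilin_commute(2)[OF T]]
          | rule trans[OF trilin_commute(2)[OF T] trilin_commute(1)[OF T]])+
      have q: "trilin T u w v = trilin T u v w" "trilin T v u w = trilin T u v w"
        by (rule trilin_commute[OF T])+
      have q': "trilin T w v u = trilin T u v w" "trilin T w u v = trilin T u v w" "trilin T v w u = trilin T u v w"
        using q trilin_commute(1)[OF T, of w v u] trilin_commute(2)[OF T, of v w u] trilin_commute(1)[OF T, of w u v] by simp_all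
      show ?thesis using 3[of u v] 3[of u w] 3[of v w]
        by (simp add: add sq p q q' add_eq_0_iff2)
    qed
    then show ?thesis using sq by simp
  qed
  then show ?thesis by (simp add: trilin_delta)
qed

lemma trilin_mat_app:
  "trilin C (mat_app B x) y z = (\<Sum>d\<in>UNIV. \<Sum>e\<in>UNIV. \<Sum>f\<in>UNIV. (\<Sum>k\<in>UNIV. C k e f * B k d) * (x d * y e * z f))"
  "trilin C x (mat_app B y) z = (\<Sum>d\<in>UNIV. \<Sum>e\<in>UNIV. \<Sum>f\<in>UNIV. (\<Sum>k\<in>UNIV. C d k f * B k e) * (x d * y e * z f))"
  "trilin C x y (mat_app B z) = (\<Sum>d\<in>UNIV. \<Sum>e\<in>UNIV. \<Sum>f\<in>UNIV. (\<Sum>k\<in>UNIV. C d e k * B k f) * (x d * y e * z f))"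
  unfolding trilin_def mat_app_def sum_distrib_left sum_distrib_right sum.cartesian_product
  by (rule sum.reindex_bij_witness[where i="\<lambda>(d,e,f,k). (k,e,f,d)" and j="\<lambda>(k,e,f,d). (d,e,f,k)"], auto simp: mult_ac)
     (rule sum.reindex_bij_witness[where i="\<lambda>(d,e,f,k). (d,k,f,e)" and j="\<lambda>(d,k,f,e). (d,e,f,k)"], auto simp: mult_ac,
      rule sum.reindex_bij_witness[where i="\<lambda>(d,e,f,k). (d,e,k,f)" and j="\<lambda>(d,e,k,f). (d,e,f,k)"], auto simp: mult_ac)

lemma similarity_trilin:
  assumes "similarity C B c"
  shows "trilin C (mat_app B x) y z + trilin C x (mat_app B y) z + trilin C x y (mat_app B z) = c * trilin C x y z"
proof -
  have "(\<Sum>k\<in>UNIV. C k e f * B k d) + (\<Sum>k\<in>UNIV. C d k f * B k e) + (\<Sum>k\<in>UNIV. C d e k * B k f) = c * C d e f" for d e f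
    using assms by (simp add: similarity_def sum.distrib)
  then show ?thesis
    unfolding trilin_mat_app sum.distrib[symmetric] distrib_right[symmetric]
    by (simp add: trilin_def sum_distrib_left mult_ac)
qed

text \<open>The number is the value at \<open>-2/9\<close> of the quadratic polynomial of \<open>ricci_quadratic\<close>. If it
  were zero, the other root would be \<open>w = (n+3)/9\<close>, which is also the similarity factor of
  \<open>ricci C D\<close>. Then \<open>W\<close> would be the sum of the two eigenspaces, and \<open>C(x,y,z)\<close> could be nonzero
  on eigenvectors only if their three eigenvalues added up to \<open>w\<close>. Since \<open>w > 2/9\<close>, no three of
  the numbers \<open>w\<close>, \<open>-2/9\<close> do, and \<open>C\<close> would vanish.\<close>

lemma ricci_discriminant:
  fixes C D :: "'m::finite tensor3"
  assumes C: "symmetric3 C" and D: "symmetric3 D" and dual: "dual_cubic C D" and nz: "C a b c \<noteq> 0"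
  shows "2/27 * mat_trace (ricci C D) + 2/81 * (of_nat CARD('m) + 3) \<noteq> 0"
proof
  let ?M = "ricci C D"
  define n :: complex where "n = of_nat CARD('m)"
  define w where "w = (n + 3) / 9"
  assume "2/27 * mat_trace (ricci C D) + 2/81 * (of_nat CARD('m) + 3) = 0"
  then have tr: "2/27 * mat_trace ?M = - (2/9 * w)" by (simp add: w_def n_def algebra_simps add_eq_0_iff)
  have MM: "mat_mult ?M ?M h f = (w - 2/9) * ?M h f + 2/9 * w * delta h f" for h f
  proof -
    have "w - 2/9 = (n + 1) / 9" by (simp add: w_def field_simps)
    then show ?thesis using ricci_quadratic[OF C D dual, of h f] unfolding tr by (simp add: n_def)
  qed
  have appMM: "mat_app ?M (mat_app ?M x) h = (w - 2/9) * mat_app ?M x h + 2/9 * w * x h" for x h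
  proof -
    have "mat_app ?M (mat_app ?M x) h = (\<Sum>f\<in>UNIV. mat_mult ?M ?M h f * x f)"
      unfolding mat_app_def mat_mult_def sum_distrib_left sum_distrib_right by (subst sum.swap) (simp add: mult_ac)
    also have "\<dots> = (w - 2/9) * mat_app ?M x h + 2/9 * w * x h"
      unfolding MM mat_app_def by (simp only: distrib_right sum.distrib mult.assoc sum_distrib_left[symmetric] sum_delta)
    finally show ?thesis .
  qed
  have inv: "trilin C (mat_app ?M x) y z + trilin C x (mat_app ?M y) z + trilin C x y (mat_app ?M z) = w * trilin C x y z" for x y z
    using similarity_trilin[OF similarity_ricci[OF C D dual]] by (simp add: w_def n_def)
  have w: "w = of_real ((real CARD('m) + 3) / 9)" by (simp add: w_def n_def)
  have pos: "(real CARD('m) + 3) / 9 > 2/9" by simp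
  \<comment> \<open>no three of the eigenvalues \<open>w\<close>, \<open>-2/9\<close> add up to
    \<open>w\<close>\<close>
  have wn: "3 * w \<noteq> w" "2 * w - 2/9 \<noteq> w" "w - 4/9 \<noteq> w" "- (2/3) \<noteq> w" "w + 2/9 \<noteq> 0" "- (4/9) \<noteq> w + 2/9"
    using pos unfolding w by (auto simp: complex_eq_iff, linarith+)
  define eig where "eig al x \<longleftrightarrow> mat_app ?M x = (\<lambda>a. al * x a)" for al x
  have tri0: "trilin C x y z = 0"
    if "eig al x" "eig be y" "eig ga z" "al + be + ga \<noteq> w" for x y z al be ga
  proof -
    have "al * trilin C x y z + be * trilin C x y z + ga * trilin C x y z = w * trilin C x y z"
      using inv[of x y z] that(1-3) trilin_lin(1)[of C al x 0 x y z] trilin_lin(2)[of C x be y 0 y z] trilin_lin(3)[of C x y ga z 0 z]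
      by (simp add: eig_def)
    then have "(al + be + ga - w) * trilin C x y z = 0" by (simp add: algebra_simps)
    then show ?thesis using that(4) by simp
  qed
  \<comment> \<open>multiples of the projections to the eigenspaces of \<open>w\<close> and
    \<open>-2/9\<close>\<close>
  define up where "up x a = mat_app ?M x a + 2/9 * x a" for x a
  define dn where "dn x a = mat_app ?M x a - w * x a" for x a
  have mat_app_lin: "mat_app ?M (\<lambda>a. r * x a + s * y a) = (\<lambda>a. r * mat_app ?M x a + s * mat_app ?M y a)" for r s x y
    by (intro ext) (simp add: mat_app_def sum.distrib sum_distrib_left algebra_simps)
  have up: "eig w (up x)" for x
    using mat_app_lin[of 1 "mat_app ?M x" "2/9" x] unfolding eig_def up_def[abs_def] by (simp add: fun_eq_iff appMM algebra_simps)
  have dn: "eig (- (2/9)) (dn x)" for x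
    using mat_app_lin[of 1 "mat_app ?M x" "- w" x] unfolding eig_def dn_def[abs_def] by (simp add: fun_eq_iff appMM algebra_simps)
  have dec: "x = (\<lambda>a. (1 / (w + 2/9)) * up x a + (- 1 / (w + 2/9)) * dn x a)" for x
  proof
    fix a
    have "(w + 2/9) * x a = up x a - dn x a" by (simp add: up_def dn_def algebra_simps)
    moreover have "v * y = u - d \<Longrightarrow> v \<noteq> 0 \<Longrightarrow> y = 1 / v * u + - 1 / v * d" for v y u d :: complex
      by (simp add: field_simps)
    ultimately show "x a = 1 / (w + 2/9) * up x a + - 1 / (w + 2/9) * dn x a" using wn(5) by blast
  qed
  have step1: "trilin C (ux) (uy) z = 0" if "(ux = up x \<and> al = w) \<or> (ux = dn x \<and> al = -(2/9))"
     "(uy = up y \<and> be = w) \<or> (uy = dn y \<and> be = -(2/9))" for ux uy x y z al be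
  proof -
    have e: "eig al ux" "eig be uy" using that up dn by auto
    have "trilin C ux uy (up z) = 0" by (rule tri0[OF e up]) (use that wn in \<open>auto simp: algebra_simps\<close>)
    moreover have "trilin C ux uy (dn z) = 0" by (rule tri0[OF e dn]) (use that wn in \<open>auto simp: algebra_simps\<close>)
    ultimately show ?thesis by (subst dec[of z], subst trilin_lin(3)) simp
  qed
  have step2: "trilin C ux y z = 0" if "(ux = up x \<and> al = w) \<or> (ux = dn x \<and> al = -(2/9))" for ux x y z al
    using step1[OF that, of "up y" y w z] step1[OF that, of "dn y" y "-(2/9)" z]
    by (subst dec[of y], subst trilin_lin(2)) simp
  have "trilin C x y z = 0" for x y z
    using step2[of "up x" x w y z] step2[of "dn x" x "-(2/9)" y z]
    by (subst dec[of x], subst trilin_lin(1)) simp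
  then have "C a b c = 0" using trilin_delta[of C a b c] by simp
  with nz show False by simp
qed

text \<open>The matrix \<open>X\<^sub>a U\<^sup>b\<close> of second derivatives of the symmetry of degree zero that the brackets
  of the top generator with coordinates produce from the coefficients \<open>A\<close>; see
  \<open>degree_zero_generated\<close>.\<close>

definition inner_sim :: "'m::finite tensor3 \<Rightarrow> 'm tensor3 \<Rightarrow> ('m \<Rightarrow> 'm \<Rightarrow> complex) \<Rightarrow> 'm \<Rightarrow> 'm \<Rightarrow> complex" where
  "inner_sim C D A b a = A b a + 1/2 * mat_trace A * delta b a - 9 * twist C D A b a"

lemma inner_sim_lin:
  "inner_sim C D (\<lambda>b a. r * A b a + s * B b a) = (\<lambda>b a. r * inner_sim C D A b a + s * inner_sim C D B b a)"
  by (intro ext) (simp add: inner_sim_def mat_trace_def twist_def sum_distrib_left sum.distrib algebra_simps)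

lemma polar_delta: "polar C (delta f) t c = (\<Sum>g\<in>UNIV. C c f g * t g)"
proof -
  have "polar C (delta f) t c = (\<Sum>b\<in>UNIV. delta f b * (\<Sum>g\<in>UNIV. C c b g * t g))"
    by (simp add: polar_def sum_distrib_left mult_ac)
  then show ?thesis by simp
qed

lemma dot_delta [simp]: "dot (delta f) s = s f" "dot s (delta f) = s f"
  by (simp_all add: dot_def)

text \<open>By \<open>dual_cubic_star\<close> the twist of \<open>t \<otimes> C(t\<^sup>2)\<close> is \<open>1/9\<close> of this matrix plus a multiple of
  the identity; the factor \<open>9\<close> in \<open>inner_sim\<close> cancels the matrix of rank one. Since \<open>C(t\<^sup>3) \<noteq> 0\<close>
  for some \<open>t\<close>, the identity is inner.\<close>

lemma inner_sim_rank_one: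
  assumes C: "symmetric3 C" and D: "symmetric3 D" and dual: "dual_cubic C D"
  shows "inner_sim C D (\<lambda>b a. t b * polar C t t a) b a = cubic C t / 6 * delta b a"
proof -
  let ?s = "polar C t t"
  have "twist C D (\<lambda>g a. t g * ?s a) b f = polar D (polar C (delta f) t) ?s b" for f
  proof -
    have "twist C D (\<lambda>g a. t g * ?s a) b f = (\<Sum>a\<in>UNIV. \<Sum>c\<in>UNIV. D a b c * ?s a * polar C (delta f) t c)"
      by (simp add: twist_def polar_delta sum_distrib_left mult_ac)
    also have "\<dots> = polar D ?s (polar C (delta f) t) b"
      by (simp add: polar_def[of D] symmetric3_swap(1)[OF D, of _ b])
    finally show ?thesis by (simp add: polar_commute[OF D])
  qed
  then have "twist C D (\<lambda>g a. t g * ?s a) b a = 1/9 * ?s a * t b + 1/27 * cubic C t * delta a b"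
    by (simp add: dual_cubic_star[OF C dual])
  moreover have "mat_trace (\<lambda>b a. t b * ?s a) = cubic C t"
    by (simp add: mat_trace_def cubic_dot dot_def)
  moreover have "delta a b = delta b a" by (simp add: delta_def)
  ultimately show ?thesis by (simp add: inner_sim_def algebra_simps)
qed

lemma nonzero_cubic:
  assumes "symmetric3 C" "C a b c \<noteq> 0" obtains t where "cubic C t \<noteq> 0"
  using polarization3[OF assms(1)] assms(2) by blast

text \<open>Let \<open>M = ricci C D\<close>. For a similarity \<open>E\<close> with factor \<open>e\<close>, \<open>twist_of_similarity\<close> gives
  \<open>inner_sim E = (1 + 9/2 M) E + 1/2 (tr E) 1 - 9/2 e M\<close>. The identity is inner by
  \<open>inner_sim_rank_one\<close>, hence \<open>M\<close> is inner because \<open>inner_sim 1 = (n/2 + 1) 1 - 9 M\<close>, and so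
  \<open>(1 + 9/2 M) E\<close> is inner for every similarity \<open>E\<close>. Multiplication by \<open>M\<close> preserves
  similarities, and by \<open>ricci_discriminant\<close> the matrix \<open>1 + 9/2 M\<close> is invertible with inverse a
  linear polynomial in \<open>M\<close>; so every similarity has the form \<open>(1 + 9/2 M) E\<close>.\<close>

theorem similarity_is_inner:
  fixes C D :: "'m::finite tensor3"
  assumes C: "symmetric3 C" and D: "symmetric3 D" and dual: "dual_cubic C D" and nz: "C a b c \<noteq> 0"
    and B: "similarity C B l"
  shows "\<exists>A. B = inner_sim C D A"
proof -
  let ?M = "ricci C D"
  obtain t where t: "cubic C t \<noteq> 0" using nonzero_cubic[OF C nz] .
  define n :: complex where "n = of_nat CARD('m)"
  define w where "w = (n + 3) / 9"
  \<comment> \<open>a preimage of the identity under \<open>inner_sim\<close>; the zero summand gives it the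
    shape of \<open>inner_sim_lin\<close>\<close>
  define I where "I = (\<lambda>b a. 6 / cubic C t * (t b * polar C t t a) + 0 * (delta b a :: complex))"
  have I: "inner_sim C D I = delta"
    unfolding I_def inner_sim_lin using t by (intro ext) (simp add: inner_sim_rank_one[OF C D dual])
  \<comment> \<open>a preimage of \<open>M\<close>\<close>
  define K where "K = (\<lambda>b a. (n / 2 + 1) / 9 * I b a + (- 1/9) * delta b a)"
  have K: "inner_sim C D K = ?M"
    unfolding K_def inner_sim_lin I
    by (intro ext) (simp add: inner_sim_def twist_delta mat_trace_delta n_def, simp add: field_simps)
  have key: "\<exists>A. (\<lambda>b a. E b a + 9/2 * mat_mult ?M E b a) = inner_sim C D A" if E: "similarity C E e" for E e
  proof -
    have t: "mat_mult ?M E b a = e * ?M b a - 2 * twist C D E b a" for b a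
      using twist_of_similarity[OF C D E, of b a] by (simp add: algebra_simps)
    have "(\<lambda>b a. E b a + 9/2 * mat_mult ?M E b a)
       = (\<lambda>b a. 1 * inner_sim C D E b a + 1 * ((- 1/2 * mat_trace E) * delta b a + (9/2 * e) * ?M b a))"
      by (intro ext) (simp add: inner_sim_def t field_simps)
    also have "\<dots> = inner_sim C D (\<lambda>b a. 1 * E b a + 1 * ((- 1/2 * mat_trace E) * I b a + (9/2 * e) * K b a))"
      unfolding inner_sim_lin I K ..
    finally show ?thesis by blast
  qed
  define kap where "kap = 2/27 * mat_trace ?M + 2/81 * (n + 3)"
  have kap: "kap \<noteq> 0" using ricci_discriminant[OF C D dual nz] unfolding kap_def n_def .
  obtain m where MB: "similarity C (mat_mult ?M B) m" using similarity_ricci_mat_mult[OF C D dual B] by blast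
  \<comment> \<open>\<open>E = (1 + 9/2 M)\<^sup>-\<^sup>1 B\<close>, the inverse being read off the
    quadratic equation of \<open>M\<close>\<close>
  define E where "E = (\<lambda>b a. (- 2 / (9 * kap)) * mat_mult ?M B b a + (2 * w / (9 * kap)) * B b a)"
  obtain e where E: "similarity C E e" unfolding E_def using similarity_lin[OF MB B] by blast
  have ME: "mat_mult ?M E b a = (- 2 / (9 * kap)) * mat_mult (mat_mult ?M ?M) B b a + (2 * w / (9 * kap)) * mat_mult ?M B b a" for b a
    by (simp add: E_def mat_mult_assoc mat_mult_def[of _ "\<lambda>b a. _ b a + _ b a"] mat_mult_def[of ?M "mat_mult ?M B"] mat_mult_def[of ?M B] sum_distrib_left sum.distrib algebra_simps,
        simp add: sum_divide_distrib)
  have MMB: "mat_mult (mat_mult ?M ?M) B b a = (n + 1) / 9 * mat_mult ?M B b a - 2/27 * mat_trace ?M * B b a" for b a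
  proof -
    have "mat_mult (mat_mult ?M ?M) B b a = (\<Sum>k\<in>UNIV. ((n + 1) / 9 * ?M b k - 2/27 * mat_trace ?M * delta b k) * B k a)"
      unfolding mat_mult_def[of "mat_mult ?M ?M"] ricci_quadratic[OF C D dual] n_def ..
    also have "\<dots> = (n + 1) / 9 * (\<Sum>k\<in>UNIV. ?M b k * B k a) - 2/27 * mat_trace ?M * (\<Sum>k\<in>UNIV. delta b k * B k a)"
      by (simp only: left_diff_distrib sum_subtractf sum_distrib_left mult.assoc)
    finally show ?thesis by (simp add: mat_mult_def)
  qed
  have "E b a + 9/2 * mat_mult ?M E b a = B b a" for b a
  proof -
    have "E b a + 9/2 * mat_mult ?M E b a = B b a * (2 * w + 9 * (2/27 * mat_trace ?M)) / (9 * kap)"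
      unfolding ME MMB unfolding E_def w_def using kap by (simp add: field_simps)
    also have "2 * w + 9 * (2/27 * mat_trace ?M) = 9 * kap" by (simp add: kap_def w_def algebra_simps)
    finally show ?thesis using kap by simp
  qed
  then have "B = (\<lambda>b a. E b a + 9/2 * mat_mult ?M E b a)" by (intro ext) simp
  then show ?thesis using key[OF E] by simp
qed

section \<open>Nondegeneracy\<close>

lemma poly6_zero:
  fixes c0 :: complex
  assumes "\<And>z. c0 + c1 * z + c2 * z^2 + c3 * z^3 + c4 * z^4 + c5 * z^5 + c6 * z^6 = 0"
  shows "c0 = 0" "c1 = 0" "c2 = 0" "c3 = 0" "c4 = 0" "c5 = 0" "c6 = 0"
proof -
  define c where "c i = [c0,c1,c2,c3,c4,c5,c6] ! i" for i
  have "(\<Sum>i\<le>6. c i * z^i) = 0" for z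
    using assms[of z] by (simp add: c_def eval_nat_numeral atMost_Suc algebra_simps)
  then have *: "c k = 0" if "k \<le> 6" for k using zero_polynom_imp_zero_coeffs that by blast
  show "c0 = 0" "c1 = 0" "c2 = 0" "c3 = 0" "c4 = 0" "c5 = 0" "c6 = 0"
    using *[of 0] *[of 1] *[of 2] *[of 3] *[of 4] *[of 5] *[of 6] by (simp_all add: c_def)
qed

text \<open>On the complex line from \<open>t\<close> to a point where the cubic is nonzero, the cubic is a
  nonzero polynomial and has finitely many zeros, so near \<open>t\<close> it vanishes at most at \<open>t\<close>.\<close>

lemma cubic_dense:
  assumes C: "symmetric3 C" and nz: "C a b c \<noteq> 0"
    and zero: "\<And>t. cubic C t \<noteq> 0 \<Longrightarrow> \<phi> t = (0::complex)"
    and cont: "\<And>d. isCont (\<lambda>z::complex. \<phi> (\<lambda>a. t a + z * d a)) 0"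
  shows "\<phi> t = 0"
proof (rule ccontr)
  assume ne: "\<phi> t \<noteq> 0"
  obtain t0 where t0: "cubic C t0 \<noteq> 0" using nonzero_cubic[OF C nz] .
  define d where "d a = t0 a - t a" for a
  define p where "p = [:trilin C t t t, 3 * trilin C t t d, 3 * trilin C t d d, trilin C d d d:]"
  have p: "cubic C (\<lambda>a. t a + z * d a) = poly p z" for z
  proof -
    have l: "trilin C (\<lambda>a. x a + z * x' a) y y' = trilin C x y y' + z * trilin C x' y y'"
       "trilin C y (\<lambda>a. x a + z * x' a) y' = trilin C y x y' + z * trilin C y x' y'"
       "trilin C y y' (\<lambda>a. x a + z * x' a) = trilin C y y' x + z * trilin C y y' x'" for x x' y y'
      using trilin_lin(1)[where r=1 and s=z] trilin_lin(2)[where r=1 and s=z] trilin_lin(3)[where r=1 and s=z] by simp_all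
    have q: "trilin C t d t = trilin C t t d" "trilin C d t t = trilin C t t d" "trilin C d t d = trilin C t d d" "trilin C d d t = trilin C t d d"
      by (rule trilin_commute[OF C] | rule trans[OF trilin_commute(1)[OF C] trilin_commute(2)[OF C]]
        | rule trans[OF trilin_commute(2)[OF C] trilin_commute(1)[OF C]])+
    show ?thesis unfolding p_def cubic_trilin l q by (simp add: algebra_simps)
  qed
  have "poly p 1 \<noteq> 0" using t0 p[of 1] by (simp add: d_def)
  then have fin: "finite {z. poly p z = 0}" by (intro poly_roots_finite) auto
  obtain e where e: "e > 0" "\<And>z. dist 0 z < e \<Longrightarrow> \<phi> (\<lambda>a. t a + z * d a) \<noteq> 0"
    using continuous_at_avoid[OF cont[of d], of 0] ne by auto
  have "ball 0 e \<subseteq> {z. poly p z = 0}"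
  proof
    fix z :: complex assume "z \<in> ball 0 e"
    then have "\<phi> (\<lambda>a. t a + z * d a) \<noteq> 0" using e(2)[of z] by simp
    then have "cubic C (\<lambda>a. t a + z * d a) = 0" using zero by blast
    then show "z \<in> {z. poly p z = 0}" using p by simp
  qed
  then have "finite (ball (0::complex) e)" using fin finite_subset by blast
  then show False using uncountable_ball[OF e(1), of "0::complex"] countable_finite by blast
qed

lemma dot_polar_trilin: "dot x (polar T y z) = trilin T x y z"
  by (simp add: dot_def polar_def trilin_def sum_distrib_left mult_ac)

text \<open>If \<open>C(z,t) = 0\<close>, all terms of \<open>dual_cubic_star\<close> except \<open>1/27 C(t\<^sup>3) z\<close> vanish.\<close>

lemma polar_kernel:
  assumes C: "symmetric3 C" and dual: "dual_cubic C D" and t: "cubic C t \<noteq> 0" and z: "\<And>a. polar C z t a = 0"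
  shows "z a = 0"
proof -
  have "dot z (polar C t t) = 0"
    using dot_polar_commute[OF C, of z t t] z polar_commute[OF C] by (simp add: dot_def)
  moreover have "polar D (polar C z t) (polar C t t) a = 0" using z by (simp add: polar_def[of D])
  ultimately show ?thesis using dual_cubic_star[OF C dual, of z t a] t by simp
qed

text \<open>Polarizing, \<open>C(z,x,y) = 0\<close> for all \<open>x\<close> and \<open>y\<close>, so that \<open>polar_kernel\<close> applies.\<close>

lemma squares_span:
  assumes C: "symmetric3 C" and nz: "C a b c \<noteq> 0" and dual: "dual_cubic C D"
    and 0: "\<And>t. dot (polar C t t) z = 0"
  shows "z a' = 0"
proof -
  have diag: "trilin C z t t = 0" for t using 0[of t] by (simp add: dot_commute[of _ z] dot_polar_trilin)
  have "trilin C z x y = 0" for x y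
  proof -
    have l: "trilin C y (\<lambda>a. x a + x' a) y' = trilin C y x y' + trilin C y x' y'"
       "trilin C y y' (\<lambda>a. x a + x' a) = trilin C y y' x + trilin C y y' x'" for x x' y y'
      using trilin_lin(2)[where r=1 and s=1] trilin_lin(3)[where r=1 and s=1] by simp_all
    show ?thesis using diag[of "\<lambda>a. x a + y a"] trilin_commute(2)[OF C, of z x y] by (simp add: l diag)
  qed
  then have "polar C z t d = 0" for t d
    using dot_polar_trilin[of "delta d" C z t] trilin_commute(1)[OF C, of "delta d" z t] by simp
  moreover obtain t where "cubic C t \<noteq> 0" using nonzero_cubic[OF C nz] .
  ultimately show ?thesis using polar_kernel[OF C dual] by blast
qed

lemma polar_line:
  assumes C: "symmetric3 C"
  shows "polar C (\<lambda>a. t a + z * x a) (\<lambda>a. t a + z * x a) a = polar C t t a + z * (2 * polar C t x a) + z^2 * polar C x x a"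
proof -
  have "polar C (\<lambda>a. t a + z * x a) (\<lambda>a. t a + z * x a) a = polar C t t a + z * polar C t x a + z * polar C x t a + z^2 * polar C x x a"
    by (simp add: polar_def sum_distrib_left sum.distrib algebra_simps power2_eq_square)
  then show ?thesis by (simp add: polar_commute[OF C, of x t])
qed

text \<open>The map \<open>t \<mapsto> C(t\<^sup>2)\<close> from \<open>W\<close> to its dual is dominant, so its image satisfies no quadratic
  equation: differentiating the equation in \<open>t\<close> shows that \<open>Q C(t\<^sup>2)\<close> lies in the kernel of
  \<open>C(t, -)\<close>, which is zero for generic \<open>t\<close>.\<close>

lemma squares_dominant:
  assumes C: "symmetric3 C" and nz: "C a b c \<noteq> 0" and dual: "dual_cubic C D"
    and Q: "\<And>a b. Q a b = Q b a" and 0: "\<And>t. dot (polar C t t) (mat_app Q (polar C t t)) = 0"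
  shows "Q a' b' = 0"
proof -
  have mat_app_add: "mat_app Q (\<lambda>a. x a + y a) = (\<lambda>a. mat_app Q x a + mat_app Q y a)" for x y
    by (intro ext) (simp add: mat_app_def algebra_simps sum.distrib)
  have mat_app_sc: "mat_app Q (\<lambda>a. k * x a) = (\<lambda>a. k * mat_app Q x a)" for x k
    by (intro ext) (simp add: mat_app_def algebra_simps sum_distrib_left)
  have dl: "dot (\<lambda>a. x a + y a) z = dot x z + dot y z" "dot z (\<lambda>a. x a + y a) = dot z x + dot z y"
     "dot (\<lambda>a. k * x a) z = k * dot x z" "dot z (\<lambda>a. k * x a) = k * dot z x" for x y z k
    by (simp_all add: dot_def algebra_simps sum.distrib sum_distrib_left)
  have qsym: "dot x (mat_app Q y) = dot y (mat_app Q x)" for x y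
  proof -
    have "dot x (mat_app Q y) = (\<Sum>a\<in>UNIV. \<Sum>b\<in>UNIV. x a * Q a b * y b)"
      by (simp add: dot_def mat_app_def sum_distrib_left mult_ac)
    also have "\<dots> = (\<Sum>b\<in>UNIV. \<Sum>a\<in>UNIV. x a * Q a b * y b)" by (rule sum.swap)
    also have "\<dots> = dot y (mat_app Q x)"
      unfolding dot_def mat_app_def sum_distrib_left by (intro sum.cong refl) (simp add: Q mult_ac)
    finally show ?thesis .
  qed
  \<comment> \<open>the coefficient of \<open>z\<close> in the equation at \<open>t + z x\<close>\<close>
  have 1: "dot (polar C t x) (mat_app Q (polar C t t)) = 0" for t x
  proof -
    have s: "polar C (\<lambda>a. t a + z * x a) (\<lambda>a. t a + z * x a) = (\<lambda>a. polar C t t a + (z * (2 * polar C t x a) + z^2 * polar C x x a))" for z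
      by (intro ext) (simp add: polar_line[OF C])
    let ?s = "polar C t t" and ?r = "polar C t x" and ?q = "polar C x x"
    have "dot ?s (mat_app Q ?s) + (4 * dot ?r (mat_app Q ?s)) * z + (2 * dot ?s (mat_app Q ?q) + 4 * dot ?r (mat_app Q ?r)) * z^2
        + (4 * dot ?r (mat_app Q ?q)) * z^3 + dot ?q (mat_app Q ?q) * z^4 + 0 * z^5 + 0 * z^6 = 0" for z
      using 0[of "\<lambda>a. t a + z * x a"] unfolding s mat_app_add mat_app_sc dl
      using qsym[of ?s ?r] qsym[of ?s ?q] qsym[of ?r ?q]
      by (simp add: algebra_simps power2_eq_square power3_eq_cube power4_eq_xxxx)
    from poly6_zero(2)[OF this] show ?thesis by simp
  qed
  have 2: "mat_app Q (polar C t t) d = 0" if t: "cubic C t \<noteq> 0" for t d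
  proof (rule polar_kernel[OF C dual t])
    fix e
    have "trilin C (mat_app Q (polar C t t)) t (delta e) = 0"
      using 1[of t "delta e"] by (simp add: dot_commute[of "polar C t (delta e)"] dot_polar_trilin)
    then show "polar C (mat_app Q (polar C t t)) t e = 0"
      using dot_polar_trilin[of "delta e" C "mat_app Q (polar C t t)" t]
        trilin_commute(1)[OF C, of "delta e" "mat_app Q (polar C t t)" t] trilin_commute(2)[OF C, of "mat_app Q (polar C t t)" "delta e" t]
      by simp
  qed
  have "mat_app Q (polar C t t) d = 0" for t d
    by (rule cubic_dense[where \<phi>="\<lambda>t. mat_app Q (polar C t t) d", OF C nz])
       (auto simp: 2, auto simp: mat_app_def polar_def intro!: continuous_intros)
  then have "dot (polar C t t) (Q a') = 0" for t
    by (simp add: mat_app_def dot_def mult.commute)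
  then show ?thesis using squares_span[OF C nz dual] by blast
qed

section \<open>The contact frame\<close>

lemma vf_nth [simp]:
  "vf_X i p $ Inl j = delta i j" "vf_X i p $ Inr (Inl ()) = cp p i" "vf_X i p $ Inr (Inr j) = 0"
  "vf_U i p $ Inl j = 0" "vf_U i p $ Inr (Inl ()) = 0" "vf_U i p $ Inr (Inr j) = delta i j"
  by (simp_all add: vf_X_def vf_U_def axis_def delta_def)

lemma d_u_nth [simp]:
  "d_u $ Inl j = 0" "d_u $ Inr (Inl ()) = 1" "d_u $ Inr (Inr j) = 0"
  by (simp_all add: axis_def)

lemma sum_option:
  fixes h :: "'m::finite option \<Rightarrow> 'b::comm_monoid_add"
  shows "(\<Sum>i\<in>UNIV. h i) = h None + (\<Sum>a\<in>UNIV. h (Some a))"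
  by (simp add: UNIV_option_conv sum.reindex)

lemma jet_eqI:
  fixes v w :: "'m::finite jet"
  assumes "\<And>i. v $ Inl i = w $ Inl i" "v $ Inr (Inl ()) = w $ Inr (Inl ())" "\<And>i. v $ Inr (Inr i) = w $ Inr (Inr i)"
  shows "v = w"
proof -
  have "v $ k = w $ k" for k
  proof (cases k)
    case (Inr j)
    then show ?thesis using assms by (cases j) auto
  qed (simp add: assms)
  then show ?thesis by (simp add: vec_eq_iff)
qed

named_theorems diff_rules

lemma op_const [diff_rules]: "d_dx i (\<lambda>p. c) p = 0" "d_dp i (\<lambda>p. c) p = 0" "d_du (\<lambda>p. c) p = 0"
  by (simp_all add: d_dx_def d_dp_def d_du_def dird_const)

lemma op_add [diff_rules]:
  assumes "holomorphic_fn f" "holomorphic_fn g" shows "d_dx i (\<lambda>p. f p + g p) p = d_dx i f p + d_dx i g p" "d_dp i (\<lambda>p. f p + g p) p = d_dp i f p + d_dp i g p" "d_du (\<lambda>p. f p + g p) p = d_du f p + d_du g p"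
  by (simp_all add: d_dx_def d_dp_def d_du_def dird_add assms)

lemma op_diff [diff_rules]:
  assumes "holomorphic_fn f" "holomorphic_fn g" shows "d_dx i (\<lambda>p. f p - g p) p = d_dx i f p - d_dx i g p" "d_dp i (\<lambda>p. f p - g p) p = d_dp i f p - d_dp i g p" "d_du (\<lambda>p. f p - g p) p = d_du f p - d_du g p"
  by (simp_all add: d_dx_def d_dp_def d_du_def dird_diff assms)

lemma op_minus [diff_rules]:
  assumes "holomorphic_fn f" shows "d_dx i (\<lambda>p. - f p) p = - d_dx i f p" "d_dp i (\<lambda>p. - f p) p = - d_dp i f p" "d_du (\<lambda>p. - f p) p = - d_du f p"
  by (simp_all add: d_dx_def d_dp_def d_du_def dird_minus assms)

lemma op_mult [diff_rules]:
  assumes "holomorphic_fn f" "holomorphic_fn g"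
  shows "d_dx i (\<lambda>p. f p * g p) p = d_dx i f p * g p + f p * d_dx i g p" "d_dp i (\<lambda>p. f p * g p) p = d_dp i f p * g p + f p * d_dp i g p" "d_du (\<lambda>p. f p * g p) p = d_du f p * g p + f p * d_du g p"
  by (simp_all add: d_dx_def d_dp_def d_du_def dird_mult assms)

lemma op_sum [diff_rules]:
  assumes "\<And>a. holomorphic_fn (F a)" shows "d_dx i (\<lambda>p. \<Sum>a\<in>A. F a p) p = (\<Sum>a\<in>A. d_dx i (F a) p)" "d_dp i (\<lambda>p. \<Sum>a\<in>A. F a p) p = (\<Sum>a\<in>A. d_dp i (F a) p)" "d_du (\<lambda>p. \<Sum>a\<in>A. F a p) p = (\<Sum>a\<in>A. d_du (F a) p)"
  by (simp_all add: d_dx_def d_dp_def d_du_def dird_sum assms)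

lemma op_coord [diff_rules]:
  "d_dx i (\<lambda>p. cx p j) p = delta i j" "d_dx i (\<lambda>p. cu p) p = cp p i" "d_dx i (\<lambda>p. cp p j) p = 0"
  "d_dp i (\<lambda>p. cx p j) p = 0" "d_dp i (\<lambda>p. cu p) p = 0" "d_dp i (\<lambda>p. cp p j) p = delta i j"
  "d_du (\<lambda>p. cx p j) p = 0" "d_du (\<lambda>p. cu p) p = 1" "d_du (\<lambda>p. cp p j) p = 0"
  by (simp_all add: d_dx_def d_dp_def d_du_def dird_nth)

lemma d_dx_alt:
  assumes "holomorphic_fn g"
  shows "d_dx i g = (\<lambda>p. dird g p (axis (Inl i) 1) + cp p i * d_du g p)"
  by (intro ext) (simp add: d_dx_def vf_X_def d_du_def dird_vadd dird_scale assms)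

lemma d_dp_alt: "d_dp i g = (\<lambda>p. dird g p (axis (Inr (Inr i)) 1))"
  by (intro ext) (simp add: d_dp_def vf_U_def)

lemma d_du_alt: "d_du g = (\<lambda>p. dird g p d_u)"
  by (intro ext) (simp add: d_du_def)

lemma holo_op [holo]:
  assumes "holomorphic_fn g"
  shows "holomorphic_fn (d_dx i g)" "holomorphic_fn (d_dp i g)" "holomorphic_fn (d_du g)"
  unfolding d_dx_alt[OF assms] d_dp_alt d_du_alt by (intro holo assms)+

lemma du_commute:
  assumes "holomorphic_fn g"
  shows "d_du (d_dx i g) = d_dx i (d_du g)" "d_du (d_dp i g) = d_dp i (d_du g)"
proof -
  show "d_du (d_dp i g) = d_dp i (d_du g)"
    unfolding d_dp_alt d_du_alt by (intro ext) (rule dird_commute[OF assms])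
  have "d_du (d_dx i g) p = d_dx i (d_du g) p" for p
  proof -
    have "d_du (d_dx i g) p = dird (\<lambda>q. dird g q (axis (Inl i) 1)) p d_u + cp p i * d_du (d_du g) p"
      unfolding d_dx_alt[OF assms]
      by (subst op_add) (auto simp: op_mult op_coord holo holo_op assms d_du_def[of "\<lambda>p. dird g p _"])
    then show ?thesis
      using dird_commute[OF assms, of "axis (Inl i) 1" p d_u]
      unfolding d_dx_alt[OF holo_op(3)[OF assms]] unfolding d_du_alt[of g] by simp
  qed
  then show "d_du (d_dx i g) = d_dx i (d_du g)" ..
qed

lemma dp_commute: "holomorphic_fn g \<Longrightarrow> d_dp i (d_dp j g) = d_dp j (d_dp i g)"
  unfolding d_dp_alt by (intro ext) (rule dird_commute)

lemma dp_dx_commute: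
  assumes "holomorphic_fn g"
  shows "d_dp i (d_dx j g) = (\<lambda>p. d_dx j (d_dp i g) p + delta i j * d_du g p)"
proof
  fix p
  have "d_dp i (d_dx j g) p = dird (\<lambda>q. dird g q (axis (Inl j) 1)) p (axis (Inr (Inr i)) 1)
      + cp p j * d_dp i (d_du g) p + delta i j * d_du g p"
    unfolding d_dx_alt[OF assms]
    by (subst op_add) (auto simp: op_mult op_coord holo holo_op assms d_dp_alt[of _ "\<lambda>p. dird g p _"])
  then show "d_dp i (d_dx j g) p = d_dx j (d_dp i g) p + delta i j * d_du g p"
    unfolding d_dx_alt[OF holo_op(2)[OF assms]] du_commute(2)[OF assms]
    using dird_commute[OF assms, of "axis (Inl j) 1" p "axis (Inr (Inr i)) 1"] by (simp add: d_dp_alt)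
qed

lemma dx_commute:
  assumes "holomorphic_fn g" shows "d_dx i (d_dx j g) = d_dx j (d_dx i g)"
proof
  fix p
  have "d_dx i (d_dx j g) p = d_dx i (\<lambda>q. dird g q (axis (Inl j) 1)) p + cp p j * d_dx i (d_du g) p" for i j
    unfolding d_dx_alt[OF assms, of j]
    by (subst op_add) (auto simp: op_mult op_coord holo holo_op assms)
  moreover have "d_dx i (\<lambda>q. dird g q (axis (Inl j) 1)) p
     = dird (\<lambda>q. dird g q (axis (Inl j) 1)) p (axis (Inl i) 1) + cp p i * dird (d_du g) p (axis (Inl j) 1)" for i j
    unfolding d_dx_alt[OF holo_dird[OF assms]] d_du_def[of "\<lambda>p. dird g p _"] d_du_alt[of g]
    using dird_commute[OF assms, of "axis (Inl j) 1" p d_u] by simp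
  moreover have "d_dx i (d_du g) p = dird (d_du g) p (axis (Inl i) 1) + cp p i * d_du (d_du g) p" for i
    unfolding d_dx_alt[OF holo_op(3)[OF assms]] ..
  ultimately show "d_dx i (d_dx j g) p = d_dx j (d_dx i g) p"
    using dird_commute[OF assms, of "axis (Inl j) 1" p "axis (Inl i) 1"] by (simp add: algebra_simps)
qed

lemma op_zero_imp_const:
  fixes g :: "'m::finite jet \<Rightarrow> complex"
  assumes g: "holomorphic_fn g" and X: "\<And>i. d_dx i g = (\<lambda>p. 0)" and U: "\<And>i. d_dp i g = (\<lambda>p. 0)"
  shows "g = (\<lambda>p. g 0)"
proof -
  have u: "d_du g p = 0" for p
    using dp_dx_commute[OF g, of None None] by (simp add: X U op_const delta_def fun_eq_iff)
  have "dird g p (axis k 1) = 0" for p k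
  proof (cases k)
    case (Inl i)
    then show ?thesis using X[of i] u unfolding d_dx_alt[OF g] by (simp add: fun_eq_iff)
  next
    case (Inr k')
    then show ?thesis using U u by (cases k') (auto simp: d_dp_alt d_du_alt fun_eq_iff)
  qed
  then show ?thesis using dird_zero_imp_const[OF g] by blast
qed

section \<open>Contact directions with constant coefficients\<close>

type_synonym 'm frame = "complex ^ ('m option + 'm option)"

text \<open>The contact vector fields \<open>\<Sum> c\<^sup>i X\<^sub>i + \<Sum> c\<^sub>i U\<^sup>i\<close> with constant coefficients include all
  \<open>V(\<lambda>,t)\<close>, and the commutator of two of them is a multiple of \<open>\<partial>\<^sub>u\<close>.\<close>

definition along :: "'m::finite frame \<Rightarrow> ('m jet \<Rightarrow> complex) \<Rightarrow> 'm jet \<Rightarrow> complex" where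
  "along c g p = (\<Sum>i\<in>UNIV. c $ Inl i * d_dx i g p) + (\<Sum>i\<in>UNIV. c $ Inr i * d_dp i g p)"

definition frame_field :: "'m::finite frame \<Rightarrow> 'm jet \<Rightarrow> 'm jet" where
  "frame_field c p = (\<Sum>i\<in>UNIV. c $ Inl i *s vf_X i p) + (\<Sum>i\<in>UNIV. c $ Inr i *s vf_U i p)"

definition frame_vec :: "complex \<Rightarrow> ('m \<Rightarrow> complex) \<Rightarrow> complex \<Rightarrow> ('m \<Rightarrow> complex) \<Rightarrow> 'm::finite frame" where
  "frame_vec x0 x p0 pp = (\<chi> k. case k of Inl i \<Rightarrow> (case i of None \<Rightarrow> x0 | Some a \<Rightarrow> x a) | Inr i \<Rightarrow> (case i of None \<Rightarrow> p0 | Some a \<Rightarrow> pp a))"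

lemma frame_vec_nth [simp]:
  "frame_vec x0 x p0 pp $ Inl None = x0" "frame_vec x0 x p0 pp $ Inl (Some a) = x a"
  "frame_vec x0 x p0 pp $ Inr None = p0" "frame_vec x0 x p0 pp $ Inr (Some a) = pp a"
  by (simp_all add: frame_vec_def)

lemma frame_eqI:
  fixes c d :: "'m::finite frame"
  assumes "c $ Inl None = d $ Inl None" "\<And>a. c $ Inl (Some a) = d $ Inl (Some a)"
    "c $ Inr None = d $ Inr None" "\<And>a. c $ Inr (Some a) = d $ Inr (Some a)"
  shows "c = d"
proof -
  have "c $ Inl i = d $ Inl i" "c $ Inr i = d $ Inr i" for i
    using assms by (cases i; simp)+
  then have "c $ k = d $ k" for k by (cases k) simp_all
  then show ?thesis by (simp add: vec_eq_iff)
qed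

lemma along_frame_field: "holomorphic_fn g \<Longrightarrow> along c g p = dird g p (frame_field c p)"
  by (simp add: along_def frame_field_def d_dx_def d_dp_def dird_vadd dird_vsum dird_scale)

lemma frame_field_nth [simp]:
  "frame_field c p $ Inl i = c $ Inl i" "frame_field c p $ Inr (Inr i) = c $ Inr i"
  "frame_field c p $ Inr (Inl ()) = (\<Sum>i\<in>UNIV. c $ Inl i * cp p i)"
  by (simp_all add: frame_field_def sum_component)

lemma along_frame_vec:
  "along (frame_vec x0 x p0 pp) g p = x0 * d_dx None g p + (\<Sum>a\<in>UNIV. x a * d_dx (Some a) g p)
     + p0 * d_dp None g p + (\<Sum>a\<in>UNIV. pp a * d_dp (Some a) g p)"
  by (simp add: along_def sum_option)

lemma holo_along [holo]: "holomorphic_fn g \<Longrightarrow> holomorphic_fn (along c g)"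
  unfolding along_def[abs_def] by (intro holo) auto

lemma along_lin: "along (c + d) g p = along c g p + along d g p" "along (k *s c) g p = k * along c g p"
  by (simp_all add: along_def algebra_simps sum.distrib sum_distrib_left)

lemma along_op [diff_rules]:
  assumes "holomorphic_fn f" "holomorphic_fn g"
  shows "along c (\<lambda>p. f p + g p) p = along c f p + along c g p"
    "along c (\<lambda>p. f p - g p) p = along c f p - along c g p"
    "along c (\<lambda>p. f p * g p) p = along c f p * g p + f p * along c g p"
  by (simp_all add: along_frame_field holo assms dird_add dird_diff dird_mult)

lemma along_minus [diff_rules]: "holomorphic_fn f \<Longrightarrow> along c (\<lambda>p. - f p) p = - along c f p"
  by (simp add: along_frame_field holo dird_minus)

lemma along_const [diff_rules]: "along c (\<lambda>p. k) p = 0"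
  by (simp add: along_frame_field holo dird_const)

lemma along_sum [diff_rules]: "(\<And>a. holomorphic_fn (F a)) \<Longrightarrow> along c (\<lambda>p. \<Sum>a\<in>A. F a p) p = (\<Sum>a\<in>A. along c (F a) p)"
  by (simp add: along_frame_field holo dird_sum)

lemma along_cmult [diff_rules]: "holomorphic_fn f \<Longrightarrow> along c (\<lambda>p. k * f p) p = k * along c f p"
  by (simp add: diff_rules holo)

lemma along_du: "holomorphic_fn g \<Longrightarrow> d_du (along c g) = along c (d_du g)"
  by (intro ext) (simp add: along_def[abs_def] diff_rules holo du_commute)

lemma along_dx:
  assumes "holomorphic_fn g" shows "along c (d_dx i g) p = d_dx i (along c g) p + c $ Inr i * d_du g p"
  unfolding along_def[of c "g", abs_def]
  by (simp add: diff_rules holo assms along_def dx_commute[OF assms, of i] dp_dx_commute[OF assms] algebra_simps sum.distrib)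

lemma along_dp:
  assumes "holomorphic_fn g" shows "along c (d_dp i g) p = d_dp i (along c g) p - c $ Inl i * d_du g p"
  unfolding along_def[of c "g", abs_def]
  by (simp add: diff_rules holo assms along_def dp_commute[OF assms, of i] dp_dx_commute[OF assms] algebra_simps sum.distrib)

section \<open>Symmetries annihilate the squares of the cone directions\<close>

definition cone_dir :: "'m::finite tensor3 \<Rightarrow> complex \<Rightarrow> ('m \<Rightarrow> complex) \<Rightarrow> 'm frame" where
  "cone_dir C l t = frame_vec (l^3) (\<lambda>a. - (l\<^sup>2 * t a)) (- (1/2 * cubic C t)) (\<lambda>a. - (3/2 * l * cubic1 C a t))"

lemma vf_V_frame_field: "vf_V C l t p = frame_field (cone_dir C l t) p"
  unfolding vf_V_def frame_field_def sum_option cone_dir_def frame_vec_nth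
  by (simp add: sum_negf vec_eq_iff)

lemma has_derivative_vscale:
  assumes "holomorphic_fn g"
  shows "((\<lambda>q. g q *s v) has_derivative (\<lambda>w. dird g p w *s v)) (at p)"
  by (rule bounded_linear.has_derivative[OF bounded_linear_vscale holomorphic_fn_has_derivative[OF assms]])

lemma frechet_derivative_nth:
  fixes A :: "complex ^ 'k::finite \<Rightarrow> complex ^ 'j::finite"
  assumes "\<And>k. holomorphic_fn (\<lambda>q. A q $ k)"
  shows "frechet_derivative A (at p) v $ k = dird (\<lambda>q. A q $ k) p v"
proof -
  have A: "A = (\<lambda>q. \<Sum>k\<in>UNIV. A q $ k *s axis k 1)"
    by (auto simp: vec_eq_iff axis_def if_distrib cong: if_cong)
  have "((\<lambda>q. \<Sum>k\<in>UNIV. A q $ k *s axis k 1) has_derivative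
      (\<lambda>w. \<Sum>k\<in>UNIV. dird (\<lambda>q. A q $ k) p w *s axis k 1)) (at p)"
    by (intro has_derivative_sum has_derivative_vscale assms)
  then have "(A has_derivative (\<lambda>w. \<Sum>k\<in>UNIV. dird (\<lambda>q. A q $ k) p w *s axis k 1)) (at p)"
    by (subst A)
  then have "frechet_derivative A (at p) = (\<lambda>w. \<Sum>k\<in>UNIV. dird (\<lambda>q. A q $ k) p w *s axis k 1)"
    by (rule frechet_derivative_at[symmetric])
  then show ?thesis by (simp add: sum_component axis_def if_distrib cong: if_cong)
qed

lemma contact_field_nth:
  "contact_field f p $ Inl i = - d_dp i f p"
  "contact_field f p $ Inr (Inl ()) = f p - (\<Sum>i\<in>UNIV. d_dp i f p * cp p i)"
  "contact_field f p $ Inr (Inr i) = d_dx i f p"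
  by (simp_all add: contact_field_def sum_component)

text \<open>The bracket has no \<open>\<partial>\<^sub>u\<close>-component, because a contact field preserves the contact
  distribution.\<close>

lemma lie_bracket_contact:
  fixes f :: "'m::finite jet \<Rightarrow> complex"
  assumes f: "holomorphic_fn f"
  shows "lie_bracket (contact_field f) (frame_field c) p
    = frame_field (\<chi> k. case k of Inl i \<Rightarrow> along c (d_dp i f) p | Inr i \<Rightarrow> - along c (d_dx i f) p) p"
    (is "?L = frame_field ?w p")
proof -
  have hS: "holomorphic_fn (\<lambda>q. contact_field f q $ k)" for k
  proof (cases k)
    case (Inl i) then show ?thesis by (simp add: contact_field_nth holo f)
  next
    case (Inr j) then show ?thesis by (cases j) (auto simp: contact_field_nth intro!: holo f)
  qed
  have hV: "holomorphic_fn (\<lambda>q. frame_field c q $ k)" for k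
  proof (cases k)
    case (Inl i) then show ?thesis by (simp add: holo)
  next
    case (Inr j) then show ?thesis by (cases j) (auto intro!: holo)
  qed
  have L: "?L $ k = dird (\<lambda>q. frame_field c q $ k) p (contact_field f p) - dird (\<lambda>q. contact_field f q $ k) p (frame_field c p)" for k
    unfolding lie_bracket_def by (simp add: frechet_derivative_nth[OF hS] frechet_derivative_nth[OF hV])
  show ?thesis
  proof (rule jet_eqI)
    fix i
    show "?L $ Inl i = frame_field ?w p $ Inl i"
      unfolding L by (simp add: contact_field_nth dird_const dird_minus holo f along_frame_field)
    show "?L $ Inr (Inr i) = frame_field ?w p $ Inr (Inr i)"
      unfolding L by (simp add: contact_field_nth dird_const holo f along_frame_field)
  next
    have V: "dird g p (frame_field c p) = along c g p" if "holomorphic_fn g" for g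
      using along_frame_field[OF that] by simp
    have cp: "along c (\<lambda>q. cp q i) p = c $ Inr i" for i
      by (simp add: along_def diff_rules)
    have 1: "dird (\<lambda>q. frame_field c q $ Inr (Inl ())) p (contact_field f p) = (\<Sum>i\<in>UNIV. c $ Inl i * d_dx i f p)"
      by (simp add: dird_sum dird_mult dird_const dird_nth holo contact_field_nth)
    have 2: "dird (\<lambda>q. contact_field f q $ Inr (Inl ())) p (frame_field c p)
       = along c f p - (\<Sum>i\<in>UNIV. along c (d_dp i f) p * cp p i + d_dp i f p * c $ Inr i)"
      unfolding contact_field_nth by (subst V) (auto simp: diff_rules cp holo f)
    show "?L $ Inr (Inl ()) = frame_field ?w p $ Inr (Inl ())"
      unfolding L 1 2 by (simp add: along_def[of c f] sum.distrib mult.commute)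
  qed
qed

text \<open>The symplectic form \<open>\<Sum> dx\<^sup>i \<and> du\<^sub>i\<close> of the contact distribution; the first argument is
  given by its frame coefficients.\<close>

definition omega :: "'m::finite frame \<Rightarrow> 'm jet \<Rightarrow> complex" where
  "omega c w = (\<Sum>i\<in>UNIV. c $ Inl i * w $ Inr (Inr i)) - (\<Sum>i\<in>UNIV. c $ Inr i * w $ Inl i)"

text \<open>The frame coefficients of \<open>[S\<^sub>f, V]\<close> are \<open>V U\<^sup>i f\<close> and \<open>- V X\<^sub>i f\<close>, and pairing them with
  those of \<open>V\<close> reassembles \<open>V\<close>.\<close>

lemma omega_bracket:
  assumes f: "holomorphic_fn f"
  shows "omega c (lie_bracket (contact_field f) (frame_field c) p) = - along c (along c f) p"
proof -
  have "along c (along c f) p = (\<Sum>i\<in>UNIV. c $ Inl i * along c (d_dx i f) p) + (\<Sum>i\<in>UNIV. c $ Inr i * along c (d_dp i f) p)"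
    unfolding along_def[of c f, abs_def] by (simp add: diff_rules holo f)
  then show ?thesis
    unfolding lie_bracket_contact[OF f] omega_def by (simp add: sum_negf)
qed

lemma cone_equations:
  fixes C :: "'m::finite tensor3"
  assumes "k \<in> cone_V C p"
  shows "k $ Inl None * k $ Inr (Inr (Some a)) = - (3/2) * cubic1 C a (\<lambda>b. k $ Inl (Some b))"
    "(k $ Inl None)\<^sup>2 * k $ Inr (Inr None) = 1/2 * cubic C (\<lambda>b. k $ Inl (Some b))"
proof -
  obtain c l t where k: "k = c *s frame_field (cone_dir C l t) p"
    using assms unfolding cone_V_def vf_V_frame_field by blast
  show "k $ Inl None * k $ Inr (Inr (Some a)) = - (3/2) * cubic1 C a (\<lambda>b. k $ Inl (Some b))"
    unfolding k by (simp add: cone_dir_def cubic1_def sum_distrib_left power2_eq_square power3_eq_cube mult_ac sum_negf)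
  show "(k $ Inl None)\<^sup>2 * k $ Inr (Inr None) = 1/2 * cubic C (\<lambda>b. k $ Inl (Some b))"
    unfolding k by (simp add: cone_dir_def cubic_def sum_distrib_left power2_eq_square power3_eq_cube mult_ac sum_negf)
qed

lemma omega_lin: "omega c (v + w) = omega c v + omega c w" "omega c (k *s v) = k * omega c v" "omega c 0 = 0"
  by (simp_all add: omega_def algebra_simps sum.distrib sum_distrib_left)

lemma has_field_derivative_cubic1:
  assumes C: "symmetric3 C" and g: "\<And>b. ((\<lambda>z. g b z) has_field_derivative g' b) (at z0)"
  shows "((\<lambda>z. cubic1 C a (\<lambda>b. g b z)) has_field_derivative 2 * polar C (\<lambda>b. g b z0) g' a) (at z0)"
proof -
  have "((\<lambda>z. cubic1 C a (\<lambda>b. g b z)) has_field_derivative polar C g' (\<lambda>b. g b z0) a + polar C (\<lambda>b. g b z0) g' a) (at z0)"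
    unfolding cubic1_def polar_def
    by (auto intro!: derivative_eq_intros g simp: sum.distrib sum_distrib_left algebra_simps)
  then show ?thesis using polar_commute[OF C, of g' "\<lambda>b. g b z0" a] by simp
qed

lemma has_field_derivative_cubic:
  assumes C: "symmetric3 C" and g: "\<And>b. ((\<lambda>z. g b z) has_field_derivative g' b) (at z0)"
  shows "((\<lambda>z. cubic C (\<lambda>b. g b z)) has_field_derivative 3 * dot g' (polar C (\<lambda>b. g b z0) (\<lambda>b. g b z0))) (at z0)"
proof -
  let ?t = "\<lambda>b. g b z0"
  have "((\<lambda>z. cubic C (\<lambda>b. g b z)) has_field_derivative trilin C g' ?t ?t + trilin C ?t g' ?t + trilin C ?t ?t g') (at z0)"
    unfolding cubic_def trilin_def
    by (auto intro!: derivative_eq_intros g simp: sum.distrib sum_distrib_left algebra_simps)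
  moreover have "trilin C ?t g' ?t = trilin C g' ?t ?t" "trilin C ?t ?t g' = trilin C g' ?t ?t"
    by (rule trilin_commute[OF C] | rule trans[OF trilin_commute(2)[OF C] trilin_commute(1)[OF C]])+
  ultimately show ?thesis by (simp add: dot_polar_trilin)
qed

text \<open>The cone is Legendrian. A curve in the cone satisfies \<open>cone_equations\<close>; differentiated at
  \<open>\<lambda> = 1\<close> they express the \<open>U\<close>-components of a velocity through its \<open>X\<close>-components, and its
  product with \<open>V\<close> is seen to vanish.\<close>

lemma omega_tangent:
  fixes C :: "'m::finite tensor3"
  assumes C: "symmetric3 C" and w: "w \<in> affine_tangent (cone_V C p) (vf_V C 1 t p)"
  shows "omega (cone_dir C 1 t) w = 0"
proof -
  let ?c = "cone_dir C 1 t"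
  have self: "omega ?c (vf_V C 1 t p) = 0"
    by (simp add: vf_V_frame_field omega_def mult.commute)
  have curve: "omega ?c w = 0"
    if g: "\<gamma> 0 = vf_V C 1 t p" "\<forall>\<^sub>F z in nhds 0. \<gamma> z \<in> cone_V C p"
      "\<And>k. ((\<lambda>z. \<gamma> z $ k) has_field_derivative w $ k) (at 0)" for \<gamma> :: "complex \<Rightarrow> 'm jet" and w
  proof -
    let ?x = "\<lambda>b. \<gamma> 0 $ Inl (Some b)" and ?wx = "\<lambda>b. w $ Inl (Some b)"
    have e1: "w $ Inl None * \<gamma> 0 $ Inr (Inr (Some a)) + \<gamma> 0 $ Inl None * w $ Inr (Inr (Some a)) = - (3 * polar C ?x ?wx a)" for a
    proof -
      have "((\<lambda>z. \<gamma> z $ Inl None * \<gamma> z $ Inr (Inr (Some a)) + 3/2 * cubic1 C a (\<lambda>b. \<gamma> z $ Inl (Some b)))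
        has_field_derivative (w $ Inl None * \<gamma> 0 $ Inr (Inr (Some a)) + w $ Inr (Inr (Some a)) * \<gamma> 0 $ Inl None
           + 3/2 * (2 * polar C ?x ?wx a))) (at 0)"
        by (intro DERIV_add DERIV_mult DERIV_cmult g(3) has_field_derivative_cubic1[OF C])
      moreover have "((\<lambda>z. \<gamma> z $ Inl None * \<gamma> z $ Inr (Inr (Some a)) + 3/2 * cubic1 C a (\<lambda>b. \<gamma> z $ Inl (Some b)))
        has_field_derivative 0) (at 0)"
        by (subst DERIV_cong_ev[OF refl _ refl, where g="\<lambda>_. 0"])
           (use g(2) in \<open>auto elim!: eventually_mono simp: cone_equations\<close>)
      ultimately have "w $ Inl None * \<gamma> 0 $ Inr (Inr (Some a)) + w $ Inr (Inr (Some a)) * \<gamma> 0 $ Inl None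
           + 3/2 * (2 * polar C ?x ?wx a) = 0" by (rule DERIV_unique)
      then show ?thesis unfolding eq_neg_iff_add_eq_0 by (simp add: mult_ac)
    qed
    have e2: "2 * \<gamma> 0 $ Inl None * w $ Inl None * \<gamma> 0 $ Inr (Inr None) + (\<gamma> 0 $ Inl None)\<^sup>2 * w $ Inr (Inr None)
        = 3/2 * dot ?wx (polar C ?x ?x)"
    proof -
      have "((\<lambda>z. (\<gamma> z $ Inl None * \<gamma> z $ Inl None) * \<gamma> z $ Inr (Inr None) + - (1/2) * cubic C (\<lambda>b. \<gamma> z $ Inl (Some b)))
        has_field_derivative ((w $ Inl None * \<gamma> 0 $ Inl None + w $ Inl None * \<gamma> 0 $ Inl None) * \<gamma> 0 $ Inr (Inr None)
           + w $ Inr (Inr None) * (\<gamma> 0 $ Inl None * \<gamma> 0 $ Inl None) + - (1/2) * (3 * dot ?wx (polar C ?x ?x)))) (at 0)"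
        by (intro DERIV_add DERIV_mult DERIV_cmult g(3) has_field_derivative_cubic[OF C])
      moreover have "((\<lambda>z. (\<gamma> z $ Inl None * \<gamma> z $ Inl None) * \<gamma> z $ Inr (Inr None) + - (1/2) * cubic C (\<lambda>b. \<gamma> z $ Inl (Some b)))
        has_field_derivative 0) (at 0)"
        by (subst DERIV_cong_ev[OF refl _ refl, where g="\<lambda>_. 0"])
           (use g(2) in \<open>auto elim!: eventually_mono simp: cone_equations(2)[unfolded power2_eq_square]\<close>)
      ultimately have "(w $ Inl None * \<gamma> 0 $ Inl None + w $ Inl None * \<gamma> 0 $ Inl None) * \<gamma> 0 $ Inr (Inr None)
           + w $ Inr (Inr None) * (\<gamma> 0 $ Inl None * \<gamma> 0 $ Inl None) + - (1/2) * (3 * dot ?wx (polar C ?x ?x)) = 0"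
        by (rule DERIV_unique)
      then show ?thesis by (simp add: algebra_simps add_eq_0_iff power2_eq_square)
    qed
    have x: "?x = (\<lambda>b. - t b)" "\<gamma> 0 $ Inl None = 1" "\<gamma> 0 $ Inr (Inr None) = - (1/2 * cubic C t)"
      "\<And>a. \<gamma> 0 $ Inr (Inr (Some a)) = - (3/2 * polar C t t a)"
      by (auto simp: g(1) vf_V_frame_field cone_dir_def cubic1_polar)
    have n: "polar C (\<lambda>b. - t b) v a = - polar C t v a" "polar C (\<lambda>b. - t b) (\<lambda>b. - t b) = polar C t t" for v a
      by (auto simp: polar_def sum_negf)
    have wa: "w $ Inr (Inr (Some a)) = 3/2 * polar C t t a * w $ Inl None + 3 * polar C t ?wx a" for a
      using e1[of a] unfolding x n by (simp add: algebra_simps)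
    have w0: "w $ Inr (Inr None) = cubic C t * w $ Inl None + 3/2 * dot ?wx (polar C t t)"
      using e2 unfolding x n by (simp add: field_simps)
    have "omega ?c w = w $ Inr (Inr None) - dot t (\<lambda>a. w $ Inr (Inr (Some a)))
       + 1/2 * cubic C t * w $ Inl None + 3/2 * dot ?wx (polar C t t)"
      by (simp add: omega_def cone_dir_def sum_option cubic1_polar dot_def sum_negf sum_distrib_left mult_ac)
    also have "dot t (\<lambda>a. w $ Inr (Inr (Some a))) = 3/2 * cubic C t * w $ Inl None + 3 * dot t (polar C t ?wx)"
      unfolding wa by (simp add: cubic_dot dot_def algebra_simps sum.distrib sum_distrib_left)
    also have "dot t (polar C t ?wx) = dot ?wx (polar C t t)"
    proof -
      have "trilin C t t ?wx = trilin C ?wx t t"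
        by (rule trans[OF trilin_commute(2)[OF C] trilin_commute(1)[OF C]])
      then show ?thesis by (simp only: dot_polar_trilin)
    qed
    finally show ?thesis unfolding w0 by (simp add: algebra_simps)
  qed
  show ?thesis
    using w unfolding affine_tangent_def
    by (rule vec.span_induct_alt) (use self curve in \<open>auto simp: omega_lin\<close>)
qed

lemma symmetry_imp_square:
  assumes C: "symmetric3 C" and f: "holomorphic_fn f" and s: "is_symmetry C f"
  shows "along (cone_dir C 1 t) (along (cone_dir C 1 t) f) p = 0"
proof -
  have V: "vf_V C 1 t = frame_field (cone_dir C 1 t)" by (intro ext) (rule vf_V_frame_field)
  have "omega (cone_dir C 1 t) (lie_bracket (contact_field f) (vf_V C 1 t) p) = 0"
    using s omega_tangent[OF C] unfolding is_symmetry_def by blast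
  then show ?thesis unfolding V omega_bracket[OF f] by simp
qed

section \<open>The structure equations\<close>

lemma cone_dir_1: "cone_dir C 1 t = frame_vec 1 (\<lambda>a. - t a) (- (1/2 * cubic C t)) (\<lambda>a. - (3/2 * polar C t t a))"
  by (simp add: cone_dir_def cubic1_polar)

lemma along_commutator:
  assumes f: "holomorphic_fn f"
  shows "along c (along d f) p = along d (along c f) p
     + ((\<Sum>i\<in>UNIV. c $ Inr i * d $ Inl i) - (\<Sum>i\<in>UNIV. c $ Inl i * d $ Inr i)) * d_du f p"
proof -
  have "along c (along d f) p = (\<Sum>i\<in>UNIV. d $ Inl i * along c (d_dx i f) p) + (\<Sum>i\<in>UNIV. d $ Inr i * along c (d_dp i f) p)"
    unfolding along_def[of d f, abs_def] by (simp add: diff_rules holo f)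
  also have "\<dots> = (\<Sum>i\<in>UNIV. d $ Inl i * d_dx i (along c f) p) + (\<Sum>i\<in>UNIV. d $ Inr i * d_dp i (along c f) p)
     + ((\<Sum>i\<in>UNIV. c $ Inr i * d $ Inl i) - (\<Sum>i\<in>UNIV. c $ Inl i * d $ Inr i)) * d_du f p"
    by (simp add: along_dx[OF f] along_dp[OF f] algebra_simps sum.distrib sum_distrib_left sum_subtractf)
  finally show ?thesis by (simp add: along_def[of d "along c f"])
qed

lemma holo_cdiv [holo]: "holomorphic_fn f \<Longrightarrow> holomorphic_fn (\<lambda>p. f p / k)"
  using holo_mult[OF _ holo_const[of "inverse k"], of f] by (simp add: divide_inverse)

lemma op_cdiv [diff_rules]:
  assumes "holomorphic_fn f"
  shows "d_dx i (\<lambda>p. f p / k) p = d_dx i f p / k" "d_dp i (\<lambda>p. f p / k) p = d_dp i f p / k" "d_du (\<lambda>p. f p / k) p = d_du f p / k"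
  by (simp_all add: divide_inverse diff_rules holo assms)

lemma sum2_lin:
  fixes x :: "'a::finite \<Rightarrow> complex" and y :: "'b::finite \<Rightarrow> complex"
  shows "(\<Sum>a\<in>UNIV. \<Sum>b\<in>UNIV. x a * y b * (h a b + k * g a b))
    = (\<Sum>a\<in>UNIV. \<Sum>b\<in>UNIV. x a * y b * h a b) + k * (\<Sum>a\<in>UNIV. \<Sum>b\<in>UNIV. x a * y b * g a b)"
  by (simp add: algebra_simps sum.distrib sum_distrib_left)

text \<open>The lines are the homogeneous parts of degree 0 to 6 in \<open>x\<close>. The terms \<open>1/2 f\<^sub>u\<close> in degree
  3 symmetrize the two orders of \<open>X\<close> and \<open>U\<close>, since \<open>[U\<^sup>i, X\<^sub>i] = \<partial>\<^sub>u\<close>.\<close>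

lemma square_formula:
  fixes C :: "'m::finite tensor3" and x :: "'m \<Rightarrow> complex"
  assumes f: "holomorphic_fn f"
  defines "s \<equiv> polar C x x" and "N \<equiv> cubic C x"
  shows "along (cone_dir C 1 x) (along (cone_dir C 1 x) f) p =
     d_dx None (d_dx None f) p
     - 2 * (\<Sum>a\<in>UNIV. x a * d_dx None (d_dx (Some a) f) p)
     + ((\<Sum>a\<in>UNIV. \<Sum>b\<in>UNIV. x a * x b * d_dx (Some a) (d_dx (Some b) f) p) - 3 * (\<Sum>a\<in>UNIV. s a * d_dx None (d_dp (Some a) f) p))
     + (3 * (\<Sum>a\<in>UNIV. \<Sum>b\<in>UNIV. x a * s b * (d_dx (Some a) (d_dp (Some b) f) p + 1/2 * delta b a * d_du f p))
         - N * (d_dx None (d_dp None f) p + 1/2 * d_du f p))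
     + (N * (\<Sum>a\<in>UNIV. x a * d_dx (Some a) (d_dp None f) p) + 9/4 * (\<Sum>a\<in>UNIV. \<Sum>b\<in>UNIV. s a * s b * d_dp (Some a) (d_dp (Some b) f) p))
     + 3/2 * N * (\<Sum>a\<in>UNIV. s a * d_dp None (d_dp (Some a) f) p)
     + 1/4 * N^2 * d_dp None (d_dp None f) p"
proof -
  define X where "X g p = (\<Sum>a\<in>UNIV. x a * d_dx (Some a) g p)" for g :: "'m jet \<Rightarrow> complex" and p
  define U where "U g p = (\<Sum>a\<in>UNIV. s a * d_dp (Some a) g p)" for g :: "'m jet \<Rightarrow> complex" and p
  have V: "along (cone_dir C 1 x) g = (\<lambda>p. d_dx None g p - X g p - 1/2 * N * d_dp None g p - 3/2 * U g p)" for g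
    by (intro ext) (simp add: cone_dir_1 along_frame_vec X_def U_def s_def N_def sum_negf sum_distrib_left mult_ac)
  have hX: "holomorphic_fn (X g)" "holomorphic_fn (U g)" if "holomorphic_fn g" for g
    unfolding X_def[abs_def] U_def[abs_def] by (intro holo that)+
  have Xc: "X (\<lambda>p. g p - h p) p = X g p - X h p" "U (\<lambda>p. g p - h p) p = U g p - U h p"
    if "holomorphic_fn g" "holomorphic_fn h" for g h p
    using that by (simp_all add: X_def U_def diff_rules holo sum_subtractf algebra_simps)
  have Xk: "X (\<lambda>p. k * g p) p = k * X g p" "U (\<lambda>p. k * g p) p = k * U g p"
     "X (\<lambda>p. g p / k) p = X g p / k" "U (\<lambda>p. g p / k) p = U g p / k"
    if "holomorphic_fn g" for g k p
    using that by (simp_all add: X_def U_def diff_rules holo sum_subtractf algebra_simps sum_distrib_left sum_divide_distrib)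
  have "along (cone_dir C 1 x) (along (cone_dir C 1 x) f) p =
      (d_dx None (d_dx None f) p - d_dx None (X f) p - 1/2 * N * d_dx None (d_dp None f) p - 3/2 * d_dx None (U f) p)
    - (X (d_dx None f) p - X (X f) p - 1/2 * N * X (d_dp None f) p - 3/2 * X (U f) p)
    - 1/2 * N * (d_dp None (d_dx None f) p - d_dp None (X f) p - 1/2 * N * d_dp None (d_dp None f) p - 3/2 * d_dp None (U f) p)
    - 3/2 * (U (d_dx None f) p - U (X f) p - 1/2 * N * U (d_dp None f) p - 3/2 * U (U f) p)"
    unfolding V by (simp add: diff_rules Xc Xk holo hX f mult.assoc)
  also have "d_dx None (X f) p = (\<Sum>a\<in>UNIV. x a * d_dx None (d_dx (Some a) f) p)"
    unfolding X_def[abs_def] by (simp add: diff_rules holo f)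
  also have "X (d_dx None f) p = (\<Sum>a\<in>UNIV. x a * d_dx None (d_dx (Some a) f) p)"
    unfolding X_def by (simp add: dx_commute[OF f, of None])
  also have "d_dx None (U f) p = (\<Sum>a\<in>UNIV. s a * d_dx None (d_dp (Some a) f) p)"
    unfolding U_def[abs_def] by (simp add: diff_rules holo f)
  also have "U (d_dx None f) p = (\<Sum>a\<in>UNIV. s a * d_dx None (d_dp (Some a) f) p)"
    unfolding U_def by (simp add: dp_dx_commute[OF f] delta_def)
  also have "X (X f) p = (\<Sum>a\<in>UNIV. \<Sum>b\<in>UNIV. x a * x b * d_dx (Some a) (d_dx (Some b) f) p)"
    unfolding X_def[abs_def] by (simp add: diff_rules holo f sum_distrib_left mult_ac)
  also have "U (U f) p = (\<Sum>a\<in>UNIV. \<Sum>b\<in>UNIV. s a * s b * d_dp (Some a) (d_dp (Some b) f) p)"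
    unfolding U_def[abs_def] by (simp add: diff_rules holo f sum_distrib_left mult_ac)
  also have "X (U f) p = (\<Sum>a\<in>UNIV. \<Sum>b\<in>UNIV. x a * s b * d_dx (Some a) (d_dp (Some b) f) p)"
    unfolding X_def U_def[abs_def] by (simp add: diff_rules holo f sum_distrib_left mult_ac)
  also have "U (X f) p = (\<Sum>b\<in>UNIV. \<Sum>a\<in>UNIV. x a * s b * (d_dx (Some a) (d_dp (Some b) f) p + delta b a * d_du f p))"
    unfolding X_def[abs_def] U_def by (simp add: diff_rules holo f sum_distrib_left mult_ac dp_dx_commute[OF f] delta_def)
  also have "\<dots> = (\<Sum>a\<in>UNIV. \<Sum>b\<in>UNIV. x a * s b * (d_dx (Some a) (d_dp (Some b) f) p + delta b a * d_du f p))"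
    by (rule sum.swap)
  also have "X (d_dp None f) p = (\<Sum>a\<in>UNIV. x a * d_dx (Some a) (d_dp None f) p)"
    by (simp add: X_def)
  also have "d_dp None (X f) p = (\<Sum>a\<in>UNIV. x a * d_dx (Some a) (d_dp None f) p)"
    unfolding X_def[abs_def] by (simp add: diff_rules holo f dp_dx_commute[OF f] delta_def)
  also have "d_dp None (U f) p = (\<Sum>a\<in>UNIV. s a * d_dp None (d_dp (Some a) f) p)"
    unfolding U_def[abs_def] by (simp add: diff_rules holo f)
  also have "U (d_dp None f) p = (\<Sum>a\<in>UNIV. s a * d_dp None (d_dp (Some a) f) p)"
    unfolding U_def by (simp add: dp_commute[OF f, of None])
  also have "d_dp None (d_dx None f) p = d_dx None (d_dp None f) p + d_du f p"
    by (simp add: dp_dx_commute[OF f] delta_def)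
  finally show ?thesis
    using sum2_lin[of x s "\<lambda>a b. d_dx (Some a) (d_dp (Some b) f) p" 1 "\<lambda>a b. delta b a * d_du f p"]
      sum2_lin[of x s "\<lambda>a b. d_dx (Some a) (d_dp (Some b) f) p" "1/2" "\<lambda>a b. delta b a * d_du f p"]
    by (simp add: algebra_simps power2_eq_square, simp add: field_simps)
qed

lemma polar_scale: "polar C (\<lambda>a. z * x a) (\<lambda>a. z * x a) = (\<lambda>a. z^2 * polar C x x a)"
  by (intro ext) (simp add: polar_def sum_distrib_left power2_eq_square mult_ac)

lemma cubic_scale: "cubic C (\<lambda>a. z * x a) = z^3 * cubic C x"
  by (simp add: cubic_def sum_distrib_left power3_eq_cube mult_ac)

text \<open>At each point the symmetrized second derivatives of \<open>f\<close> along the contact distribution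
  form an element of \<open>W \<oplus> W\<^sup>* \<oplus> sim(C)\<close>, where \<open>sim(C)\<close> are the similarities of the cubic: this is
  the Lie algebra of infinitesimal symplectic
  symmetries of the cone.\<close>

definition structure_eqs :: "'m::finite tensor3 \<Rightarrow> 'm tensor3 \<Rightarrow> ('m jet \<Rightarrow> complex) \<Rightarrow> bool" where
  "structure_eqs C D f \<longleftrightarrow>
     d_dx None (d_dx None f) = (\<lambda>p. 0) \<and>
     (\<forall>a. d_dx None (d_dx (Some a) f) = (\<lambda>p. 0)) \<and>
     (\<forall>a b. d_dx (Some a) (d_dx (Some b) f) = (\<lambda>p. 3 * (\<Sum>c\<in>UNIV. C a b c * d_dx None (d_dp (Some c) f) p))) \<and>
     d_dp None (d_dp None f) = (\<lambda>p. 0) \<and>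
     (\<forall>a. d_dp None (d_dp (Some a) f) = (\<lambda>p. 0)) \<and>
     (\<forall>a b. d_dp (Some a) (d_dp (Some b) f) = (\<lambda>p. - 3 * (\<Sum>c\<in>UNIV. D a b c * d_dx (Some c) (d_dp None f) p))) \<and>
     (\<forall>p. similarity C (\<lambda>b a. d_dx (Some a) (d_dp (Some b) f) p + 1/2 * delta b a * d_du f p)
            (d_dx None (d_dp None f) p + 1/2 * d_du f p))"

lemma similarity_iff_cubic:
  assumes C: "symmetric3 C"
  shows "similarity C B c \<longleftrightarrow> (\<forall>x. 3 * (\<Sum>a\<in>UNIV. \<Sum>b\<in>UNIV. x a * polar C x x b * B b a) = c * cubic C x)"
proof
  have e: "(\<Sum>a\<in>UNIV. \<Sum>b\<in>UNIV. x a * polar C x x b * B b a) = trilin C (mat_app B x) x x" for x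
    unfolding dot_polar_trilin[symmetric] dot_def mat_app_def sum_distrib_right
    by (subst sum.swap) (simp add: mult_ac)
  have t: "trilin C x (mat_app B x) x = trilin C (mat_app B x) x x" "trilin C x x (mat_app B x) = trilin C (mat_app B x) x x" for x
    by (rule trilin_commute[OF C] | rule trans[OF trilin_commute(2)[OF C] trilin_commute(1)[OF C]])+
  {
    assume "similarity C B c"
    then have "3 * trilin C (mat_app B x) x x = c * trilin C x x x" for x
      using similarity_trilin[of C B c x x x] t[of x] by simp
    then show "\<forall>x. 3 * (\<Sum>a\<in>UNIV. \<Sum>b\<in>UNIV. x a * polar C x x b * B b a) = c * cubic C x"
      unfolding e cubic_trilin by blast
  next
    assume *: "\<forall>x. 3 * (\<Sum>a\<in>UNIV. \<Sum>b\<in>UNIV. x a * polar C x x b * B b a) = c * cubic C x"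
    define T where "T d e f = (\<Sum>k\<in>UNIV. C k e f * B k d + C d k f * B k e + C d e k * B k f) - c * C d e f" for d e f
    have T: "symmetric3 T"
      unfolding symmetric3_def T_def by (simp add: symmetric3_swap[OF C] add_ac)
    have "cubic T x = trilin C (mat_app B x) x x + trilin C x (mat_app B x) x + trilin C x x (mat_app B x) - c * cubic C x" for x
      unfolding trilin_mat_app cubic_def T_def
      by (simp add: sum.distrib sum_distrib_left algebra_simps sum_subtractf)
    then have "cubic T x = 0" for x using *[rule_format, of x] unfolding e t by simp
    then have "T d e f = 0" for d e f using polarization3[OF T] by blast
    then show "similarity C B c" unfolding similarity_def T_def by simp
  }
qed

lemma quadratic_zero:
  assumes Q: "\<And>a b. Q a b = Q b a" and 0: "\<And>x. (\<Sum>a\<in>UNIV. \<Sum>b\<in>UNIV. x a * x b * Q a b) = (0::complex)"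
  shows "Q a (b::'m::finite) = 0"
proof -
  define q where "q x y = (\<Sum>a\<in>UNIV. \<Sum>b\<in>UNIV. x a * y b * Q a b)" for x y :: "'m \<Rightarrow> complex"
  have k: "q (delta a) (delta b) = Q a b" for a b
    by (simp add: q_def mult.assoc)
  have add: "q (\<lambda>i. x i + y i) (\<lambda>i. x i + y i) = q x x + q x y + q y x + q y y" for x y
    by (simp add: q_def algebra_simps sum.distrib)
  have z: "q x x = 0" for x using 0[of x] by (simp add: q_def)
  have "q (delta a) (delta b) + q (delta b) (delta a) = 0"
    using add[of "delta a" "delta b"] by (simp add: z)
  then show ?thesis unfolding k using Q[of a b] by simp
qed

lemma sum_polar:
  assumes T: "symmetric3 T"
  shows "(\<Sum>a\<in>UNIV. \<Sum>b\<in>UNIV. x a * x b * (\<Sum>c\<in>UNIV. T a b c * Y c)) = (\<Sum>c\<in>UNIV. polar T x x c * Y c)"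
proof -
  have "(\<Sum>a\<in>UNIV. \<Sum>b\<in>UNIV. \<Sum>c\<in>UNIV. x a * x b * (T a b c * Y c)) = (\<Sum>c\<in>UNIV. \<Sum>a\<in>UNIV. \<Sum>b\<in>UNIV. x a * x b * (T a b c * Y c))"
    by (rule sum_swap3)
  also have "\<dots> = (\<Sum>c\<in>UNIV. polar T x x c * Y c)"
    by (simp add: polar_def sum_distrib_left sum_distrib_right mult_ac symmetric3_swap[OF T])
  finally show ?thesis by (simp only: sum_distrib_left)
qed

text \<open>The product of the cubic with a linear form is a quadratic form in \<open>C(x\<^sup>2)\<close>; this makes
  the two terms of degree 4 in \<open>square_formula\<close> comparable.\<close>

lemma dual_cubic_dot:
  assumes C: "symmetric3 C" and D: "symmetric3 D" and dual: "dual_cubic C D"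
  shows "cubic C x * (\<Sum>c\<in>UNIV. x c * Y c)
    = 27/4 * (\<Sum>a\<in>UNIV. \<Sum>b\<in>UNIV. polar C x x a * polar C x x b * (\<Sum>c\<in>UNIV. D a b c * Y c))"
  unfolding sum_polar[OF D] using dual_cubic_star[OF C dual, of x x]
  by (simp add: cubic_dot[symmetric] sum_distrib_left algebra_simps)

text \<open>Replacing \<open>t\<close> by \<open>z t\<close> separates the homogeneous parts. Those of degree 1, 2, 3 are
  polarized directly. The part of degree 4 is a quadratic form in \<open>C(t\<^sup>2)\<close> by \<open>dual_cubic_dot\<close>,
  that of degree 5 is \<open>C(t\<^sup>3)\<close> times a linear form in \<open>C(t\<^sup>2)\<close>, and squares satisfy no linear or
  quadratic equations.\<close>

theorem square_imp_structure_eqs: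
  fixes C D :: "'m::finite tensor3"
  assumes C: "symmetric3 C" and D: "symmetric3 D" and dual: "dual_cubic C D" and nz: "C a0 b0 c0 \<noteq> 0"
    and f: "holomorphic_fn f" and sq: "\<And>t p. along (cone_dir C 1 t) (along (cone_dir C 1 t) f) p = 0"
  shows "structure_eqs C D f"
proof -
  let ?N = "cubic C" and ?s = "\<lambda>x. polar C x x"
  define k1 where "k1 x p = - 2 * (\<Sum>a\<in>UNIV. x a * d_dx None (d_dx (Some a) f) p)" for x p
  define k2 where "k2 x p = (\<Sum>a\<in>UNIV. \<Sum>b\<in>UNIV. x a * x b * d_dx (Some a) (d_dx (Some b) f) p) - 3 * (\<Sum>a\<in>UNIV. ?s x a * d_dx None (d_dp (Some a) f) p)" for x p
  define k3 where "k3 x p = 3 * (\<Sum>a\<in>UNIV. \<Sum>b\<in>UNIV. x a * ?s x b * (d_dx (Some a) (d_dp (Some b) f) p + 1/2 * delta b a * d_du f p))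
         - ?N x * (d_dx None (d_dp None f) p + 1/2 * d_du f p)" for x p
  define k4 where "k4 x p = ?N x * (\<Sum>a\<in>UNIV. x a * d_dx (Some a) (d_dp None f) p) + 9/4 * (\<Sum>a\<in>UNIV. \<Sum>b\<in>UNIV. ?s x a * ?s x b * d_dp (Some a) (d_dp (Some b) f) p)" for x p
  define k5 where "k5 x p = 3/2 * ?N x * (\<Sum>a\<in>UNIV. ?s x a * d_dp None (d_dp (Some a) f) p)" for x p
  define k6 where "k6 x p = 1/4 * (?N x)^2 * d_dp None (d_dp None f) p" for x p
  have "d_dx None (d_dx None f) p + k1 x p * z + k2 x p * z^2 + k3 x p * z^3 + k4 x p * z^4 + k5 x p * z^5 + k6 x p * z^6 = 0" for x p z
  proof -
    have s1: "(\<Sum>a\<in>UNIV. z * x a * h a) = z * (\<Sum>a\<in>UNIV. x a * h a)" for h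
      by (simp add: sum_distrib_left mult_ac)
    have s2: "(\<Sum>a\<in>UNIV. \<Sum>b\<in>UNIV. z * x a * (z * x b) * h a b) = z^2 * (\<Sum>a\<in>UNIV. \<Sum>b\<in>UNIV. x a * x b * h a b)" for h
      by (simp add: sum_distrib_left power2_eq_square mult_ac)
    have s2': "(\<Sum>a\<in>UNIV. z^2 * ?s x a * h a) = z^2 * (\<Sum>a\<in>UNIV. ?s x a * h a)" for h
      by (simp add: sum_distrib_left mult_ac)
    have s3: "(\<Sum>a\<in>UNIV. \<Sum>b\<in>UNIV. z * x a * (z^2 * ?s x b) * h a b) = z^3 * (\<Sum>a\<in>UNIV. \<Sum>b\<in>UNIV. x a * ?s x b * h a b)" for h
      by (simp add: sum_distrib_left power2_eq_square power3_eq_cube mult_ac)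
    have s4: "(\<Sum>a\<in>UNIV. \<Sum>b\<in>UNIV. z^2 * ?s x a * (z^2 * ?s x b) * h a b) = z^4 * (\<Sum>a\<in>UNIV. \<Sum>b\<in>UNIV. ?s x a * ?s x b * h a b)" for h
      by (simp add: sum_distrib_left power2_eq_square power4_eq_xxxx mult_ac)
    have z56: "z^5 = z^3 * z^2" "z^6 = (z^3)^2" by (simp_all add: power_add[symmetric] power_mult[symmetric])
    show ?thesis
      using sq[of "\<lambda>a. z * x a" p]
      unfolding square_formula[OF f] polar_scale cubic_scale s1 s2 s2' s3 s4 k1_def k2_def k3_def k4_def k5_def k6_def z56
      by (simp add: algebra_simps power_mult_distrib power4_eq_xxxx power3_eq_cube)
  qed
  note k = poly6_zero[OF this]
  have e0: "d_dx None (d_dx None f) = (\<lambda>p. 0)" using k(1) by blast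
  have e1: "d_dx None (d_dx (Some a) f) = (\<lambda>p. 0)" for a
    using k(2)[of "delta a"] by (intro ext) (simp add: k1_def)
  have e2: "d_dx (Some a) (d_dx (Some b) f) = (\<lambda>p. 3 * (\<Sum>c\<in>UNIV. C a b c * d_dx None (d_dp (Some c) f) p))" for a b
  proof
    fix p
    define Q where "Q a b = d_dx (Some a) (d_dx (Some b) f) p - 3 * (\<Sum>c\<in>UNIV. C a b c * d_dx None (d_dp (Some c) f) p)" for a b
    have "Q a b = 0"
    proof (rule quadratic_zero)
      show "Q a b = Q b a" for a b
        unfolding Q_def by (simp add: dx_commute[OF f, of "Some a"] symmetric3_swap(1)[OF C, of a])
      show "(\<Sum>a\<in>UNIV. \<Sum>b\<in>UNIV. x a * x b * Q a b) = 0" for x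
      proof -
        have "(\<Sum>a\<in>UNIV. \<Sum>b\<in>UNIV. x a * x b * Q a b) = k2 x p"
          using sum2_lin[of x x "\<lambda>a b. d_dx (Some a) (d_dx (Some b) f) p" "- 3" "\<lambda>a b. \<Sum>c\<in>UNIV. C a b c * d_dx None (d_dp (Some c) f) p"]
          unfolding Q_def k2_def sum_polar[OF C] by simp
        then show ?thesis using k(3) by simp
      qed
    qed
    then show "d_dx (Some a) (d_dx (Some b) f) p = 3 * (\<Sum>c\<in>UNIV. C a b c * d_dx None (d_dp (Some c) f) p)"
      by (simp add: Q_def)
  qed
  have e3: "similarity C (\<lambda>b a. d_dx (Some a) (d_dp (Some b) f) p + 1/2 * delta b a * d_du f p)
            (d_dx None (d_dp None f) p + 1/2 * d_du f p)" for p
    unfolding similarity_iff_cubic[OF C] using k(4)[of _ p] by (simp add: k3_def mult.commute)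
  have e4: "d_dp (Some a) (d_dp (Some b) f) = (\<lambda>p. - 3 * (\<Sum>c\<in>UNIV. D a b c * d_dx (Some c) (d_dp None f) p))" for a b
  proof
    fix p
    define Q where "Q a b = d_dp (Some a) (d_dp (Some b) f) p + 3 * (\<Sum>c\<in>UNIV. D a b c * d_dx (Some c) (d_dp None f) p)" for a b
    have "Q a b = 0"
    proof (rule squares_dominant[OF C nz dual])
      show "Q a b = Q b a" for a b
        unfolding Q_def by (simp add: dp_commute[OF f, of "Some a"] symmetric3_swap(1)[OF D, of a])
      show "dot (polar C x x) (mat_app Q (polar C x x)) = 0" for x
      proof -
        have "9/4 * dot (polar C x x) (mat_app Q (polar C x x)) = k4 x p"
          using sum2_lin[of "?s x" "?s x" "\<lambda>a b. d_dp (Some a) (d_dp (Some b) f) p" 3 "\<lambda>a b. \<Sum>c\<in>UNIV. D a b c * d_dx (Some c) (d_dp None f) p"]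
          unfolding k4_def Q_def dot_def mat_app_def dual_cubic_dot[OF C D dual]
          by (simp add: sum_distrib_left mult_ac)
        then show ?thesis using k(5)[of x p] by simp
      qed
    qed
    then show "d_dp (Some a) (d_dp (Some b) f) p = - 3 * (\<Sum>c\<in>UNIV. D a b c * d_dx (Some c) (d_dp None f) p)"
      by (simp add: Q_def add_eq_0_iff)
  qed
  have e5: "d_dp None (d_dp (Some a) f) = (\<lambda>p. 0)" for a
  proof
    fix p
    have "dot (polar C t t) (\<lambda>a. d_dp None (d_dp (Some a) f) p) = 0" for t
    proof (rule cubic_dense[where \<phi>="\<lambda>t. dot (polar C t t) (\<lambda>a. d_dp None (d_dp (Some a) f) p)", OF C nz])
      show "dot (polar C t t) (\<lambda>a. d_dp None (d_dp (Some a) f) p) = 0" if "cubic C t \<noteq> 0" for t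
        using k(6)[of t p] that by (simp add: k5_def dot_def)
    qed (auto simp: dot_def polar_def intro!: continuous_intros)
    then show "d_dp None (d_dp (Some a) f) p = 0"
      using squares_span[OF C nz dual, of "\<lambda>a. d_dp None (d_dp (Some a) f) p"] by blast
  qed
  have e6: "d_dp None (d_dp None f) = (\<lambda>p. 0)"
  proof
    fix p
    obtain t where "cubic C t \<noteq> 0" using nonzero_cubic[OF C nz] .
    then show "d_dp None (d_dp None f) p = 0" using k(7)[of t p] by (simp add: k6_def)
  qed
  show ?thesis unfolding structure_eqs_def using e0 e1 e2 e3 e4 e5 e6 by blast
qed

theorem structure_eqs_imp_square:
  fixes C D :: "'m::finite tensor3"
  assumes C: "symmetric3 C" and D: "symmetric3 D" and dual: "dual_cubic C D"
    and f: "holomorphic_fn f" and se: "structure_eqs C D f"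
  shows "along (cone_dir C 1 x) (along (cone_dir C 1 x) f) p = 0"
proof -
  let ?N = "cubic C x" and ?s = "polar C x x"
  have e2: "(\<Sum>a\<in>UNIV. \<Sum>b\<in>UNIV. x a * x b * d_dx (Some a) (d_dx (Some b) f) p) = 3 * (\<Sum>c\<in>UNIV. ?s c * d_dx None (d_dp (Some c) f) p)"
  proof -
    have "(\<Sum>a\<in>UNIV. \<Sum>b\<in>UNIV. x a * x b * d_dx (Some a) (d_dx (Some b) f) p)
       = 3 * (\<Sum>a\<in>UNIV. \<Sum>b\<in>UNIV. x a * x b * (\<Sum>c\<in>UNIV. C a b c * d_dx None (d_dp (Some c) f) p))"
      using se unfolding structure_eqs_def by (simp add: sum_distrib_left mult_ac)
    then show ?thesis unfolding sum_polar[OF C] .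
  qed
  have e3: "3 * (\<Sum>a\<in>UNIV. \<Sum>b\<in>UNIV. x a * ?s b * (d_dx (Some a) (d_dp (Some b) f) p + 1/2 * delta b a * d_du f p))
      = ?N * (d_dx None (d_dp None f) p + 1/2 * d_du f p)"
    using se unfolding structure_eqs_def similarity_iff_cubic[OF C] by (simp add: mult.commute)
  have e4: "?N * (\<Sum>a\<in>UNIV. x a * d_dx (Some a) (d_dp None f) p)
      + 9/4 * (\<Sum>a\<in>UNIV. \<Sum>b\<in>UNIV. ?s a * ?s b * d_dp (Some a) (d_dp (Some b) f) p) = 0"
  proof -
    have "(\<Sum>a\<in>UNIV. \<Sum>b\<in>UNIV. ?s a * ?s b * d_dp (Some a) (d_dp (Some b) f) p)
      = (\<Sum>a\<in>UNIV. \<Sum>b\<in>UNIV. ?s a * ?s b * (0 + (- 3) * (\<Sum>c\<in>UNIV. D a b c * d_dx (Some c) (d_dp None f) p)))"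
      using se unfolding structure_eqs_def by simp
    then show ?thesis unfolding dual_cubic_dot[OF C D dual] sum2_lin by simp
  qed
  show ?thesis
    unfolding square_formula[OF f] e2 e3 e4
    using se unfolding structure_eqs_def by simp
qed

section \<open>Tangency and brackets\<close>

lemma cone_dir_line:
  fixes C :: "'m::finite tensor3"
  assumes C: "symmetric3 C"
  shows "cone_dir C 1 (\<lambda>a. t a + z * x a) = cone_dir C 1 t
     + (z *s frame_vec 0 (\<lambda>a. - x a) (- (3/2 * dot x (polar C t t))) (\<lambda>a. - (3 * polar C t x a))
     + (z^2 *s frame_vec 0 (\<lambda>a. 0) (- (3/2 * dot t (polar C x x))) (\<lambda>a. - (3/2 * polar C x x a))
     + z^3 *s frame_vec 0 (\<lambda>a. 0) (- (1/2 * cubic C x)) (\<lambda>a. 0)))"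
proof -
  have l: "trilin C (\<lambda>a. t a + z * x a) y y' = trilin C t y y' + z * trilin C x y y'"
       "trilin C y (\<lambda>a. t a + z * x a) y' = trilin C y t y' + z * trilin C y x y'"
       "trilin C y y' (\<lambda>a. t a + z * x a) = trilin C y y' t + z * trilin C y y' x" for y y'
    using trilin_lin(1)[where r=1 and s=z] trilin_lin(2)[where r=1 and s=z] trilin_lin(3)[where r=1 and s=z] by simp_all
  have q: "trilin C t x t = trilin C x t t" "trilin C t t x = trilin C x t t" "trilin C x t x = trilin C t x x" "trilin C x x t = trilin C t x x"
    by (rule trilin_commute[OF C] | rule trans[OF trilin_commute(1)[OF C] trilin_commute(2)[OF C]]
        | rule trans[OF trilin_commute(2)[OF C] trilin_commute(1)[OF C]])+
  have cub: "cubic C (\<lambda>a. t a + z * x a) = cubic C t + z * (3 * dot x (polar C t t)) + z^2 * (3 * dot t (polar C x x)) + z^3 * cubic C x"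
    unfolding cubic_trilin dot_polar_trilin l q by (simp add: algebra_simps power2_eq_square power3_eq_cube)
  show ?thesis
    by (rule frame_eqI) (simp_all add: cone_dir_1 cub polar_line[OF C] algebra_simps)
qed

text \<open>The derivative of \<open>V(V f) = 0\<close> with respect to \<open>t\<close> in direction \<open>x\<close> is
  \<open>V(T f) + T(V f) = 0\<close> for the velocity \<open>T\<close> of \<open>V\<close>. The two terms agree, because \<open>T\<close> and \<open>V\<close> are
  orthogonal for the symplectic form and therefore commute.\<close>

lemma square_polarized:
  fixes C :: "'m::finite tensor3"
  assumes C: "symmetric3 C" and f: "holomorphic_fn f"
    and sq: "\<And>t p. along (cone_dir C 1 t) (along (cone_dir C 1 t) f) p = 0"
  shows "along (cone_dir C 1 t) (along (frame_vec 0 (\<lambda>a. - x a) (- (3/2 * dot x (polar C t t))) (\<lambda>a. - (3 * polar C t x a))) f) p = 0"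
proof -
  let ?v = "cone_dir C 1 t" and ?T = "frame_vec 0 (\<lambda>a. - x a) (- (3/2 * dot x (polar C t t))) (\<lambda>a. - (3 * polar C t x a))"
  define v2 where "v2 = frame_vec 0 (\<lambda>a. 0) (- (3/2 * dot t (polar C x x))) (\<lambda>a. - (3/2 * polar C x x a))"
  define v3 :: "'m frame" where "v3 = frame_vec 0 (\<lambda>a. 0) (- (1/2 * cubic C x)) (\<lambda>a. 0)"
  define B where "B c d = along c (along d f) p" for c d
  have B: "B (c + c') d = B c d + B c' d" "B c (d + d') = B c d + B c d'" "B (k *s c) d = k * B c d" "B c (k *s d) = k * B c d" for c c' d d' k
  proof -
    have "along (d + d') f = (\<lambda>p. along d f p + along d' f p)" "along (k *s d) f = (\<lambda>p. k * along d f p)"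
      by (intro ext, rule along_lin)+
    then show "B (c + c') d = B c d + B c' d" "B c (d + d') = B c d + B c d'" "B (k *s c) d = k * B c d" "B c (k *s d) = k * B c d"
      by (simp_all add: B_def along_lin diff_rules holo f)
  qed
  have "B ?v ?v + (B ?v ?T + B ?T ?v) * z + (B ?v v2 + B v2 ?v + B ?T ?T) * z^2 + (B ?v v3 + B v3 ?v + B ?T v2 + B v2 ?T) * z^3
     + (B ?T v3 + B v3 ?T + B v2 v2) * z^4 + (B v2 v3 + B v3 v2) * z^5 + B v3 v3 * z^6 = 0" for z
  proof -
    have "B (?v + (z *s ?T + (z^2 *s v2 + z^3 *s v3))) (?v + (z *s ?T + (z^2 *s v2 + z^3 *s v3))) = 0"
      using sq[of "\<lambda>a. t a + z * x a" p] unfolding cone_dir_line[OF C] B_def v2_def v3_def .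
    then show ?thesis unfolding B
      by (simp add: algebra_simps power2_eq_square power3_eq_cube power4_eq_xxxx eval_nat_numeral)
  qed
  from poly6_zero(2)[OF this] have 1: "B ?v ?T + B ?T ?v = 0" .
  have tc: "dot t (polar C t x) = dot x (polar C t t)"
    unfolding dot_polar_trilin by (rule trans[OF trilin_commute(2)[OF C] trilin_commute(1)[OF C]])
  have "B ?v ?T = B ?T ?v"
  proof -
    have "(\<Sum>i\<in>UNIV. ?v $ Inr i * ?T $ Inl i) - (\<Sum>i\<in>UNIV. ?v $ Inl i * ?T $ Inr i)
      = 3/2 * dot x (polar C t t) + 3/2 * dot x (polar C t t) - 3 * dot t (polar C t x)"
      by (simp add: sum_option cone_dir_1 dot_def sum_negf sum_distrib_left mult_ac)
    then show ?thesis unfolding B_def along_commutator[OF f, of ?v] tc by simp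
  qed
  with 1 show ?thesis by (simp add: B_def)
qed

text \<open>Reading \<open>square_polarized\<close> as linear in \<open>x\<close> expresses \<open>V X\<^sub>a f\<close> through the \<open>V U\<^sup>i f\<close>, and
  \<open>V(V f) = 0\<close> then determines \<open>V X\<^sub>0 f\<close>. These are the equations of the tangent space of the cone
  at \<open>V\<close>, imposed on the vector with coefficients \<open>V U\<^sup>i f\<close>, \<open>- V X\<^sub>i f\<close>.\<close>

lemma tangency:
  fixes C :: "'m::finite tensor3"
  assumes C: "symmetric3 C" and f: "holomorphic_fn f"
    and sq: "\<And>t p. along (cone_dir C 1 t) (along (cone_dir C 1 t) f) p = 0"
  defines "\<phi> \<equiv> \<lambda>t i p. along (cone_dir C 1 t) (d_dp i f) p"
  shows "dot x (\<lambda>a. along (cone_dir C 1 t) (d_dx (Some a) f) p)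
      = - (3/2 * dot x (polar C t t) * \<phi> t None p) - 3 * trilin C t x (\<lambda>a. \<phi> t (Some a) p)"
    "along (cone_dir C 1 t) (d_dx None f) p = - (cubic C t * \<phi> t None p) - 3/2 * dot (polar C t t) (\<lambda>a. \<phi> t (Some a) p)"
proof -
  let ?v = "cone_dir C 1 t"
  have ex: "along ?v (along (frame_vec x0 x p0 pp) f) p = x0 * along ?v (d_dx None f) p + dot x (\<lambda>a. along ?v (d_dx (Some a) f) p)
     + p0 * \<phi> t None p + dot pp (\<lambda>a. \<phi> t (Some a) p)" for x0 x p0 pp
    unfolding along_frame_vec[of _ _ _ _ f, abs_def] \<phi>_def by (simp add: diff_rules holo f dot_def)
  have neg: "dot (\<lambda>a. - x a) y = - dot x y" "dot (\<lambda>a. - (k * x a)) y = - (k * dot x y)" for x y k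
    by (simp_all add: dot_def sum_negf sum_distrib_left mult_ac)
  have t: "dot (polar C t x) y = trilin C t x y" for x y
    unfolding dot_commute[of _ y] dot_polar_trilin
    by (rule trans[OF trilin_commute(1)[OF C] trilin_commute(2)[OF C]])
  show 1: "dot x (\<lambda>a. along ?v (d_dx (Some a) f) p)
      = - (3/2 * dot x (polar C t t) * \<phi> t None p) - 3 * trilin C t x (\<lambda>a. \<phi> t (Some a) p)" for x
  proof -
    have ar: "a = - (u * b) - 3 * c" if "0 * r + - a + - u * b + - (3 * c) = 0" for a b c u r :: complex
    proof -
      have "a = a + (0 * r + - a + - u * b + - (3 * c))" using that by simp
      then show ?thesis by simp
    qed
    show ?thesis
      by (rule ar) (rule square_polarized[OF C f sq, of t x p, unfolded ex neg(2), unfolded neg(1) t])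
  qed
  have "along ?v (d_dx None f) p = dot t (\<lambda>a. along ?v (d_dx (Some a) f) p) + 1/2 * cubic C t * \<phi> t None p
      + 3/2 * dot (polar C t t) (\<lambda>a. \<phi> t (Some a) p)"
  proof -
    have ar: "a = b + n * c + d" if "1 * a + - b + - n * c + - d = 0" for a b c d n :: complex
    proof -
      have "a = a - (1 * a + - b + - n * c + - d)" using that by simp
      then show ?thesis by simp
    qed
    have "along ?v (along (frame_vec 1 (\<lambda>a. - t a) (- (1/2 * cubic C t)) (\<lambda>a. - (3/2 * polar C t t a))) f) p = 0"
      using sq[of t p] by (simp only: cone_dir_1)
    then show ?thesis unfolding ex neg(2) unfolding neg(1) by (rule ar)
  qed
  then show "along ?v (d_dx None f) p = - (cubic C t * \<phi> t None p) - 3/2 * dot (polar C t t) (\<lambda>a. \<phi> t (Some a) p)"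
    unfolding 1 cubic_dot[symmetric] t[symmetric] by (simp add: algebra_simps)
qed

text \<open>The tangent space described by \<open>tangency\<close> is Lagrangian, because the bilinear form
  \<open>C(t,-,-)\<close> is symmetric.\<close>

lemma tangency_isotropic:
  fixes C :: "'m::finite tensor3"
  assumes C: "symmetric3 C" and f: "holomorphic_fn f" and g: "holomorphic_fn g"
    and sf: "\<And>t p. along (cone_dir C 1 t) (along (cone_dir C 1 t) f) p = 0"
    and sg: "\<And>t p. along (cone_dir C 1 t) (along (cone_dir C 1 t) g) p = 0"
  defines "v \<equiv> \<lambda>t. cone_dir C 1 t"
  shows "(\<Sum>i\<in>UNIV. along (v t) (d_dx i f) p * along (v t) (d_dp i g) p)
       = (\<Sum>i\<in>UNIV. along (v t) (d_dx i g) p * along (v t) (d_dp i f) p)"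
proof -
  let ?f = "\<lambda>i. along (v t) (d_dp i f) p" and ?g = "\<lambda>i. along (v t) (d_dp i g) p"
  have s: "(\<Sum>i\<in>UNIV. along (v t) (d_dx i h) p * k i) = along (v t) (d_dx None h) p * k None + dot (\<lambda>a. k (Some a)) (\<lambda>a. along (v t) (d_dx (Some a) h) p)" for h k
    by (simp add: sum_option dot_def mult.commute)
  have "trilin C t (\<lambda>a. ?g (Some a)) (\<lambda>a. ?f (Some a)) = trilin C t (\<lambda>a. ?f (Some a)) (\<lambda>a. ?g (Some a))"
    by (rule trilin_commute[OF C])
  then show ?thesis
    unfolding s unfolding v_def tangency[OF C f sf] tangency[OF C g sg] dot_commute[of "polar C t t"]
    by (simp add: algebra_simps)
qed

text \<open>In \<open>V(V [f,g])\<close> the terms with one derivative on each factor cancel by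
  \<open>tangency_isotropic\<close>. The others arise from commuting \<open>V\<close> with \<open>X\<^sub>i\<close> and \<open>U\<^sup>i\<close>, which produces
  multiples of \<open>V f\<^sub>u\<close> and \<open>V g\<^sub>u\<close> that cancel in pairs.\<close>

theorem square_lagrange:
  fixes C :: "'m::finite tensor3"
  assumes C: "symmetric3 C" and f: "holomorphic_fn f" and g: "holomorphic_fn g"
    and sf: "\<And>t p. along (cone_dir C 1 t) (along (cone_dir C 1 t) f) p = 0"
    and sg: "\<And>t p. along (cone_dir C 1 t) (along (cone_dir C 1 t) g) p = 0"
  shows "along (cone_dir C 1 t) (along (cone_dir C 1 t) (lagrange f g)) p = 0"
proof -
  let ?V = "along (cone_dir C 1 t)"
  let ?c = "cone_dir C 1 t"
  have V2: "?V (?V (\<lambda>p. a p * b p)) p = ?V (?V a) p * b p + 2 * ?V a p * ?V b p + a p * ?V (?V b) p"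
    if "holomorphic_fn a" "holomorphic_fn b" for a b
  proof -
    have "?V (\<lambda>p. a p * b p) = (\<lambda>p. ?V a p * b p + a p * ?V b p)" by (intro ext) (simp add: diff_rules that)
    then show ?thesis by (simp add: diff_rules holo that)
  qed
  have V2d: "?V (?V (\<lambda>p. a p - b p)) p = ?V (?V a) p - ?V (?V b) p" "?V (?V (\<lambda>p. a p + b p)) p = ?V (?V a) p + ?V (?V b) p"
    if "holomorphic_fn a" "holomorphic_fn b" for a b
  proof -
    have "?V (\<lambda>p. a p - b p) = (\<lambda>p. ?V a p - ?V b p)" "?V (\<lambda>p. a p + b p) = (\<lambda>p. ?V a p + ?V b p)" by (intro ext, simp add: diff_rules that)+
    then show "?V (?V (\<lambda>p. a p - b p)) p = ?V (?V a) p - ?V (?V b) p" "?V (?V (\<lambda>p. a p + b p)) p = ?V (?V a) p + ?V (?V b) p"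
      by (simp_all add: diff_rules holo that)
  qed
  have V2s: "?V (?V (\<lambda>p. \<Sum>i\<in>UNIV. h i p)) p = (\<Sum>i\<in>UNIV. ?V (?V (h i)) p)" if "\<And>i. holomorphic_fn (h i)" for h :: "'m option \<Rightarrow> _"
  proof -
    have "?V (\<lambda>p. \<Sum>i\<in>UNIV. h i p) = (\<lambda>p. \<Sum>i\<in>UNIV. ?V (h i) p)" by (intro ext) (simp add: diff_rules that)
    then show ?thesis by (simp add: diff_rules holo that)
  qed
  have zero: "?V (?V f) = (\<lambda>p. 0)" "?V (?V g) = (\<lambda>p. 0)" using sf sg by auto
  have V2u: "?V (?V (d_du h)) p = 0" if "holomorphic_fn h" "?V (?V h) = (\<lambda>p. 0)" for h
  proof -
    have "?V (?V (d_du h)) = d_du (?V (?V h))"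
      unfolding along_du[OF holo_along[OF that(1)]] along_du[OF that(1)] ..
    then show ?thesis unfolding that(2) by (simp add: op_const)
  qed
  have V2x: "?V (?V (d_dx i h)) p = 2 * ?c $ Inr i * ?V (d_du h) p" if "holomorphic_fn h" "?V (?V h) = (\<lambda>p. 0)" for h i
  proof -
    have "?V (d_dx i h) = (\<lambda>p. d_dx i (?V h) p + ?c $ Inr i * d_du h p)" by (intro ext) (rule along_dx[OF that(1)])
    then show ?thesis
      by (simp add: diff_rules holo that along_dx[OF holo_along[OF that(1)]] along_du[symmetric])
  qed
  have V2p: "?V (?V (d_dp i h)) p = - 2 * ?c $ Inl i * ?V (d_du h) p" if "holomorphic_fn h" "?V (?V h) = (\<lambda>p. 0)" for h i
  proof -
    have "?V (d_dp i h) = (\<lambda>p. d_dp i (?V h) p - ?c $ Inl i * d_du h p)" by (intro ext) (rule along_dp[OF that(1)])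
    then show ?thesis
      by (simp add: diff_rules holo that along_dp[OF holo_along[OF that(1)]] along_du[symmetric])
  qed
  have "?V (?V (lagrange f g)) p = 2 * ?V f p * ?V (d_du g) p - 2 * ?V g p * ?V (d_du f) p
     + (\<Sum>i\<in>UNIV. 2 * ?c $ Inr i * ?V (d_du f) p * d_dp i g p + 2 * ?V (d_dx i f) p * ?V (d_dp i g) p
           + d_dx i f p * (- 2 * ?c $ Inl i * ?V (d_du g) p)
         - (2 * ?c $ Inr i * ?V (d_du g) p * d_dp i f p + 2 * ?V (d_dx i g) p * ?V (d_dp i f) p
           + d_dx i g p * (- 2 * ?c $ Inl i * ?V (d_du f) p)))"
    unfolding lagrange_def[abs_def]
    by (simp add: V2d V2 V2s holo f g V2u[OF f zero(1)] V2u[OF g zero(2)] V2x[OF f zero(1)] V2x[OF g zero(2)] V2p[OF f zero(1)] V2p[OF g zero(2)] zero)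
  also have "\<dots> = 2 * ?V f p * ?V (d_du g) p - 2 * ?V g p * ?V (d_du f) p
     + 2 * ?V (d_du f) p * ?V g p - 2 * ?V (d_du g) p * ?V f p
     + 2 * ((\<Sum>i\<in>UNIV. ?V (d_dx i f) p * ?V (d_dp i g) p) - (\<Sum>i\<in>UNIV. ?V (d_dx i g) p * ?V (d_dp i f) p))"
    unfolding along_def[of ?c f p] along_def[of ?c g p]
    by (simp add: sum.distrib sum_subtractf sum_distrib_left algebra_simps sum_negf)
  also have "\<dots> = 0" using tangency_isotropic[OF C f g sf sg, of t p] by simp
  finally show ?thesis .
qed

section \<open>The converse: annihilation implies symmetry\<close>

lemma frame_field_lin: "frame_field (c + d) p = frame_field c p + frame_field d p" "frame_field (k *s c) p = k *s frame_field c p" "frame_field 0 p = 0"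
proof -
  show "frame_field (c + d) p = frame_field c p + frame_field d p"
    by (rule jet_eqI) (simp_all add: algebra_simps sum.distrib)
  show "frame_field (k *s c) p = k *s frame_field c p"
    by (rule jet_eqI) (simp_all add: sum_distrib_left mult_ac)
  show "frame_field 0 p = 0" by (rule jet_eqI) simp_all
qed

lemma affine_tangent_lin:
  "0 \<in> affine_tangent K v"
  "v \<in> affine_tangent K v"
  "x \<in> affine_tangent K v \<Longrightarrow> y \<in> affine_tangent K v \<Longrightarrow> x + y \<in> affine_tangent K v"
  "x \<in> affine_tangent K v \<Longrightarrow> k *s x \<in> affine_tangent K v"
  unfolding affine_tangent_def by (auto intro: vec.span_zero vec.span_base vec.span_add vec.span_scale)

lemma affine_tangent_curve:
  assumes "\<gamma> 0 = v" "\<And>z. \<gamma> z \<in> K" "\<And>k. ((\<lambda>z. \<gamma> z $ k) has_field_derivative w $ k) (at 0)"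
  shows "w \<in> affine_tangent K v"
  unfolding affine_tangent_def by (rule vec.span_base) (use assms in auto)

lemma cone_V_frame_field: "c *s frame_field (cone_dir C l t) p \<in> cone_V C p"
  unfolding cone_V_def vf_V_frame_field by blast

lemma cone_dir_scale:
  fixes C :: "'m::finite tensor3"
  assumes "l \<noteq> 0" shows "cone_dir C l (\<lambda>a. l * t a) = l^3 *s cone_dir C 1 t"
  by (rule frame_eqI)
     (simp_all add: cone_dir_def cubic1_polar polar_scale cubic_scale power2_eq_square power3_eq_cube)

lemma tangent_ordinary:
  fixes C :: "'m::finite tensor3"
  assumes C: "symmetric3 C" and l: "l \<noteq> 0"
  shows "frame_field (l^3 *s frame_vec 0 (\<lambda>a. - x a) (- (3/2 * dot x (polar C t t))) (\<lambda>a. - (3 * polar C t x a))) p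
    \<in> affine_tangent (cone_V C p) (vf_V C l (\<lambda>a. l * t a) p)"
proof -
  define v2 where "v2 = frame_vec 0 (\<lambda>a. 0) (- (3/2 * dot t (polar C x x))) (\<lambda>a. - (3/2 * polar C x x a))"
  define v3 :: "'m frame" where "v3 = frame_vec 0 (\<lambda>a. 0) (- (1/2 * cubic C x)) (\<lambda>a. 0)"
  define v1 where "v1 = frame_vec 0 (\<lambda>a. - x a) (- (3/2 * dot x (polar C t t))) (\<lambda>a. - (3 * polar C t x a))"
  define \<gamma> where "\<gamma> z = frame_field (cone_dir C l (\<lambda>a. l * (t a + z * x a))) p" for z
  have \<gamma>: "\<gamma> z = l^3 *s (frame_field (cone_dir C 1 t) p + (z *s frame_field v1 p + (z^2 *s frame_field v2 p + z^3 *s frame_field v3 p)))" for z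
    unfolding \<gamma>_def cone_dir_scale[OF l] cone_dir_line[OF C] v1_def v2_def v3_def frame_field_lin ..
  have "frame_field (l^3 *s v1) p \<in> affine_tangent (cone_V C p) (vf_V C l (\<lambda>a. l * t a) p)"
  proof (rule affine_tangent_curve[of \<gamma>])
    show "\<gamma> 0 = vf_V C l (\<lambda>a. l * t a) p" by (simp add: \<gamma>_def vf_V_frame_field)
    show "\<gamma> z \<in> cone_V C p" for z
      using cone_V_frame_field[of 1 C l "\<lambda>a. l * (t a + z * x a)" p] by (simp add: \<gamma>_def)
    show "((\<lambda>z. \<gamma> z $ k) has_field_derivative frame_field (l^3 *s v1) p $ k) (at 0)" for k
      unfolding \<gamma> frame_field_lin by (auto intro!: derivative_eq_intros)
  qed
  then show ?thesis by (simp add: v1_def)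
qed

text \<open>By \<open>polar_kernel\<close> the map \<open>C(t, -)\<close> from \<open>W\<close> to its dual is injective.\<close>

lemma polar_surj:
  fixes C :: "'m::finite tensor3"
  assumes C: "symmetric3 C" and dual: "dual_cubic C D" and t: "cubic C t \<noteq> 0"
  shows "\<exists>x. polar C t x = z"
proof -
  define F :: "complex ^ 'm \<Rightarrow> complex ^ 'm" where "F x = (\<chi> a. polar C t (\<lambda>b. x $ b) a)" for x
  have lin: "Vector_Spaces.linear (*s) (*s) F"
    by unfold_locales (auto simp: F_def vec_eq_iff polar_def algebra_simps sum.distrib sum_distrib_left)
  have "inj F"
  proof (rule injI)
    fix x y assume "F x = F y"
    then have "polar C (\<lambda>b. x $ b - y $ b) t a = 0" for a
      unfolding polar_commute[OF C, of _ t]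
      by (simp add: F_def vec_eq_iff polar_def algebra_simps sum_subtractf)
    then have "x $ a - y $ a = 0" for a using polar_kernel[OF C dual t, of "\<lambda>b. x $ b - y $ b"] by blast
    then show "x = y" by (simp add: vec_eq_iff)
  qed
  then have "surj F" by (rule vec.linear_inj_imp_surj[OF lin])
  then obtain x where "F x = (\<chi> a. z a)" by (metis surjD)
  then show ?thesis by (intro exI[of _ "\<lambda>b. x $ b"]) (simp add: F_def vec_eq_iff fun_eq_iff)
qed

text \<open>At \<open>\<lambda> = 0\<close> the point of the cone is a multiple of \<open>U\<^sup>0\<close>. The curves \<open>z \<mapsto> V(z,x)\<close> through
  it have the velocities \<open>C\<^sub>a(x\<^sup>2) U\<^sup>a\<close> up to factors, where \<open>x\<close> runs over the vectors with nonzero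
  cubic. Differences of the squares of two such \<open>x\<close> near \<open>t\<close> give all \<open>C(t,x)\<close>, and these exhaust
  the dual space by \<open>polar_surj\<close>.\<close>

lemma tangent_vertex:
  fixes C :: "'m::finite tensor3"
  assumes C: "symmetric3 C" and dual: "dual_cubic C D" and t: "cubic C t \<noteq> 0"
  shows "frame_field (frame_vec 0 (\<lambda>a. 0) 0 z) p \<in> affine_tangent (cone_V C p) (vf_V C 0 t p)"
proof -
  let ?A = "affine_tangent (cone_V C p) (vf_V C 0 t p)"
  have frame_vec_lin: "frame_vec 0 (\<lambda>a. 0) 0 (\<lambda>a. y a + z a) = (frame_vec 0 (\<lambda>a. 0) 0 y + frame_vec 0 (\<lambda>a. 0) 0 z :: 'm frame)"
    "frame_vec 0 (\<lambda>a. 0) 0 (\<lambda>a. k * y a) = (k *s frame_vec 0 (\<lambda>a. 0) 0 y :: 'm frame)" for y z :: "'m \<Rightarrow> complex" and k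
    by (rule frame_eqI; simp)+
  define S where "S = {z. frame_field (frame_vec 0 (\<lambda>a. 0) 0 z) p \<in> ?A}"
  have S: "(\<lambda>a. y a + z a) \<in> S" "(\<lambda>a. k * y a) \<in> S" if "y \<in> S" "z \<in> S" for y z k
    using that unfolding S_def by (simp_all add: frame_vec_lin frame_field_lin affine_tangent_lin)
  have sq: "polar C x x \<in> S" if x: "cubic C x \<noteq> 0" for x
  proof -
    \<comment> \<open>this factor makes the curve start at the given point of the cone\<close>
    define r where "r = cubic C t / cubic C x"
    define \<gamma> where "\<gamma> z = r *s frame_field (cone_dir C z x) p" for z
    have "frame_field (frame_vec 0 (\<lambda>a. 0) 0 (\<lambda>a. - (3/2 * r) * polar C x x a)) p \<in> ?A"
    proof (rule affine_tangent_curve[of \<gamma>])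
      have "r *s cone_dir C 0 x = cone_dir C 0 t"
        using x by (intro frame_eqI) (simp_all add: cone_dir_def r_def)
      then show "\<gamma> 0 = vf_V C 0 t p" by (simp add: \<gamma>_def vf_V_frame_field frame_field_lin[symmetric])
      show "\<gamma> z \<in> cone_V C p" for z unfolding \<gamma>_def by (rule cone_V_frame_field)
      have fr: "cone_dir C z x = z^3 *s frame_vec 1 (\<lambda>a. 0) 0 (\<lambda>a. 0) + (z^2 *s frame_vec 0 (\<lambda>a. - x a) 0 (\<lambda>a. 0)
          + (frame_vec 0 (\<lambda>a. 0) (- (1/2 * cubic C x)) (\<lambda>a. 0) + z *s frame_vec 0 (\<lambda>a. 0) 0 (\<lambda>a. - (3/2) * polar C x x a)))" for z
        by (rule frame_eqI) (simp_all add: cone_dir_def cubic1_polar)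
      have "(\<lambda>a. - (3/2 * r) * polar C x x a) = (\<lambda>a. r * (- (3/2) * polar C x x a))" by (simp add: mult_ac)
      then have w: "frame_field (frame_vec 0 (\<lambda>a. 0) 0 (\<lambda>a. - (3/2 * r) * polar C x x a)) p = r *s frame_field (frame_vec 0 (\<lambda>a. 0) 0 (\<lambda>a. - (3/2) * polar C x x a)) p"
        by (simp only: frame_vec_lin frame_field_lin)
      show "((\<lambda>z. \<gamma> z $ k) has_field_derivative frame_field (frame_vec 0 (\<lambda>a. 0) 0 (\<lambda>a. - (3/2 * r) * polar C x x a)) p $ k) (at 0)" for k
        unfolding \<gamma>_def fr w frame_field_lin by (auto intro!: derivative_eq_intros)
    qed
    then have 1: "(\<lambda>a. - (3/2 * r) * polar C x x a) \<in> S" by (simp add: S_def)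
    have "(\<lambda>a. (- 1 / (3/2 * r)) * (- (3/2 * r) * polar C x x a)) \<in> S" using S(2)[OF 1 1] .
    moreover have "r \<noteq> 0" using t x by (simp add: r_def)
    ultimately show ?thesis by simp
  qed
  have "polar C t x \<in> S" for x
  proof -
    have "isCont (\<lambda>h. cubic C (\<lambda>a. t a + h * x a)) 0" "isCont (\<lambda>h. cubic C (\<lambda>a. t a + (- h) * x a)) 0"
      unfolding cubic_def by (intro continuous_intros)+
    then obtain e e' where e: "e > 0" "\<And>h. dist 0 h < e \<Longrightarrow> cubic C (\<lambda>a. t a + h * x a) \<noteq> 0"
       "e' > 0" "\<And>h. dist 0 h < e' \<Longrightarrow> cubic C (\<lambda>a. t a + (- h) * x a) \<noteq> 0"
      using continuous_at_avoid[of "0::complex" "\<lambda>h. cubic C (\<lambda>a. t a + h * x a)" 0]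
        continuous_at_avoid[of "0::complex" "\<lambda>h. cubic C (\<lambda>a. t a + (- h) * x a)" 0] t by auto
    \<comment> \<open>small enough that the cubic is nonzero at \<open>t + h x\<close> and \<open>t - h x\<close>\<close>
    define h :: complex where "h = of_real (min e e' / 2)"
    have h: "h \<noteq> 0" "dist 0 h < e" "dist 0 h < e'" using e(1,3) by (auto simp: h_def norm_divide dist_norm)
    have "polar C (\<lambda>a. t a + h * x a) (\<lambda>a. t a + h * x a) \<in> S" "polar C (\<lambda>a. t a + (- h) * x a) (\<lambda>a. t a + (- h) * x a) \<in> S"
      using sq e(2)[OF h(2)] e(4)[OF h(3)] by auto
    then have "(\<lambda>a. polar C (\<lambda>a. t a + h * x a) (\<lambda>a. t a + h * x a) a + (- 1) * polar C (\<lambda>a. t a + (- h) * x a) (\<lambda>a. t a + (- h) * x a) a) \<in> S"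
      (is "?d \<in> S") using S by blast
    then have "(\<lambda>a. (1 / (4 * h)) * ?d a) \<in> S" using S(2)[of ?d ?d] by blast
    moreover have "?d a = 4 * h * polar C t x a" for a
    proof -
      show ?thesis unfolding polar_line[OF C] by (simp add: algebra_simps)
    qed
    ultimately show ?thesis using h(1) by simp
  qed
  then have "z \<in> S" using polar_surj[OF C dual t, of z] by auto
  then show ?thesis by (simp add: S_def)
qed

text \<open>For \<open>\<lambda> \<noteq> 0\<close>, \<open>tangency\<close> exhibits \<open>[S\<^sub>f, V]\<close> as a combination of \<open>V\<close> and the velocity of
  the curve \<open>z \<mapsto> V(1, s + z x)\<close> with \<open>s = t/\<lambda>\<close> and a suitable direction \<open>x\<close>.
  For \<open>\<lambda> = 0\<close> the equations
  \<open>U\<^sup>0 U\<^sup>i f = 0\<close> leave only components along the \<open>U\<^sup>i\<close>, which are tangent by \<open>tangent_vertex\<close>.\<close>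

theorem square_imp_symmetry:
  fixes C D :: "'m::finite tensor3"
  assumes C: "symmetric3 C" and dual: "dual_cubic C D"
    and f: "holomorphic_fn f" and sq: "\<And>t p. along (cone_dir C 1 t) (along (cone_dir C 1 t) f) p = 0"
    and se: "structure_eqs C D f"
  shows "is_symmetry C f"
  unfolding is_symmetry_def
proof (intro allI)
  fix l :: complex and t :: "'m \<Rightarrow> complex" and p
  let ?A = "affine_tangent (cone_V C p) (vf_V C l t p)"
  have V: "vf_V C l t = frame_field (cone_dir C l t)" by (intro ext) (rule vf_V_frame_field)
  show "lie_bracket (contact_field f) (vf_V C l t) p \<in> ?A"
  proof (cases "l = 0")
    case True
    have v0: "cone_dir C l t = (- (1/2 * cubic C t)) *s frame_vec 0 (\<lambda>a. 0) 1 (\<lambda>a. 0)"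
      using True by (intro frame_eqI) (simp_all add: cone_dir_def)
    let ?k = "- (1/2 * cubic C t)"
    have vn: "cone_dir C l t $ Inl i = 0" "cone_dir C l t $ Inr None = ?k" "cone_dir C l t $ Inr (Some a) = 0" for i a
      by (cases i) (simp_all add: cone_dir_def True)
    have d: "along (cone_dir C l t) g p = ?k * d_dp None g p" for g
      unfolding v0 along_lin by (simp add: along_frame_vec)
    have U: "d_dp None (d_dp i f) p = 0" for i
      using se unfolding structure_eqs_def by (cases i) simp_all
    show ?thesis
    proof (cases "cubic C t = 0")
      case True
      have "(\<chi> k. case k of Inl i \<Rightarrow> along (cone_dir C l t) (d_dp i f) p | Inr i \<Rightarrow> - along (cone_dir C l t) (d_dx i f) p) = 0"
        unfolding d True by (simp add: vec_eq_iff split: sum.splits)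
      then show ?thesis unfolding V lie_bracket_contact[OF f] by (simp add: frame_field_lin affine_tangent_lin(1))
    next
      case False
      define z where "z a = - (?k * d_dp None (d_dx (Some a) f) p)" for a
      have "(\<chi> k. case k of Inl i \<Rightarrow> along (cone_dir C l t) (d_dp i f) p | Inr i \<Rightarrow> - along (cone_dir C l t) (d_dx i f) p)
         = (- d_dp None (d_dx None f) p) *s cone_dir C l t + frame_vec 0 (\<lambda>a. 0) 0 z" (is "?w = ?w'")
        by (rule frame_eqI) (simp_all add: d U vn z_def)
      note eq = this
      have "frame_field (frame_vec 0 (\<lambda>a. 0) 0 z) p \<in> affine_tangent (cone_V C p) (frame_field (cone_dir C l t) p)"
        using tangent_vertex[OF C dual False, of z p] \<open>l = 0\<close> by (simp add: vf_V_frame_field)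
      then show ?thesis
        unfolding V lie_bracket_contact[OF f] eq frame_field_lin by (intro affine_tangent_lin)
    qed
  next
    case False
    define s where "s a = t a / l" for a
    have t: "t = (\<lambda>a. l * s a)" using False by (simp add: s_def)
    have v: "cone_dir C l t = l^3 *s cone_dir C 1 s" unfolding t by (rule cone_dir_scale[OF False])
    let ?\<phi> = "\<lambda>i. along (cone_dir C 1 s) (d_dp i f) p"
    \<comment> \<open>the direction of the curve; the \<open>X\<close>-components leave no other choice once
      the multiple of \<open>V\<close> is fixed by the component along
      \<open>X\<^sub>0\<close>\<close>
    define x where "x a = - ?\<phi> (Some a) - s a * ?\<phi> None" for a
    let ?T = "frame_vec 0 (\<lambda>a. - x a) (- (3/2 * dot x (polar C s s))) (\<lambda>a. - (3 * polar C s x a))"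
    have psi: "along (cone_dir C 1 s) (d_dx (Some a) f) p = - (3/2 * polar C s s a * ?\<phi> None) - 3 * polar C s (\<lambda>b. ?\<phi> (Some b)) a" for a
    proof -
      have "trilin C s (delta a) (\<lambda>b. ?\<phi> (Some b)) = polar C s (\<lambda>b. ?\<phi> (Some b)) a"
        using dot_polar_trilin[of "delta a" C s] trilin_commute(1)[OF C, of s "delta a"] by simp
      then show ?thesis using tangency(1)[OF C f sq, of "delta a" s p] by simp
    qed
    have cx: "polar C s x a = - polar C s (\<lambda>b. ?\<phi> (Some b)) a - ?\<phi> None * polar C s s a" for a
      unfolding x_def polar_def by (simp add: algebra_simps sum_subtractf sum_negf sum_distrib_left)
    have dx: "dot x (polar C s s) = - dot (polar C s s) (\<lambda>b. ?\<phi> (Some b)) - ?\<phi> None * cubic C s"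
      unfolding x_def cubic_dot by (simp add: dot_def algebra_simps sum_subtractf sum_negf sum_distrib_left)
    have v1: "cone_dir C 1 s $ Inl None = 1" "cone_dir C 1 s $ Inl (Some a) = - s a"
      "cone_dir C 1 s $ Inr None = - (1/2 * cubic C s)" "cone_dir C 1 s $ Inr (Some a) = - (3/2 * polar C s s a)" for a
      by (simp_all add: cone_dir_1)
    have "(\<chi> k. case k of Inl i \<Rightarrow> along (cone_dir C l t) (d_dp i f) p | Inr i \<Rightarrow> - along (cone_dir C l t) (d_dx i f) p)
       = ?\<phi> None *s cone_dir C l t + l^3 *s ?T" (is "?w = ?w'")
    proof (rule frame_eqI)
      show "?w $ Inl None = ?w' $ Inl None" "?w $ Inl (Some a) = ?w' $ Inl (Some a)" for a
        unfolding v by (simp_all add: along_lin v1 x_def algebra_simps)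
      show "?w $ Inr None = ?w' $ Inr None"
        unfolding v by (simp add: along_lin tangency(2)[OF C f sq] dx v1, simp add: field_simps)
      show "?w $ Inr (Some a) = ?w' $ Inr (Some a)" for a
        unfolding v by (simp add: along_lin psi cx v1, simp add: field_simps)
    qed
    then show ?thesis
      unfolding V lie_bracket_contact[OF f]
      using affine_tangent_lin(2)[of "frame_field (cone_dir C l t) p" "cone_V C p"] tangent_ordinary[OF C False, of x s p]
      unfolding t[symmetric] vf_V_frame_field
      by (simp only: frame_field_lin) (blast intro: affine_tangent_lin)
  qed
qed

section \<open>The top generator\<close>

lemma delta_option [simp]:
  "delta None None = 1" "delta (Some a) (Some b) = delta a b" "delta None (Some b) = 0" "delta (Some a) None = 0" "delta a a = 1"
  by (simp_all add: delta_def)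

lemma polar_lin:
  "polar T (\<lambda>a. x a + y a) z a = polar T x z a + polar T y z a" "polar T z (\<lambda>a. x a + y a) a = polar T z x a + polar T z y a"
  "polar T (\<lambda>a. k * x a) z a = k * polar T x z a" "polar T z (\<lambda>a. k * x a) a = k * polar T z x a"
  "polar T (\<lambda>a. 0) z a = 0" "polar T z (\<lambda>a. 0) a = 0"
  by (simp_all add: polar_def algebra_simps sum.distrib sum_distrib_left)

lemma dird_polar:
  assumes "\<And>b. holomorphic_fn (q b)" "\<And>b. holomorphic_fn (r b)"
  shows "dird (\<lambda>p. polar T (\<lambda>b. q b p) (\<lambda>b. r b p) a) p v
    = polar T (\<lambda>b. dird (q b) p v) (\<lambda>b. r b p) a + polar T (\<lambda>b. q b p) (\<lambda>b. dird (r b) p v) a"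
  unfolding polar_def
  by (simp add: dird_sum dird_mult dird_const holo assms sum.distrib algebra_simps)

lemma holo_polar [holo]:
  assumes "\<And>b. holomorphic_fn (q b)" "\<And>b. holomorphic_fn (r b)"
  shows "holomorphic_fn (\<lambda>p. polar T (\<lambda>b. q b p) (\<lambda>b. r b p) a)"
  unfolding polar_def by (intro holo assms)

lemma holo_cubic [holo]:
  assumes "\<And>b. holomorphic_fn (q b)" shows "holomorphic_fn (\<lambda>p. cubic T (\<lambda>b. q b p))"
  unfolding cubic_def by (intro holo assms)

lemma dird_cubic:
  assumes T: "symmetric3 T" and q: "\<And>b. holomorphic_fn (q b)"
  shows "dird (\<lambda>p. cubic T (\<lambda>b. q b p)) p v = 3 * dot (\<lambda>b. dird (q b) p v) (polar T (\<lambda>b. q b p) (\<lambda>b. q b p))"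
proof -
  let ?q = "\<lambda>b. q b p" and ?d = "\<lambda>b. dird (q b) p v"
  have "dird (\<lambda>p. cubic T (\<lambda>b. q b p)) p v = trilin T ?d ?q ?q + trilin T ?q ?d ?q + trilin T ?q ?q ?d"
    unfolding cubic_def trilin_def
    by (simp add: dird_sum dird_mult dird_const holo q sum.distrib algebra_simps)
  moreover have "trilin T ?q ?d ?q = trilin T ?d ?q ?q" "trilin T ?q ?q ?d = trilin T ?d ?q ?q"
    by (rule trilin_commute[OF T] | rule trans[OF trilin_commute(2)[OF T] trilin_commute(1)[OF T]])+
  ultimately show ?thesis by (simp add: dot_polar_trilin)
qed

lemma op_polar [diff_rules]:
  assumes "\<And>b. holomorphic_fn (q b)" "\<And>b. holomorphic_fn (r b)"
  shows "d_dx i (\<lambda>p. polar T (\<lambda>b. q b p) (\<lambda>b. r b p) a) p = polar T (\<lambda>b. d_dx i (q b) p) (\<lambda>b. r b p) a + polar T (\<lambda>b. q b p) (\<lambda>b. d_dx i (r b) p) a"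
    "d_dp i (\<lambda>p. polar T (\<lambda>b. q b p) (\<lambda>b. r b p) a) p = polar T (\<lambda>b. d_dp i (q b) p) (\<lambda>b. r b p) a + polar T (\<lambda>b. q b p) (\<lambda>b. d_dp i (r b) p) a"
    "d_du (\<lambda>p. polar T (\<lambda>b. q b p) (\<lambda>b. r b p) a) p = polar T (\<lambda>b. d_du (q b) p) (\<lambda>b. r b p) a + polar T (\<lambda>b. q b p) (\<lambda>b. d_du (r b) p) a"
  unfolding d_dx_def d_dp_def d_du_def by (rule dird_polar[OF assms])+

lemma op_cubic [diff_rules]:
  assumes "symmetric3 T" "\<And>b. holomorphic_fn (q b)"
  shows "d_dx i (\<lambda>p. cubic T (\<lambda>b. q b p)) p = 3 * dot (\<lambda>b. d_dx i (q b) p) (polar T (\<lambda>b. q b p) (\<lambda>b. q b p))"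
    "d_dp i (\<lambda>p. cubic T (\<lambda>b. q b p)) p = 3 * dot (\<lambda>b. d_dp i (q b) p) (polar T (\<lambda>b. q b p) (\<lambda>b. q b p))"
    "d_du (\<lambda>p. cubic T (\<lambda>b. q b p)) p = 3 * dot (\<lambda>b. d_du (q b) p) (polar T (\<lambda>b. q b p) (\<lambda>b. q b p))"
  unfolding d_dx_def d_dp_def d_du_def by (rule dird_cubic[OF assms])+

abbreviation jx :: "'m::finite jet \<Rightarrow> 'm \<Rightarrow> complex" where "jx p \<equiv> (\<lambda>a. cx p (Some a))"
abbreviation jp :: "'m::finite jet \<Rightarrow> 'm \<Rightarrow> complex" where "jp p \<equiv> (\<lambda>a. cp p (Some a))"
abbreviation jxp :: "'m::finite jet \<Rightarrow> complex" where "jxp p \<equiv> (\<Sum>i\<in>UNIV. cx p i * cp p i)"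

definition topgen :: "'m::finite tensor3 \<Rightarrow> 'm tensor3 \<Rightarrow> 'm jet \<Rightarrow> complex" where
  "topgen C D p = cu p * (cu p - jxp p) - 1/2 * cubic C (jx p) * cp p None + 1/2 * cubic D (jp p) * cx p None
     + 9/4 * (\<Sum>a\<in>UNIV. polar C (jx p) (jx p) a * polar D (jp p) (jp p) a)"

lemma dot_simps [simp]: "dot (\<lambda>a. delta b a) y = y b" "dot (\<lambda>a. delta a b) y = y b" "dot (\<lambda>a. 0) y = 0"
  by (simp_all add: dot_def)

lemma holo_topgen [holo]: "holomorphic_fn (topgen C D)"
  unfolding topgen_def[abs_def] by (intro holo)

context
  fixes C D :: "'m::finite tensor3"
  assumes C: "symmetric3 C" and D: "symmetric3 D"
begin

lemma polar_comm2: "polar C (\<lambda>b. delta a b) x c = polar C x (\<lambda>b. delta a b) c" "polar D (\<lambda>b. delta a b) x c = polar D x (\<lambda>b. delta a b) c"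
  using polar_commute[OF C] polar_commute[OF D] by blast+

lemma polar_expand:
  "(\<Sum>a\<in>UNIV. t a * polar C x (\<lambda>b. delta a b) c) = polar C x t c"
  "(\<Sum>a\<in>UNIV. t a * polar D x (\<lambda>b. delta a b) c) = polar D x t c"
proof -
  have "(\<Sum>a\<in>UNIV. t a * polar T x (\<lambda>b. delta a b) c) = polar T x t c" if "symmetric3 T" for T
    unfolding polar_commute[OF that, of x] polar_delta polar_def[of T t x]
    by (simp add: sum_distrib_left mult_ac)
  then show "(\<Sum>a\<in>UNIV. t a * polar C x (\<lambda>b. delta a b) c) = polar C x t c"
    "(\<Sum>a\<in>UNIV. t a * polar D x (\<lambda>b. delta a b) c) = polar D x t c" using C D by blast+
qed

lemma topgen_du: "d_du (topgen C D) = (\<lambda>p. 2 * cu p - jxp p)"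
  unfolding topgen_def[abs_def]
  by (intro ext) (simp add: diff_rules holo C D polar_lin)

lemma topgen_dx0: "d_dx None (topgen C D) = (\<lambda>p. cu p * cp p None - cp p None * jxp p + 1/2 * cubic D (jp p))"
  unfolding topgen_def[abs_def]
  by (intro ext) (simp add: diff_rules holo C D polar_lin algebra_simps)

lemma topgen_dxa: "d_dx (Some a) (topgen C D) = (\<lambda>p. cu p * cp p (Some a) - cp p (Some a) * jxp p
    - 3/2 * polar C (jx p) (jx p) a * cp p None + 9/2 * (\<Sum>c\<in>UNIV. polar C (jx p) (\<lambda>b. delta a b) c * polar D (jp p) (jp p) c))"
  unfolding topgen_def[abs_def]
  by (intro ext) (simp add: diff_rules holo C D polar_lin polar_comm2 algebra_simps sum.distrib sum_distrib_left)

lemma topgen_dp0: "d_dp None (topgen C D) = (\<lambda>p. - (cu p * cx p None) - 1/2 * cubic C (jx p))"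
  unfolding topgen_def[abs_def]
  by (intro ext) (simp add: diff_rules holo C D polar_lin algebra_simps)

lemma topgen_dpa: "d_dp (Some a) (topgen C D) = (\<lambda>p. - (cu p * cx p (Some a)) + 3/2 * polar D (jp p) (jp p) a * cx p None
     + 9/2 * (\<Sum>c\<in>UNIV. polar C (jx p) (jx p) c * polar D (jp p) (\<lambda>b. delta a b) c))"
  unfolding topgen_def[abs_def]
  by (intro ext) (simp add: diff_rules holo C D polar_lin polar_comm2 algebra_simps sum.distrib sum_distrib_left)

lemma topgen_x0x0: "d_dx None (d_dx None (topgen C D)) = (\<lambda>p. 0)"
  unfolding topgen_dx0 by (intro ext) (simp add: diff_rules holo C D algebra_simps)

lemma topgen_x0xa: "d_dx None (d_dx (Some a) (topgen C D)) = (\<lambda>p. 0)"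
  unfolding topgen_dxa by (intro ext) (simp add: diff_rules holo C D polar_lin algebra_simps)

lemma topgen_x0p: "d_dx None (d_dp (Some c) (topgen C D)) = (\<lambda>p. 3/2 * polar D (jp p) (jp p) c - cx p (Some c) * cp p None)"
  unfolding topgen_dpa by (intro ext) (simp add: diff_rules holo C D polar_lin algebra_simps)

lemma topgen_xp0: "d_dx (Some c) (d_dp None (topgen C D)) = (\<lambda>p. - (cp p (Some c) * cx p None) - 3/2 * polar C (jx p) (jx p) c)"
  unfolding topgen_dp0 by (intro ext) (simp add: diff_rules holo C D polar_lin algebra_simps)

lemma topgen_x0p0: "d_dx None (d_dp None (topgen C D)) = (\<lambda>p. - (cp p None * cx p None) - cu p)"
  unfolding topgen_dp0 by (intro ext) (simp add: diff_rules holo C D polar_lin algebra_simps)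

lemma topgen_xp: "d_dx (Some a) (d_dp (Some b) (topgen C D)) = (\<lambda>p. - (cp p (Some a) * cx p (Some b)) - cu p * delta b a
     + 9 * (\<Sum>c\<in>UNIV. polar C (jx p) (\<lambda>b. delta a b) c * polar D (jp p) (\<lambda>d. delta b d) c))"
  unfolding topgen_dpa
  by (intro ext) (simp add: diff_rules holo C D polar_lin polar_comm2 algebra_simps sum.distrib sum_distrib_left, simp add: delta_def)

lemma topgen_xx: "d_dx (Some a) (d_dx (Some b) (topgen C D)) = (\<lambda>p. 3 * (\<Sum>c\<in>UNIV. C a b c * d_dx None (d_dp (Some c) (topgen C D)) p))"
proof -
  have k: "polar C (\<lambda>d. delta a d) (\<lambda>d. delta b d) c = C a b c" for a b c
    by (simp add: polar_def mult.assoc symmetric3_swap[OF C])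
  have k2: "polar C x (\<lambda>d. delta a d) b = (\<Sum>c\<in>UNIV. C a b c * x c)" for x
    unfolding polar_comm2(1)[symmetric] polar_delta by (simp add: symmetric3_swap[OF C])
  have "d_dx (Some a) (d_dx (Some b) (topgen C D)) p = - 3 * polar C (jx p) (\<lambda>d. delta a d) b * cp p None
      + 9/2 * (\<Sum>c\<in>UNIV. polar C (\<lambda>d. delta a d) (\<lambda>d. delta b d) c * polar D (jp p) (jp p) c)" for p
    unfolding topgen_dxa by (simp add: diff_rules holo C D polar_lin polar_comm2(1)[of a "jx p"] algebra_simps)
  then show ?thesis
    unfolding k k2 topgen_x0p by (intro ext) (simp add: algebra_simps sum_subtractf sum_distrib_left sum_negf)
qed

lemma topgen_p0p0: "d_dp None (d_dp None (topgen C D)) = (\<lambda>p. 0)"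
  unfolding topgen_dp0 by (intro ext) (simp add: diff_rules holo C D algebra_simps)

lemma topgen_p0pa: "d_dp None (d_dp (Some a) (topgen C D)) = (\<lambda>p. 0)"
  unfolding topgen_dpa by (intro ext) (simp add: diff_rules holo C D polar_lin algebra_simps)

lemma topgen_pp: "d_dp (Some a) (d_dp (Some b) (topgen C D)) = (\<lambda>p. - 3 * (\<Sum>c\<in>UNIV. D a b c * d_dx (Some c) (d_dp None (topgen C D)) p))"
proof -
  have k: "polar D (\<lambda>d. delta a d) (\<lambda>d. delta b d) c = D a b c" for a b c
    by (simp add: polar_def mult.assoc symmetric3_swap[OF D])
  have k2: "polar D x (\<lambda>d. delta a d) b = (\<Sum>c\<in>UNIV. D a b c * x c)" for x
    unfolding polar_comm2(2)[symmetric] polar_delta by (simp add: symmetric3_swap[OF D])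
  have "d_dp (Some a) (d_dp (Some b) (topgen C D)) p = 3 * polar D (jp p) (\<lambda>d. delta a d) b * cx p None
      + 9/2 * (\<Sum>c\<in>UNIV. polar C (jx p) (jx p) c * polar D (\<lambda>d. delta a d) (\<lambda>d. delta b d) c)" for p
    unfolding topgen_dpa by (simp add: diff_rules holo C D polar_lin polar_comm2(2)[of a "jp p"] algebra_simps)
  then show ?thesis
    unfolding k k2 topgen_xp0 by (intro ext) (simp add: algebra_simps sum.distrib sum_distrib_left sum_subtractf sum_negf)
qed

text \<open>The similarity condition carries the content. Contracted with \<open>t\<close> and \<open>C(t\<^sup>2)\<close>, the matrix \<open>X\<^sub>a U\<^sup>b f\<close> contains \<open>9 P \<cdot> D(C(X,t), C(t\<^sup>2))\<close> from the last term of the generator and \<open>- (P \<cdot> t) C(X,t,t)\<close>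
  from \<open>u(u - x\<^sup>i u\<^sub>i)\<close>. By \<open>dual_cubic_star\<close> the sum is a multiple of \<open>C(t\<^sup>3)\<close>, and the factor
  \<open>9/4\<close> in the generator is the one for which this happens.\<close>

theorem topgen_structure_eqs:
  assumes dual: "dual_cubic C D"
  shows "structure_eqs C D (topgen C D)"
proof -
  have sim: "similarity C (\<lambda>b a. d_dx (Some a) (d_dp (Some b) (topgen C D)) p + 1/2 * delta b a * d_du (topgen C D) p)
        (d_dx None (d_dp None (topgen C D)) p + 1/2 * d_du (topgen C D) p)" for p
    unfolding similarity_iff_cubic[OF C]
  proof (intro allI)
    fix t
    let ?s = "polar C t t" and ?X = "jx p" and ?P = "jp p"
    have body: "d_dx (Some a) (d_dp (Some b) (topgen C D)) p + 1/2 * delta b a * d_du (topgen C D) p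
      = - (?P a * ?X b) + - (1/2 * jxp p) * delta b a
           + 9 * (\<Sum>c\<in>UNIV. polar C ?X (\<lambda>b. delta a b) c * polar D ?P (\<lambda>d. delta b d) c)" for a b
    proof -
      have "- u - c * k + S + 1/2 * k * (2 * c - e) = - u + - (1/2 * e) * k + S" for u c k S e :: complex
        by (simp add: field_simps)
      then show ?thesis unfolding topgen_xp topgen_du .
    qed
    have "(\<Sum>a\<in>UNIV. \<Sum>b\<in>UNIV. t a * ?s b * (d_dx (Some a) (d_dp (Some b) (topgen C D)) p + 1/2 * delta b a * d_du (topgen C D) p))
       = (\<Sum>a\<in>UNIV. \<Sum>b\<in>UNIV. t a * ?s b * (- (?P a * ?X b) + - (1/2 * jxp p) * delta b a
           + 9 * (\<Sum>c\<in>UNIV. polar C ?X (\<lambda>b. delta a b) c * polar D ?P (\<lambda>d. delta b d) c)))"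
      unfolding body ..
    also have "\<dots> = (\<Sum>a\<in>UNIV. \<Sum>b\<in>UNIV. t a * ?s b * (- (?P a * ?X b))) + - (1/2 * jxp p) * (\<Sum>a\<in>UNIV. \<Sum>b\<in>UNIV. t a * ?s b * delta b a)
       + 9 * (\<Sum>a\<in>UNIV. \<Sum>b\<in>UNIV. t a * ?s b * (\<Sum>c\<in>UNIV. polar C ?X (\<lambda>b. delta a b) c * polar D ?P (\<lambda>d. delta b d) c))"
      unfolding sum2_lin ..
    also have "(\<Sum>a\<in>UNIV. \<Sum>b\<in>UNIV. t a * ?s b * (- (?P a * ?X b))) = - (dot t ?P * dot ?X ?s)"
      by (simp add: dot_def sum_product sum_negf mult_ac)
    also have "(\<Sum>a\<in>UNIV. \<Sum>b\<in>UNIV. t a * ?s b * delta b a) = cubic C t"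
      by (simp add: cubic_dot dot_def)
    also have "(\<Sum>a\<in>UNIV. \<Sum>b\<in>UNIV. t a * ?s b * (\<Sum>c\<in>UNIV. polar C ?X (\<lambda>b. delta a b) c * polar D ?P (\<lambda>d. delta b d) c))
       = (\<Sum>c\<in>UNIV. \<Sum>a\<in>UNIV. \<Sum>b\<in>UNIV. t a * ?s b * (polar C ?X (\<lambda>b. delta a b) c * polar D ?P (\<lambda>d. delta b d) c))"
      unfolding sum_distrib_left by (rule sum_swap3)
    also have "\<dots> = (\<Sum>c\<in>UNIV. polar C ?X t c * polar D ?P ?s c)"
    proof (rule sum.cong[OF refl])
      fix c
      have "polar C ?X t c * polar D ?P ?s c
          = (\<Sum>a\<in>UNIV. t a * polar C ?X (\<lambda>b. delta a b) c) * (\<Sum>b\<in>UNIV. ?s b * polar D ?P (\<lambda>d. delta b d) c)"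
        by (rule arg_cong2[where f="(*)", OF polar_expand[symmetric]])
      then show "(\<Sum>a\<in>UNIV. \<Sum>b\<in>UNIV. t a * ?s b * (polar C ?X (\<lambda>b. delta a b) c * polar D ?P (\<lambda>d. delta b d) c))
          = polar C ?X t c * polar D ?P ?s c"
        by (simp add: sum_product mult_ac)
    qed
    also have "\<dots> = dot ?P (polar D (polar C ?X t) ?s)"
    proof -
      have "trilin D (polar C ?X t) ?P ?s = trilin D ?P (polar C ?X t) ?s" by (rule trilin_commute[OF D])
      then show ?thesis unfolding dot_polar_trilin[symmetric] by (simp add: dot_def)
    qed
    also have "\<dots> = 1/9 * dot ?X ?s * dot ?P t + 1/27 * cubic C t * dot ?P ?X"
      unfolding dot_def[of ?P] dual_cubic_star[OF C dual]
      by (simp add: algebra_simps sum.distrib sum_distrib_left)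
    finally have "3 * (\<Sum>a\<in>UNIV. \<Sum>b\<in>UNIV. t a * ?s b * (d_dx (Some a) (d_dp (Some b) (topgen C D)) p + 1/2 * delta b a * d_du (topgen C D) p))
       = (- (3/2) * jxp p + dot ?P ?X) * cubic C t"
      by (simp add: dot_commute[of t] algebra_simps)
    also have "dot ?P ?X = jxp p - cx p None * cp p None"
      by (simp add: sum_option dot_def mult.commute)
    also have "- (3/2) * jxp p + (jxp p - cx p None * cp p None)
        = d_dx None (d_dp None (topgen C D)) p + 1/2 * d_du (topgen C D) p"
      unfolding topgen_x0p0 topgen_du by (simp add: field_simps)
    finally show "3 * (\<Sum>a\<in>UNIV. \<Sum>b\<in>UNIV. t a * ?s b * (d_dx (Some a) (d_dp (Some b) (topgen C D)) p + 1/2 * delta b a * d_du (topgen C D) p))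
       = (d_dx None (d_dp None (topgen C D)) p + 1/2 * d_du (topgen C D) p) * cubic C t"
      .
  qed
  show ?thesis
    unfolding structure_eqs_def
    using sim topgen_x0x0 topgen_x0xa topgen_xx topgen_p0p0 topgen_p0pa topgen_pp by blast
qed

end

section \<open>The algebra of symmetries\<close>

locale dual_cubics =
  fixes C D :: "'m::finite tensor3"
  assumes C: "symmetric3 C" and dual: "dual_cubic C D" and nonzero: "\<exists>a b c. C a b c \<noteq> 0"
begin

lemma D: "symmetric3 D"
  using dual unfolding dual_cubic_def by blast

abbreviation "S \<equiv> symmetry_algebra C"

lemma symmetry_iff:
  "f \<in> S \<longleftrightarrow> holomorphic_fn f \<and> structure_eqs C D f"
  "f \<in> S \<longleftrightarrow> holomorphic_fn f \<and> (\<forall>t p. along (cone_dir C 1 t) (along (cone_dir C 1 t) f) p = 0)"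
proof -
  obtain a b c where nz: "C a b c \<noteq> 0" using nonzero by blast
  have 1: "f \<in> S \<Longrightarrow> holomorphic_fn f \<and> (\<forall>t p. along (cone_dir C 1 t) (along (cone_dir C 1 t) f) p = 0)"
    unfolding symmetry_algebra_def using symmetry_imp_square[OF C] by blast
  have 2: "holomorphic_fn f \<and> (\<forall>t p. along (cone_dir C 1 t) (along (cone_dir C 1 t) f) p = 0) \<Longrightarrow> structure_eqs C D f"
    using square_imp_structure_eqs[OF C D dual nz] by blast
  have 3: "holomorphic_fn f \<and> structure_eqs C D f \<Longrightarrow> f \<in> S"
    unfolding symmetry_algebra_def
    using square_imp_symmetry[OF C dual] structure_eqs_imp_square[OF C D dual] by blast
  show "f \<in> S \<longleftrightarrow> holomorphic_fn f \<and> structure_eqs C D f"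
    "f \<in> S \<longleftrightarrow> holomorphic_fn f \<and> (\<forall>t p. along (cone_dir C 1 t) (along (cone_dir C 1 t) f) p = 0)"
    using 1 2 3 by blast+
qed

lemma S_holo: "f \<in> S \<Longrightarrow> holomorphic_fn f"
  unfolding symmetry_iff(1) by blast

lemma S_add: "f \<in> S \<Longrightarrow> g \<in> S \<Longrightarrow> (\<lambda>p. f p + g p) \<in> S"
proof -
  assume "f \<in> S" "g \<in> S"
  note * = this[unfolded symmetry_iff(2)]
  have "along c (\<lambda>p. f p + g p) = (\<lambda>p. along c f p + along c g p)" for c
    by (intro ext) (simp add: diff_rules *)
  then show ?thesis using * unfolding symmetry_iff(2) by (simp add: diff_rules holo)
qed

lemma S_scale: "f \<in> S \<Longrightarrow> (\<lambda>p. k * f p) \<in> S"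
proof -
  assume "f \<in> S"
  note * = this[unfolded symmetry_iff(2)]
  have "along c (\<lambda>p. k * f p) = (\<lambda>p. k * along c f p)" for c
    by (intro ext) (simp add: diff_rules *)
  then show ?thesis using * unfolding symmetry_iff(2) by (simp add: diff_rules holo)
qed

lemma S_coord: "(\<lambda>p. k) \<in> S" "(\<lambda>p. cx p i) \<in> S" "(\<lambda>p. cp p i) \<in> S"
proof -
  have "along c (\<lambda>p. k) = (\<lambda>p. 0)" "along c (\<lambda>p. cx p i) = (\<lambda>p. c $ Inl i)" "along c (\<lambda>p. cp p i) = (\<lambda>p. c $ Inr i)" for c
    by (intro ext, simp add: along_def diff_rules)+
  then show "(\<lambda>p. k) \<in> S" "(\<lambda>p. cx p i) \<in> S" "(\<lambda>p. cp p i) \<in> S"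
    unfolding symmetry_iff(2) by (simp_all add: diff_rules holo)
qed

lemma S_zero: "(\<lambda>p. 0) \<in> S" by (rule S_coord)

lemma S_diff: "f \<in> S \<Longrightarrow> g \<in> S \<Longrightarrow> (\<lambda>p. f p - g p) \<in> S"
  using S_add[OF _ S_scale[of g "-1"], of f] by simp

lemma holo_lagrange [holo]:
  "holomorphic_fn f \<Longrightarrow> holomorphic_fn g \<Longrightarrow> holomorphic_fn (lagrange f g)"
  unfolding lagrange_def[abs_def] by (intro holo)

lemma S_lagrange: "f \<in> S \<Longrightarrow> g \<in> S \<Longrightarrow> lagrange f g \<in> S"
  using square_lagrange[OF C, of f g] unfolding symmetry_iff(2) by (blast intro: holo_lagrange)

lemma S_topgen: "topgen C D \<in> S"
  unfolding symmetry_iff(1) using topgen_structure_eqs[OF C D dual] holo_topgen by blast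

lemma lagrange_one: "lagrange (\<lambda>p. 1) f = d_du f"
  by (intro ext) (simp add: lagrange_def diff_rules)

lemma S_du: "f \<in> S \<Longrightarrow> d_du f \<in> S"
  using S_lagrange[OF S_coord(1)[of 1]] unfolding lagrange_one .

section \<open>Prolongation\<close>

lemma
  assumes "f \<in> S"
  shows x0x0: "d_dx None (d_dx None f) = (\<lambda>p. 0)"
    and x0xa: "d_dx None (d_dx (Some a) f) = (\<lambda>p. 0)" "d_dx (Some a) (d_dx None f) = (\<lambda>p. 0)"
    and xaxb: "d_dx (Some a) (d_dx (Some b) f) = (\<lambda>p. 3 * (\<Sum>c\<in>UNIV. C a b c * d_dx None (d_dp (Some c) f) p))"
    and p0p0: "d_dp None (d_dp None f) = (\<lambda>p. 0)"
    and p0pa: "d_dp None (d_dp (Some a) f) = (\<lambda>p. 0)" "d_dp (Some a) (d_dp None f) = (\<lambda>p. 0)"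
    and papb: "d_dp (Some a) (d_dp (Some b) f) = (\<lambda>p. - 3 * (\<Sum>c\<in>UNIV. D a b c * d_dx (Some c) (d_dp None f) p))"
    and simil: "similarity C (\<lambda>b a. d_dx (Some a) (d_dp (Some b) f) p + 1/2 * delta b a * d_du f p)
            (d_dx None (d_dp None f) p + 1/2 * d_du f p)"
  using assms dx_commute[of f "Some a" None] dp_commute[of f "Some a" None]
  unfolding symmetry_iff(1) structure_eqs_def by auto

lemma dp_dx:
  assumes "holomorphic_fn g"
  shows "d_dp None (d_dx (Some a) g) = d_dx (Some a) (d_dp None g)"
    "d_dp (Some a) (d_dx None g) = d_dx None (d_dp (Some a) g)"
    "d_dp None (d_dx None g) = (\<lambda>p. d_dx None (d_dp None g) p + d_du g p)"
    "d_dp (Some a) (d_dx (Some b) g) = (\<lambda>p. d_dx (Some b) (d_dp (Some a) g) p + delta a b * d_du g p)"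
  using dp_dx_commute[OF assms] by auto

lemma zero_op: "d_dx i (\<lambda>p. 0) = (\<lambda>p. 0)" "d_dp i (\<lambda>p. 0) = (\<lambda>p. 0)" "d_du (\<lambda>p. 0) = (\<lambda>p. 0)"
  by (intro ext, simp add: diff_rules)+

text \<open>Applying \<open>U\<^sup>i\<close> or \<open>X\<^sub>i\<close> to the structure equations and commuting derivatives expresses all
  first derivatives of the free components \<open>y\<^sup>b = X\<^sub>0 U\<^sup>b f\<close>, \<open>Y\<^sub>b = X\<^sub>b U\<^sup>0 f\<close> through first
  derivatives of \<open>f\<^sub>u\<close>.\<close>

lemma y_derivs:
  assumes f: "f \<in> S"
  defines "e \<equiv> d_du f" and "y \<equiv> \<lambda>b. d_dx None (d_dp (Some b) f)"
  shows "d_dx None (y b) = (\<lambda>p. 0)"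
    "d_dx (Some a) (y b) = (\<lambda>p. - delta a b * d_dx None e p)"
    "d_dp None (y b) = d_dp (Some b) e"
    "d_dp (Some a) (y b) = (\<lambda>p. 3 * (\<Sum>c\<in>UNIV. D a b c * d_dx (Some c) e p))"
    "d_dx None (d_dx (Some c) (d_dp None f)) = (\<lambda>p. - d_dx (Some c) e p)"
proof -
  note h = S_holo[OF f]
  note hh = h holo_op[OF h]
  have "d_dx None (y b) = d_dp (Some b) (d_dx None (d_dx None f))"
    unfolding y_def dp_dx(2)[OF h] dp_dx(2)[OF holo_op(1)[OF h]] ..
  then show "d_dx None (y b) = (\<lambda>p. 0)" unfolding x0x0[OF f] zero_op .
  have "d_dp (Some b) (d_dx (Some a) (d_dx None f)) = (\<lambda>p. d_dx (Some a) (y b) p + delta b a * d_du (d_dx None f) p)"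
    unfolding dp_dx(4)[OF holo_op(1)[OF h]] dp_dx(2)[OF h] y_def ..
  then have "(\<lambda>p. d_dx (Some a) (y b) p + delta b a * d_dx None e p) = (\<lambda>p. 0)"
    unfolding x0xa(2)[OF f] zero_op du_commute(1)[OF h] e_def by simp
  then show "d_dx (Some a) (y b) = (\<lambda>p. - delta a b * d_dx None e p)"
    by (cases "a = b") (simp_all add: fun_eq_iff delta_def add_eq_0_iff2)
  have "d_dp None (y b) = (\<lambda>p. d_dx None (d_dp None (d_dp (Some b) f)) p + d_du (d_dp (Some b) f) p)"
    unfolding y_def dp_dx(3)[OF holo_op(2)[OF h]] ..
  then show "d_dp None (y b) = d_dp (Some b) e"
    unfolding p0pa(1)[OF f] zero_op du_commute(2)[OF h] e_def by simp
  have "d_dp None (d_dx None (d_dx (Some c) f)) = (\<lambda>p. d_dx None (d_dp None (d_dx (Some c) f)) p + d_du (d_dx (Some c) f) p)" for c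
    by (rule dp_dx(3)[OF holo_op(1)[OF h]])
  then have "(\<lambda>p. d_dx None (d_dx (Some c) (d_dp None f)) p + d_dx (Some c) e p) = (\<lambda>p. 0)" for c
    unfolding x0xa(1)[OF f] zero_op dp_dx(1)[OF h] du_commute(1)[OF h] e_def by simp
  then show Y: "d_dx None (d_dx (Some c) (d_dp None f)) = (\<lambda>p. - d_dx (Some c) e p)" for c
    by (simp add: fun_eq_iff add_eq_0_iff2)
  have "d_dp (Some a) (y b) = d_dx None (d_dp (Some a) (d_dp (Some b) f))"
    unfolding y_def by (rule dp_dx(2)[OF holo_op(2)[OF h]])
  also have "\<dots> = (\<lambda>p. - 3 * (\<Sum>c\<in>UNIV. D a b c * d_dx None (d_dx (Some c) (d_dp None f)) p))"
    unfolding papb[OF f] by (intro ext) (simp add: diff_rules holo hh)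
  finally show "d_dp (Some a) (y b) = (\<lambda>p. 3 * (\<Sum>c\<in>UNIV. D a b c * d_dx (Some c) e p))"
    unfolding Y by (simp add: sum_negf)
qed

lemma Y_derivs:
  assumes f: "f \<in> S"
  defines "e \<equiv> d_du f" and "Y \<equiv> \<lambda>b. d_dx (Some b) (d_dp None f)"
  shows "d_dx None (Y b) = (\<lambda>p. - d_dx (Some b) e p)"
    "d_dx (Some a) (Y b) = (\<lambda>p. 3 * (\<Sum>c\<in>UNIV. C a b c * d_dp (Some c) e p))"
    "d_dp None (Y b) = (\<lambda>p. 0)"
    "d_dp (Some a) (Y b) = (\<lambda>p. delta a b * d_dp None e p)"
proof -
  note h = S_holo[OF f]
  note hh = h holo_op[OF h]
  show "d_dx None (Y b) = (\<lambda>p. - d_dx (Some b) e p)"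
    unfolding Y_def e_def by (rule y_derivs(5)[OF f])
  have "d_dx (Some a) (Y b) = d_dp None (d_dx (Some a) (d_dx (Some b) f))"
    unfolding Y_def dp_dx(1)[OF h, symmetric] by (rule dp_dx(1)[OF holo_op(1)[OF h], symmetric])
  also have "\<dots> = (\<lambda>p. 3 * (\<Sum>c\<in>UNIV. C a b c * d_dp None (d_dx None (d_dp (Some c) f)) p))"
    unfolding xaxb[OF f] by (intro ext) (simp add: diff_rules holo hh)
  finally show "d_dx (Some a) (Y b) = (\<lambda>p. 3 * (\<Sum>c\<in>UNIV. C a b c * d_dp (Some c) e p))"
    unfolding y_derivs(3)[OF f] e_def .
  have "d_dp None (Y b) = d_dx (Some b) (d_dp None (d_dp None f))"
    unfolding Y_def by (rule dp_dx(1)[OF holo_op(2)[OF h]])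
  then show "d_dp None (Y b) = (\<lambda>p. 0)" unfolding p0p0[OF f] zero_op .
  have "d_dp (Some a) (Y b) = (\<lambda>p. d_dx (Some b) (d_dp (Some a) (d_dp None f)) p + delta a b * d_du (d_dp None f) p)"
    unfolding Y_def by (rule dp_dx(4)[OF holo_op(2)[OF h]])
  then show "d_dp (Some a) (Y b) = (\<lambda>p. delta a b * d_dp None e p)"
    unfolding p0pa(2)[OF f] zero_op du_commute(2)[OF h] e_def by simp
qed

text \<open>Since \<open>f\<^sub>u = [1, f]\<close> is again a symmetry, it satisfies the structure equations. Commuting
  the derivatives of \<open>y\<^sup>b\<close> and \<open>Y\<^sub>b\<close> once more gives \<open>X\<^sub>0 U\<^sup>b f\<^sub>u = X\<^sub>b U\<^sup>0 f\<^sub>u = 0\<close> and shows that the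
  similarity belonging to \<open>f\<^sub>u\<close> is \<open>-\<epsilon>\<close> times the identity, where \<open>\<epsilon>\<close> is its factor. The identity
  has factor 3, so \<open>\<epsilon> = -3 \<epsilon>\<close> and \<open>\<epsilon> = 0\<close>.\<close>

theorem du_hessian:
  assumes f: "f \<in> S"
  defines "e \<equiv> d_du f"
  shows "d_dx i (d_dx j e) = (\<lambda>p. 0)" "d_dp i (d_dp j e) = (\<lambda>p. 0)"
    "d_dx i (d_dp j e) = (\<lambda>p. - 1/2 * delta i j * d_du e p)"
proof -
  note h = S_holo[OF f]
  have e: "e \<in> S" unfolding e_def by (rule S_du[OF f])
  note he = S_holo[OF e]
  let ?y = "\<lambda>b. d_dx None (d_dp (Some b) f)" and ?Y = "\<lambda>b. d_dx (Some b) (d_dp None f)"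
  have hy: "holomorphic_fn (?y b)" "holomorphic_fn (?Y b)" for b by (intro holo h)+
  have uy: "d_du (?y b) = d_dx None (d_dp (Some b) e)" "d_du (?Y b) = d_dx (Some b) (d_dp None e)" for b
    unfolding e_def du_commute(1)[OF holo_op(2)[OF h]] du_commute(2)[OF h] by (rule refl)+
  have A: "d_dx None (d_dp (Some b) e) = (\<lambda>p. 0)" for b
  proof -
    have "d_dp None (d_dx None (?y b)) = (\<lambda>p. d_dx None (d_dp None (?y b)) p + d_du (?y b) p)"
      by (rule dp_dx(3)[OF hy(1)])
    then have "(\<lambda>p. d_dx None (d_dp (Some b) e) p + d_dx None (d_dp (Some b) e) p) = (\<lambda>p. 0)"
      unfolding y_derivs(1)[OF f] zero_op y_derivs(3)[OF f] uy e_def[symmetric] by simp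
    then show ?thesis by (simp add: fun_eq_iff)
  qed
  have A': "d_dx (Some b) (d_dp None e) = (\<lambda>p. 0)" for b
  proof -
    have "d_dp None (d_dx None (?Y b)) = (\<lambda>p. d_dx None (d_dp None (?Y b)) p + d_du (?Y b) p)"
      by (rule dp_dx(3)[OF hy(2)])
    moreover have "d_dp None (\<lambda>p. - d_dx (Some b) e p) = (\<lambda>p. - d_dx (Some b) (d_dp None e) p)"
      using dp_dx(1)[OF he, of b] by (intro ext) (simp add: diff_rules holo he)
    ultimately have "(\<lambda>p. - d_dx (Some b) (d_dp None e) p) = (\<lambda>p. d_dx (Some b) (d_dp None e) p)"
      unfolding Y_derivs(1)[OF f] Y_derivs(3)[OF f] zero_op uy e_def[symmetric] by simp
    then show ?thesis by (simp add: fun_eq_iff)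
  qed
  define E0 where "E0 p = d_dx None (d_dp None e) p + 1/2 * d_du e p" for p
  \<comment> \<open>the similarity of \<open>f\<^sub>u\<close> is a multiple of the identity\<close>
  have B: "d_dx (Some a) (d_dp (Some b) e) p + 1/2 * delta b a * d_du e p = - E0 p * delta b a" for a b p
  proof -
    have "d_dp None (d_dx (Some a) (?y b)) p = d_dx (Some a) (d_dp (Some b) e) p"
      unfolding dp_dx(1)[OF hy(1)] y_derivs(3)[OF f] e_def ..
    moreover have "d_dp None (d_dx (Some a) (?y b)) p = - delta a b * (d_dx None (d_dp None e) p + d_du e p)"
      unfolding y_derivs(2)[OF f] e_def[symmetric] using dp_dx(3)[OF he] by (simp add: diff_rules holo he)
    ultimately have "d_dx (Some a) (d_dp (Some b) e) p = - delta a b * (d_dx None (d_dp None e) p + d_du e p)"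
      by (simp only:)
    then have "d_dx (Some a) (d_dp (Some b) e) p = - delta b a * (d_dx None (d_dp None e) p + d_du e p)"
      unfolding delta_def[of a b] delta_def[of b a] by (simp only: eq_commute[of a b])
    then show ?thesis by (simp only: E0_def) (simp add: algebra_simps)
  qed
  have E0: "E0 p = 0" for p
  proof -
    obtain a b c where nz: "C a b c \<noteq> 0" using nonzero by blast
    have "similarity C (\<lambda>b a. - E0 p * delta b a) (E0 p)"
      using simil[OF e, of p] unfolding B E0_def[symmetric] .
    moreover have "similarity C (\<lambda>b a. - E0 p * delta b a) (- E0 p * 3)"
      using similarity_lin[OF similarity_delta similarity_delta, of C "- E0 p" 0] by simp
    ultimately have "E0 p * C a b c = - E0 p * 3 * C a b c"
      unfolding similarity_def by (metis (no_types, lifting))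
    then have "4 * (E0 p * C a b c) = 0" by (simp add: algebra_simps add_eq_0_iff)
    then show ?thesis using nz by simp
  qed
  show "d_dx i (d_dp j e) = (\<lambda>p. - 1/2 * delta i j * d_du e p)" for i j
  proof (intro ext)
    fix p
    show "d_dx i (d_dp j e) p = - 1/2 * delta i j * d_du e p"
    proof (cases i; cases j)
      assume "i = None" "j = None"
      then show ?thesis using E0[of p] unfolding E0_def by (simp add: add_eq_0_iff2)
    next
      fix a b assume "i = Some a" "j = Some b"
      then show ?thesis using B[of a b p] E0[of p] by (simp add: add_eq_0_iff2 delta_def)
    qed (simp_all add: A A')
  qed
  show "d_dx i (d_dx j e) = (\<lambda>p. 0)"
    using x0x0[OF e] x0xa[OF e] xaxb[OF e] A by (cases i; cases j) simp_all
  show "d_dp i (d_dp j e) = (\<lambda>p. 0)"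
    using p0p0[OF e] p0pa[OF e] papb[OF e] A' by (cases i; cases j) simp_all
qed

lemma other_index: obtains j :: "'m option" where "j \<noteq> i"
  by (cases i) (auto intro: that)

text \<open>By \<open>du_hessian\<close>, \<open>X\<^sub>j U\<^sup>j f\<^sub>u\<close> is a multiple of \<open>f\<^sub>u\<^sub>u\<close> for each \<open>j\<close>, while \<open>X\<^sub>k U\<^sup>j f\<^sub>u = 0\<close> for
  \<open>j \<noteq> k\<close>. Commuting \<open>X\<^sub>k\<close> with \<open>X\<^sub>j\<close> for \<open>j \<noteq> k\<close> annihilates \<open>X\<^sub>k f\<^sub>u\<^sub>u\<close>; there is such a \<open>j\<close> as
  \<open>n \<ge> 2\<close>.\<close>

theorem du_du_constant:
  assumes f: "f \<in> S"
  shows "d_du (d_du f) = (\<lambda>p. d_du (d_du f) 0)"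
proof (rule op_zero_imp_const)
  define e where "e = d_du f"
  have he: "holomorphic_fn e" unfolding e_def by (intro holo S_holo[OF f])
  show "holomorphic_fn (d_du (d_du f))" by (intro holo S_holo[OF f])
  note hess = du_hessian[OF f, folded e_def]
  show "d_dx k (d_du (d_du f)) = (\<lambda>p. 0)" for k
  proof -
    obtain j where j: "j \<noteq> k" using other_index .
    have "d_dx k (d_dx j (d_dp j e)) = d_dx j (d_dx k (d_dp j e))"
      by (rule dx_commute) (intro holo he)
    moreover have "d_dx k (d_dx j (d_dp j e)) = (\<lambda>p. - 1/2 * d_dx k (d_du e) p)"
      unfolding hess(3) by (intro ext) (simp add: diff_rules holo he)
    moreover have "d_dx j (d_dx k (d_dp j e)) = (\<lambda>p. 0)"
      unfolding hess(3) using j by (intro ext) (simp add: diff_rules holo he delta_def)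
    ultimately show ?thesis by (simp add: fun_eq_iff e_def)
  qed
  show "d_dp k (d_du (d_du f)) = (\<lambda>p. 0)" for k
  proof -
    obtain j where j: "j \<noteq> k" using other_index .
    have px: "d_dp i (d_dx l e) = (\<lambda>p. 1/2 * delta i l * d_du e p)" for i l
      unfolding dp_dx_commute[OF he] hess(3) by (intro ext) (simp add: delta_def)
    have "d_dp k (d_dp j (d_dx j e)) = d_dp j (d_dp k (d_dx j e))"
      by (rule dp_commute) (intro holo he)
    moreover have "d_dp k (d_dp j (d_dx j e)) = (\<lambda>p. 1/2 * d_dp k (d_du e) p)"
      unfolding px by (intro ext) (simp add: diff_rules holo he)
    moreover have "d_dp j (d_dp k (d_dx j e)) = (\<lambda>p. 0)"
      unfolding px using j by (intro ext) (simp add: diff_rules holo he delta_def)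
    ultimately show ?thesis by (simp add: fun_eq_iff e_def)
  qed
qed

section \<open>Generation and grading\<close>

text \<open>The functions \<open>[[T, x\<^sup>j], u\<^sub>i]\<close> of degree zero. As brackets with coordinates commute with
  the derivatives along the frame, their second derivatives follow from those of the top
  generator.\<close>

definition quad_gen :: "'m option \<Rightarrow> 'm option \<Rightarrow> 'm jet \<Rightarrow> complex" where
  "quad_gen i j = lagrange (lagrange (topgen C D) (\<lambda>p. cx p j)) (\<lambda>p. cp p i)"

abbreviation "T \<equiv> topgen C D"

definition "gens = range (\<lambda>i p. cx p i) \<union> range (\<lambda>i p. cp p i) \<union> {T}"

lemma lagrange_cp: "lagrange f (\<lambda>p. cp p i) = (\<lambda>p. d_dx i f p - cp p i * d_du f p)"
  by (intro ext) (simp add: lagrange_def diff_rules)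

lemma lagrange_cx: "lagrange f (\<lambda>p. cx p i) = (\<lambda>p. - (cx p i * d_du f p) - d_dp i f p)"
  by (intro ext) (simp add: lagrange_def diff_rules sum_negf)

lemma lagrange_cp_op:
  assumes f: "holomorphic_fn f"
  shows "d_dx j (lagrange f (\<lambda>p. cp p i)) = lagrange (d_dx j f) (\<lambda>p. cp p i)"
    "d_dp j (lagrange f (\<lambda>p. cp p i)) = lagrange (d_dp j f) (\<lambda>p. cp p i)"
    "d_du (lagrange f (\<lambda>p. cp p i)) = lagrange (d_du f) (\<lambda>p. cp p i)"
  unfolding lagrange_cp du_commute[OF f] dp_commute[OF f]
  by (intro ext, simp add: diff_rules holo f dx_commute[OF f, of j] du_commute[OF f] dp_dx_commute[OF f])+

lemma lagrange_cx_op: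
  assumes f: "holomorphic_fn f"
  shows "d_dx j (lagrange f (\<lambda>p. cx p i)) = lagrange (d_dx j f) (\<lambda>p. cx p i)"
    "d_dp j (lagrange f (\<lambda>p. cx p i)) = lagrange (d_dp j f) (\<lambda>p. cx p i)"
    "d_du (lagrange f (\<lambda>p. cx p i)) = lagrange (d_du f) (\<lambda>p. cx p i)"
  unfolding lagrange_cx
  by (intro ext, simp add: diff_rules holo f dp_commute[OF f, of j] du_commute[OF f] dp_dx_commute[OF f] delta_def)+

lemma grading_element_eq: "grading_element = (\<lambda>p. 2 * cu p - jxp p)"
  by (intro ext) (simp add: grading_element_def)

lemma topgen_du': "d_du T = grading_element"
  unfolding topgen_du[OF C D] grading_element_eq ..

lemma holo_grading [holo]: "holomorphic_fn grading_element"
  unfolding grading_element_eq by (intro holo)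

lemma grading_op:
  "d_du grading_element = (\<lambda>p. 2)" "d_dx i grading_element = (\<lambda>p. cp p i)" "d_dp i grading_element = (\<lambda>p. - cx p i)"
  unfolding grading_element_eq by (intro ext, simp add: diff_rules holo)+

lemma S_grading: "grading_element \<in> S"
  unfolding topgen_du'[symmetric] by (rule S_du[OF S_topgen])

lemma lie_lin:
  "f \<in> lie_generated G \<Longrightarrow> g \<in> lie_generated G \<Longrightarrow> (\<lambda>p. f p + g p) \<in> lie_generated G"
  "f \<in> lie_generated G \<Longrightarrow> (\<lambda>p. k * f p) \<in> lie_generated G"
  "f \<in> lie_generated G \<Longrightarrow> g \<in> lie_generated G \<Longrightarrow> (\<lambda>p. f p - g p) \<in> lie_generated G"
proof -
  show 1: "(\<lambda>p. f p + g p) \<in> lie_generated G" if "f \<in> lie_generated G" "g \<in> lie_generated G" for f g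
    using lie_generated.add[OF that] by (simp add: plus_fun_def)
  show 2: "(\<lambda>p. k * f p) \<in> lie_generated G" if "f \<in> lie_generated G" for f k
    by (rule lie_generated.scale[OF that])
  show "(\<lambda>p. f p - g p) \<in> lie_generated G" if "f \<in> lie_generated G" "g \<in> lie_generated G"
    using 1[OF that(1) 2[OF that(2), of "-1"]] by simp
qed

lemma gens_generated: "(\<lambda>p. cx p i) \<in> lie_generated gens" "(\<lambda>p. cp p i) \<in> lie_generated gens" "T \<in> lie_generated gens"
  unfolding gens_def by (rule lie_generated.gen, blast)+

lemma const_generated: "(\<lambda>p. k) \<in> lie_generated gens"
proof -
  have "lagrange (\<lambda>p. cx p None) (\<lambda>p. cp p None) = (\<lambda>p::'m jet. 1)"
    unfolding lagrange_cp by (intro ext) (simp add: diff_rules)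
  then have "(\<lambda>p::'m jet. 1) \<in> lie_generated gens"
    using lie_generated.bracket[OF gens_generated(1)[of None] gens_generated(2)[of None]] by (simp only:)
  from lie_lin(2)[OF this, of k] show ?thesis by simp
qed

lemma sum_generated:
  "(\<And>i. i \<in> A \<Longrightarrow> F i \<in> lie_generated gens) \<Longrightarrow> (\<lambda>p. \<Sum>i\<in>A. F i p) \<in> lie_generated gens"
  by (induction A rule: infinite_finite_induct) (auto intro: lie_lin const_generated)

lemma grading_generated: "grading_element \<in> lie_generated gens"
  using lie_generated.bracket[OF const_generated[of 1] gens_generated(3)] unfolding lagrange_one topgen_du' .

lemma quad_gen_generated: "quad_gen i j \<in> lie_generated gens"
  unfolding quad_gen_def by (intro lie_generated.bracket gens_generated)

lemma generated_imp_S: "f \<in> lie_generated gens \<Longrightarrow> f \<in> S"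
proof (induction rule: lie_generated.induct)
  case (gen f) then show ?case using S_coord S_topgen unfolding gens_def by auto
next
  case (add f g) then show ?case using S_add[of f g] by (simp add: plus_fun_def)
qed (auto intro: S_scale S_lagrange)

lemma quad_gen_op:
  "d_du (quad_gen i j) = (\<lambda>p. - delta i j)"
  "d_dx k (d_dp l (quad_gen i j)) = lagrange (lagrange (d_dx k (d_dp l T)) (\<lambda>p. cx p j)) (\<lambda>p. cp p i)"
proof -
  have hT: "holomorphic_fn T" by (rule holo_topgen)
  have hl: "holomorphic_fn (lagrange g (\<lambda>p. cx p j))" if "holomorphic_fn g" for g by (intro holo that)
  show "d_dx k (d_dp l (quad_gen i j)) = lagrange (lagrange (d_dx k (d_dp l T)) (\<lambda>p. cx p j)) (\<lambda>p. cp p i)"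
    unfolding quad_gen_def lagrange_cp_op(2)[OF hl[OF hT]] lagrange_cx_op(2)[OF hT]
      lagrange_cp_op(1)[OF hl[OF holo_op(2)[OF hT]]] lagrange_cx_op(1)[OF holo_op(2)[OF hT]] ..
  have "d_du (quad_gen i j) = lagrange (lagrange grading_element (\<lambda>p. cx p j)) (\<lambda>p. cp p i)"
    unfolding quad_gen_def lagrange_cp_op(3)[OF hl[OF hT]] lagrange_cx_op(3)[OF hT] topgen_du' ..
  also have "\<dots> = (\<lambda>p. - delta i j)"
    unfolding lagrange_cx lagrange_cp grading_op by (intro ext) (simp add: diff_rules holo delta_def)
  finally show "d_du (quad_gen i j) = (\<lambda>p. - delta i j)" .
qed

lemma quad_gen_y:
  "d_dx None (d_dp (Some b) (quad_gen (Some a) None)) = (\<lambda>p. delta a b)"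
  "d_dx None (d_dp (Some b) (quad_gen None (Some a))) = (\<lambda>p. 0)"
  "d_dx None (d_dp (Some b) (quad_gen (Some c) (Some d))) = (\<lambda>p. 0)"
  unfolding quad_gen_op topgen_x0p[OF C D] lagrange_cx lagrange_cp
  by (intro ext, simp add: diff_rules holo polar_lin)+

lemma quad_gen_Y:
  "d_dx (Some b) (d_dp None (quad_gen (Some a) None)) = (\<lambda>p. 0)"
  "d_dx (Some b) (d_dp None (quad_gen None (Some a))) = (\<lambda>p. delta a b)"
  "d_dx (Some b) (d_dp None (quad_gen (Some c) (Some d))) = (\<lambda>p. 0)"
  unfolding quad_gen_op topgen_xp0[OF C D] lagrange_cx lagrange_cp
  by (intro ext, simp add: diff_rules holo polar_lin)+

lemma quad_gen_E:
  "d_dx (Some a) (d_dp (Some b) (quad_gen (Some c) None)) = (\<lambda>p. 0)"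
  "d_dx (Some a) (d_dp (Some b) (quad_gen None (Some d))) = (\<lambda>p. 0)"
  "d_dx (Some a) (d_dp (Some b) (quad_gen (Some c) (Some d)))
    = (\<lambda>p. delta c d * delta b a + delta d a * delta c b - 9 * (\<Sum>e\<in>UNIV. C e c a * D e d b))"
proof -
  have k: "polar C (\<lambda>b. delta a b) (\<lambda>b. delta c b) e = C e a c" "polar D (\<lambda>b. delta a b) (\<lambda>b. delta c b) e = D e a c" for a c e
    by (simp_all add: polar_def mult.assoc)
  show "d_dx (Some a) (d_dp (Some b) (quad_gen (Some c) None)) = (\<lambda>p. 0)"
    "d_dx (Some a) (d_dp (Some b) (quad_gen None (Some d))) = (\<lambda>p. 0)"
    "d_dx (Some a) (d_dp (Some b) (quad_gen (Some c) (Some d)))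
      = (\<lambda>p. delta c d * delta b a + delta d a * delta c b - 9 * (\<Sum>e\<in>UNIV. C e c a * D e d b))"
    unfolding quad_gen_op topgen_xp[OF C D] lagrange_cx lagrange_cp
    by (intro ext, simp add: diff_rules holo polar_lin k)+
qed

lemma affine_expansion:
  assumes f: "holomorphic_fn f"
    and 2: "\<And>i j. d_dx i (d_dx j f) = (\<lambda>p. 0)" "\<And>i j. d_dp i (d_dp j f) = (\<lambda>p. 0)"
      "\<And>i j. d_dx i (d_dp j f) = (\<lambda>p. 0)" "\<And>i j. d_dp i (d_dx j f) = (\<lambda>p. 0)"
  shows "f = (\<lambda>p. f 0 + ((\<Sum>i\<in>UNIV. d_dx i f 0 * cx p i) + (\<Sum>i\<in>UNIV. d_dp i f 0 * cp p i)))"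
proof -
  have X: "d_dx j f = (\<lambda>p. d_dx j f 0)" for j
    by (rule op_zero_imp_const) (use 2 in \<open>auto intro: holo f\<close>)
  have U: "d_dp j f = (\<lambda>p. d_dp j f 0)" for j
    by (rule op_zero_imp_const) (use 2 in \<open>auto intro: holo f\<close>)
  define l where "l p = (\<Sum>i\<in>UNIV. d_dx i f 0 * cx p i) + (\<Sum>i\<in>UNIV. d_dp i f 0 * cp p i)" for p
  have hl: "holomorphic_fn l" unfolding l_def[abs_def] by (intro holo)
  have Xl: "d_dx j l p = d_dx j f 0" "d_dp j l p = d_dp j f 0" for j p
    unfolding l_def[abs_def] by (simp_all add: diff_rules holo)
  have const: "(\<lambda>p. f p - l p) = (\<lambda>p. f 0 - l 0)"
  proof (rule op_zero_imp_const)
    show "d_dx i (\<lambda>p. f p - l p) = (\<lambda>p. 0)" for i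
    proof
      fix p show "d_dx i (\<lambda>p. f p - l p) p = 0"
        using fun_cong[OF X, of i p] by (simp add: diff_rules f hl Xl)
    qed
    show "d_dp i (\<lambda>p. f p - l p) = (\<lambda>p. 0)" for i
    proof
      fix p show "d_dp i (\<lambda>p. f p - l p) p = 0"
        using fun_cong[OF U, of i p] by (simp add: diff_rules f hl Xl)
    qed
  qed (intro holo f hl)
  have "l 0 = 0" by (simp add: l_def)
  then have "f p = f 0 + l p" for p
    using fun_cong[OF const, of p] by (simp add: diff_eq_eq)
  then show ?thesis unfolding l_def by blast
qed

text \<open>If \<open>f\<^sub>u\<close> is constant, \<open>y_derivs\<close> and \<open>Y_derivs\<close> make \<open>X\<^sub>0 U\<^sup>b f\<close> and \<open>X\<^sub>b U\<^sup>0 f\<close> constant, and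
  commuting derivatives does the same for \<open>X\<^sub>a U\<^sup>b f\<close>. The remaining \<open>X\<^sub>0 U\<^sup>0 f\<close> is, up to a
  constant, the factor of a constant similarity of a nonzero cubic.\<close>

lemma second_derivatives_constant:
  assumes f: "f \<in> S" and e: "d_du f = (\<lambda>p. k)"
  shows "d_dx i (d_dx j f) = (\<lambda>p. d_dx i (d_dx j f) 0)" "d_dp i (d_dp j f) = (\<lambda>p. d_dp i (d_dp j f) 0)"
    "d_dx i (d_dp j f) = (\<lambda>p. d_dx i (d_dp j f) 0)"
proof -
  note h = S_holo[OF f]
  have de: "d_dx i (d_du f) = (\<lambda>p. 0)" "d_dp i (d_du f) = (\<lambda>p. 0)" for i
    unfolding e by (intro ext, simp add: diff_rules)+
  have dey: "d_du (d_dx i f) = (\<lambda>p. 0)" "d_du (d_dp i f) = (\<lambda>p. 0)" for i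
    unfolding du_commute[OF h] de by (rule refl)+
  let ?y = "\<lambda>b. d_dx None (d_dp (Some b) f)" and ?Y = "\<lambda>b. d_dx (Some b) (d_dp None f)"
  let ?E = "\<lambda>a b. d_dx (Some a) (d_dp (Some b) f)"
  have hy: "holomorphic_fn (?y b)" "holomorphic_fn (?Y b)" "holomorphic_fn (?E a b)" for a b by (intro holo h)+
  have yd: "d_dx i (?y b) = (\<lambda>p. 0)" "d_dp i (?y b) = (\<lambda>p. 0)" for i b
    using y_derivs[OF f] de by (cases i; simp)+
  have Yd: "d_dx i (?Y b) = (\<lambda>p. 0)" "d_dp i (?Y b) = (\<lambda>p. 0)" for i b
    using Y_derivs[OF f] de by (cases i; simp)+
  have y: "?y b = (\<lambda>p. ?y b 0)" for b by (rule op_zero_imp_const[OF hy(1) yd])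
  have Y: "?Y b = (\<lambda>p. ?Y b 0)" for b by (rule op_zero_imp_const[OF hy(2) Yd])
  have E: "?E a b = (\<lambda>p. ?E a b 0)" for a b
  proof (rule op_zero_imp_const[OF hy(3)])
    fix i
    show "d_dx i (?E a b) = (\<lambda>p. 0)"
    proof (cases i)
      case None
      have "d_dx None (?E a b) = d_dx (Some a) (?y b)" by (rule dx_commute) (intro holo h)
      then show ?thesis using None yd by simp
    next
      case (Some c)
      have pe: "d_dp (Some b) (d_dx (Some a) f) = (\<lambda>p. ?E a b p + delta b a * k)"
        unfolding dp_dx(4)[OF h] e ..
      have "d_dp (Some b) (d_dx (Some c) (d_dx (Some a) f)) = d_dx (Some c) (d_dp (Some b) (d_dx (Some a) f))"
        unfolding dp_dx(4)[OF holo_op(1)[OF h]] dey by simp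
      moreover have "d_dp (Some b) (d_dx (Some c) (d_dx (Some a) f)) = (\<lambda>p. 0)"
        unfolding xaxb[OF f] by (intro ext) (simp add: diff_rules holo hy yd)
      moreover have "d_dx (Some c) (d_dp (Some b) (d_dx (Some a) f)) = d_dx (Some c) (?E a b)"
        unfolding pe by (intro ext) (simp add: diff_rules holo hy)
      ultimately show ?thesis using Some by simp
    qed
    show "d_dp i (?E a b) = (\<lambda>p. 0)"
    proof (cases i)
      case None
      have "d_dp None (?E a b) = d_dx (Some a) (d_dp None (d_dp (Some b) f))" by (rule dp_dx(1)) (intro holo h)
      then show ?thesis using None p0pa(1)[OF f] zero_op by simp
    next
      case (Some c)
      have "d_dp (Some c) (?E a b) = d_dx (Some a) (d_dp (Some c) (d_dp (Some b) f))"
        unfolding dp_dx(4)[OF holo_op(2)[OF h]] dey by simp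
      also have "\<dots> = (\<lambda>p. 0)"
        unfolding papb[OF f] by (intro ext) (simp add: diff_rules holo hy Yd)
      finally show ?thesis using Some by simp
    qed
  qed
  have E0: "d_dx None (d_dp None f) = (\<lambda>p. d_dx None (d_dp None f) 0)"
  proof
    fix p
    obtain a b c where nz: "C a b c \<noteq> 0" using nonzero by blast
    let ?B = "\<lambda>b a. ?E a b 0 + 1/2 * delta b a * k"
    have s: "similarity C ?B (d_dx None (d_dp None f) q + 1/2 * k)" for q
      using simil[OF f, of q] unfolding e fun_cong[OF E, of _ _ q] .
    have t: "(\<Sum>k\<in>UNIV. C k b c * ?B k a + C a k c * ?B k b + C a b k * ?B k c) = (d_dx None (d_dp None f) q + 1/2 * k) * C a b c" for q
      using s[of q] unfolding similarity_def by blast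
    have "(d_dx None (d_dp None f) p + 1/2 * k) * C a b c = (d_dx None (d_dp None f) 0 + 1/2 * k) * C a b c"
      by (rule trans[OF t[of p, symmetric] t[of 0]])
    then show "d_dx None (d_dp None f) p = d_dx None (d_dp None f) 0" using nz by simp
  qed
  show "d_dx i (d_dp j f) = (\<lambda>p. d_dx i (d_dp j f) 0)" for i j
    using y Y E E0 by (cases i; cases j) blast+
  show "d_dx i (d_dx j f) = (\<lambda>p. d_dx i (d_dx j f) 0)"
  proof (cases i; cases j)
    fix a b assume ij: "i = Some a" "j = Some b"
    have "d_dx (Some a) (d_dx (Some b) f) q = 3 * (\<Sum>c\<in>UNIV. C a b c * ?y c 0)" for q
      by (simp only: xaxb[OF f] fun_cong[OF y, of _ q])
    then show ?thesis unfolding ij by (intro ext) (simp only:)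
  qed (simp_all add: x0x0[OF f] x0xa[OF f])
  show "d_dp i (d_dp j f) = (\<lambda>p. d_dp i (d_dp j f) 0)"
  proof (cases i; cases j)
    fix a b assume ij: "i = Some a" "j = Some b"
    have "d_dp (Some a) (d_dp (Some b) f) q = - 3 * (\<Sum>c\<in>UNIV. D a b c * ?Y c 0)" for q
      by (simp only: papb[OF f] fun_cong[OF Y, of _ q])
    then show ?thesis unfolding ij by (intro ext) (simp only:)
  qed (simp_all add: p0p0[OF f] p0pa[OF f])
qed

text \<open>A multiple of the grading element removes \<open>f\<^sub>u\<close>. The functions \<open>quad_gen\<close> with one index 0
  realize the vector and covector part of the second derivatives, and the matrix part is inner by
  \<open>similarity_is_inner\<close>. The difference has vanishing second derivatives, hence is affine in the
  coordinates \<open>x\<^sup>i\<close>, \<open>u\<^sub>i\<close>.\<close>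

lemma degree_zero_generated:
  assumes f: "f \<in> S" and e: "d_du f = (\<lambda>p. k)"
  shows "f \<in> lie_generated gens"
proof -
  have hq: "holomorphic_fn (quad_gen i j)" for i j
    by (rule S_holo[OF generated_imp_S[OF quad_gen_generated]])
  define f4 where "f4 p = f p - k / 2 * grading_element p" for p
  have f4: "f4 \<in> S" unfolding f4_def[abs_def] by (intro S_diff S_scale f S_grading)
  have e4: "d_du f4 = (\<lambda>p. 0)"
    unfolding f4_def[abs_def] by (intro ext) (simp add: diff_rules holo S_holo[OF f] e grading_op)
  note sc = second_derivatives_constant[OF f4 e4]
  obtain a0 b0 c0 where nz: "C a0 b0 c0 \<noteq> 0" using nonzero by blast
  let ?B = "\<lambda>b a. d_dx (Some a) (d_dp (Some b) f4) 0"
  have "similarity C ?B (d_dx None (d_dp None f4) 0)"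
    using simil[OF f4, of 0] by (simp add: e4)
  then obtain A where A: "?B = inner_sim C D A" using similarity_is_inner[OF C D dual nz] by blast
  define y where "y a = d_dx None (d_dp (Some a) f4) 0" for a
  define Y where "Y a = d_dx (Some a) (d_dp None f4) 0" for a
  \<comment> \<open>the multiple of the grading element cancels the \<open>u\<close>-derivative of
    \<open>quad_gen\<close>\<close>
  define g where "g c d p = quad_gen (Some c) (Some d) p + 1/2 * delta c d * grading_element p" for c d p
  have hg: "holomorphic_fn (g c d)" for c d unfolding g_def[abs_def] by (intro holo hq)
  have g_gen: "g c d \<in> lie_generated gens" for c d
    unfolding g_def[abs_def] by (intro lie_lin quad_gen_generated grading_generated)
  have opg: "d_du (g c d) p = 0" "d_dx None (d_dp (Some b) (g c d)) p = 0" "d_dx (Some b) (d_dp None (g c d)) p = 0"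
    "d_dx (Some a) (d_dp (Some b) (g c d)) p = 1/2 * delta c d * delta b a + delta d a * delta c b - 9 * (\<Sum>e\<in>UNIV. C e c a * D e d b)"
    for a b c d p
  proof -
    have dpg: "d_dp i (g c d) = (\<lambda>p. d_dp i (quad_gen (Some c) (Some d)) p + - (1/2 * delta c d * cx p i))" for i
      unfolding g_def[abs_def] by (intro ext) (simp add: diff_rules holo hq grading_op)
    show "d_du (g c d) p = 0"
      unfolding g_def[abs_def] by (simp add: diff_rules holo hq grading_op quad_gen_op)
    show "d_dx None (d_dp (Some b) (g c d)) p = 0" "d_dx (Some b) (d_dp None (g c d)) p = 0"
      "d_dx (Some a) (d_dp (Some b) (g c d)) p = 1/2 * delta c d * delta b a + delta d a * delta c b - 9 * (\<Sum>e\<in>UNIV. C e c a * D e d b)"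
      unfolding dpg by (simp_all add: diff_rules holo hq quad_gen_y quad_gen_Y quad_gen_E, simp add: delta_def)
  qed
  \<comment> \<open>the combination of generators with the same second derivatives as \<open>f4\<close>\<close>
  define w where "w p = (\<Sum>a\<in>UNIV. y a * quad_gen (Some a) None p) + (\<Sum>a\<in>UNIV. Y a * quad_gen None (Some a) p)
     + (\<Sum>c\<in>UNIV. \<Sum>d\<in>UNIV. A c d * g c d p)" for p
  have w_gen: "w \<in> lie_generated gens"
    unfolding w_def[abs_def] by (intro lie_lin(1) sum_generated lie_lin(2) quad_gen_generated g_gen)
  have w: "w \<in> S" by (rule generated_imp_S[OF w_gen])
  have dpw: "d_dp i w = (\<lambda>p. (\<Sum>a\<in>UNIV. y a * d_dp i (quad_gen (Some a) None) p) + (\<Sum>a\<in>UNIV. Y a * d_dp i (quad_gen None (Some a)) p)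
     + (\<Sum>c\<in>UNIV. \<Sum>d\<in>UNIV. A c d * d_dp i (g c d) p))" for i
    unfolding w_def[abs_def] by (intro ext) (simp add: diff_rules holo hq hg)
  have ew: "d_du w p = 0" for p
    unfolding w_def[abs_def] by (simp add: diff_rules holo hq hg opg quad_gen_op)
  have yw: "d_dx None (d_dp (Some b) w) p = y b" for b p
    unfolding dpw by (simp add: diff_rules holo hq hg opg quad_gen_y)
  have Yw: "d_dx (Some b) (d_dp None w) p = Y b" for b p
    unfolding dpw by (simp add: diff_rules holo hq hg opg quad_gen_Y)
  have Ew: "d_dx (Some a) (d_dp (Some b) w) p = inner_sim C D A b a" for a b p
  proof -
    have "d_dx (Some a) (d_dp (Some b) w) p
       = (\<Sum>c\<in>UNIV. \<Sum>d\<in>UNIV. A c d * (1/2 * delta c d * delta b a + delta d a * delta c b - 9 * (\<Sum>e\<in>UNIV. C e c a * D e d b)))"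
      unfolding dpw by (simp add: diff_rules holo hq hg opg quad_gen_E)
    also have "\<dots> = 1/2 * delta b a * (\<Sum>c\<in>UNIV. \<Sum>d\<in>UNIV. A c d * delta c d) + (\<Sum>c\<in>UNIV. \<Sum>d\<in>UNIV. A c d * delta d a * delta c b)
       - 9 * (\<Sum>c\<in>UNIV. \<Sum>d\<in>UNIV. A c d * (\<Sum>e\<in>UNIV. C e c a * D e d b))"
      by (simp only: distrib_left right_diff_distrib sum.distrib sum_subtractf sum_distrib_left mult_ac)
    also have "(\<Sum>c\<in>UNIV. \<Sum>d\<in>UNIV. A c d * delta c d) = mat_trace A" by (simp add: mat_trace_def)
    also have "(\<Sum>c\<in>UNIV. \<Sum>d\<in>UNIV. A c d * delta d a * delta c b) = A b a" by (simp add: mult.assoc)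
    also have "(\<Sum>c\<in>UNIV. \<Sum>d\<in>UNIV. A c d * (\<Sum>e\<in>UNIV. C e c a * D e d b)) = twist C D A b a"
    proof -
      have "(\<Sum>c\<in>UNIV. \<Sum>d\<in>UNIV. A c d * (\<Sum>e\<in>UNIV. C e c a * D e d b)) = (\<Sum>d\<in>UNIV. \<Sum>c\<in>UNIV. \<Sum>e\<in>UNIV. A c d * (C e c a * D e d b))"
        unfolding sum_distrib_left by (rule sum.swap)
      also have "\<dots> = (\<Sum>d\<in>UNIV. \<Sum>e\<in>UNIV. \<Sum>c\<in>UNIV. A c d * (C e c a * D e d b))"
        by (rule sum.cong[OF refl], rule sum.swap)
      also have "\<dots> = twist C D A b a"
        unfolding twist_def by (simp add: mult_ac symmetric3_swap[OF C] symmetric3_swap[OF D])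
      finally show ?thesis .
    qed
    finally show ?thesis by (simp add: inner_sim_def)
  qed
  define f5 where "f5 p = f4 p - w p" for p
  have f5: "f5 \<in> S" unfolding f5_def[abs_def] by (intro S_diff f4 w)
  note h5 = S_holo[OF f5] and h4 = S_holo[OF f4] and hw = S_holo[OF w]
  have e5: "d_du f5 = (\<lambda>p. 0)" unfolding f5_def[abs_def] by (intro ext) (simp add: diff_rules h4 hw ew e4)
  have dp5: "d_dx i (d_dp j f5) p = d_dx i (d_dp j f4) p - d_dx i (d_dp j w) p" for i j p
  proof -
    have "d_dp j f5 = (\<lambda>p. d_dp j f4 p - d_dp j w p)" unfolding f5_def[abs_def] by (intro ext) (simp add: diff_rules h4 hw)
    then show ?thesis by (simp add: diff_rules holo h4 hw)
  qed
  have y5: "d_dx None (d_dp (Some b) f5) = (\<lambda>p. 0)" for b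
  proof
    fix p show "d_dx None (d_dp (Some b) f5) p = 0"
      using fun_cong[OF sc(3), of None "Some b" p] by (simp add: dp5 yw y_def)
  qed
  have Y5: "d_dx (Some b) (d_dp None f5) = (\<lambda>p. 0)" for b
  proof
    fix p show "d_dx (Some b) (d_dp None f5) p = 0"
      using fun_cong[OF sc(3), of "Some b" None p] by (simp add: dp5 Yw Y_def)
  qed
  have E5: "d_dx (Some a) (d_dp (Some b) f5) = (\<lambda>p. 0)" for a b
  proof
    fix p show "d_dx (Some a) (d_dp (Some b) f5) p = 0"
      using fun_cong[OF fun_cong[OF A], of a b] fun_cong[OF sc(3), of "Some a" "Some b" p] by (simp add: dp5 Ew)
  qed
  have E05: "d_dx None (d_dp None f5) = (\<lambda>p. 0)"
  proof
    fix p
    have "similarity C (\<lambda>b a. 0) (d_dx None (d_dp None f5) p)"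
      using simil[OF f5, of p] by (simp add: e5 E5)
    then have "d_dx None (d_dp None f5) p = 0 \<or> (\<forall>d e f. C d e f = 0)" unfolding similarity_def by simp
    then show "d_dx None (d_dp None f5) p = 0" using nz by blast
  qed
  have xp5: "d_dx i (d_dp j f5) = (\<lambda>p. 0)" for i j
    using y5 Y5 E5 E05 by (cases i; cases j) auto
  have xx5: "d_dx i (d_dx j f5) = (\<lambda>p. 0)" for i j
    using x0x0[OF f5] x0xa[OF f5] xaxb[OF f5] y5 by (cases i; cases j) auto
  have pp5: "d_dp i (d_dp j f5) = (\<lambda>p. 0)" for i j
    using p0p0[OF f5] p0pa[OF f5] papb[OF f5] Y5 by (cases i; cases j) auto
  have px5: "d_dp i (d_dx j f5) = (\<lambda>p. 0)" for i j
    unfolding dp_dx_commute[OF h5] xp5 e5 by simp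
  have "f5 \<in> lie_generated gens"
    by (subst affine_expansion[OF h5 xx5 pp5 xp5 px5])
       (intro lie_lin(1) const_generated sum_generated lie_lin(2) gens_generated)
  moreover have "f = (\<lambda>p. f5 p + (w p + k / 2 * grading_element p))"
    by (intro ext) (simp add: f5_def f4_def)
  ultimately show ?thesis
    using lie_lin(1)[OF _ lie_lin(1)[OF w_gen lie_lin(2)[OF grading_generated]], of f5 "k / 2"] by simp
qed

text \<open>As \<open>X\<^sub>i = \<partial>\<^sub>i + u\<^sub>i \<partial>\<^sub>u\<close>, this is the Euler operator with weight 1 for \<open>x\<^sup>i\<close>, \<open>u\<^sub>i\<close> and weight
  2 for \<open>u\<close>, minus 2.\<close>

lemma lagrange_grading:
  "lagrange grading_element g = (\<lambda>p. grading_element p * d_du g p - 2 * g p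
     + (\<Sum>i\<in>UNIV. cp p i * d_dp i g p + cx p i * d_dx i g p))"
  by (intro ext) (simp add: lagrange_def grading_op mult.commute)

lemma graded_iff: "g \<in> graded_part C k \<longleftrightarrow> g \<in> S \<and> lagrange grading_element g = (\<lambda>p. of_int k * g p)"
  by (simp add: graded_part_def)

lemma grading_lin:
  assumes g: "holomorphic_fn g"
  shows "holomorphic_fn f \<Longrightarrow> lagrange grading_element (\<lambda>p. f p + g p) = (\<lambda>p. lagrange grading_element f p + lagrange grading_element g p)"
    "lagrange grading_element (\<lambda>p. k * g p) = (\<lambda>p. k * lagrange grading_element g p)"
  unfolding lagrange_grading
  by (intro ext, simp add: diff_rules holo g algebra_simps sum.distrib sum_distrib_left)+

lemma graded_lin:
  "f \<in> graded_part C k \<Longrightarrow> g \<in> graded_part C k \<Longrightarrow> (\<lambda>p. f p + g p) \<in> graded_part C k"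
  "f \<in> graded_part C k \<Longrightarrow> (\<lambda>p. r * f p) \<in> graded_part C k"
  "(\<lambda>p. 0) \<in> graded_part C k"
proof -
  show "(\<lambda>p. f p + g p) \<in> graded_part C k" if "f \<in> graded_part C k" "g \<in> graded_part C k"
    using that unfolding graded_iff by (auto simp: grading_lin S_holo algebra_simps intro: S_add)
  show 2: "(\<lambda>p. r * f p) \<in> graded_part C k" if "f \<in> graded_part C k" for r f
    using that unfolding graded_iff by (auto simp: grading_lin S_holo algebra_simps intro: S_scale)
  show "(\<lambda>p. 0) \<in> graded_part C k"
    unfolding graded_iff lagrange_grading by (simp add: S_zero diff_rules)
qed

lemma graded_sum: "(\<And>i. i \<in> A \<Longrightarrow> F i \<in> graded_part C k) \<Longrightarrow> (\<lambda>p. \<Sum>i\<in>A. F i p) \<in> graded_part C k"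
  by (induction A rule: infinite_finite_induct) (auto intro: graded_lin)

lemma grading_of_bracket:
  assumes g: "holomorphic_fn g"
  shows "lagrange grading_element (lagrange g (\<lambda>p. cp p j)) p
       = lagrange (lagrange grading_element g) (\<lambda>p. cp p j) p - lagrange g (\<lambda>p. cp p j) p"
    "lagrange grading_element (lagrange g (\<lambda>p. cx p j)) p
       = lagrange (lagrange grading_element g) (\<lambda>p. cx p j) p - lagrange g (\<lambda>p. cx p j) p"
proof -
  show "lagrange grading_element (lagrange g (\<lambda>p. cp p j)) p
       = lagrange (lagrange grading_element g) (\<lambda>p. cp p j) p - lagrange g (\<lambda>p. cp p j) p"
    unfolding lagrange_grading lagrange_cp_op[OF g] unfolding lagrange_cp
    by (simp add: diff_rules holo g grading_op algebra_simps sum.distrib sum_distrib_left sum_subtractf)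
  show "lagrange grading_element (lagrange g (\<lambda>p. cx p j)) p
       = lagrange (lagrange grading_element g) (\<lambda>p. cx p j) p - lagrange g (\<lambda>p. cx p j) p"
    unfolding lagrange_grading lagrange_cx_op[OF g] unfolding lagrange_cx
    by (simp add: diff_rules holo g grading_op algebra_simps sum.distrib sum_distrib_left sum_subtractf sum_negf)
qed

lemma graded_bracket:
  assumes "f \<in> graded_part C k"
  shows "lagrange f (\<lambda>p. cp p j) \<in> graded_part C (k - 1)" "lagrange f (\<lambda>p. cx p j) \<in> graded_part C (k - 1)"
proof -
  have f: "f \<in> S" "lagrange grading_element f = (\<lambda>p. of_int k * f p)" using assms unfolding graded_iff by auto
  note h = S_holo[OF f(1)]
  have "lagrange (\<lambda>p. of_int k * f p) (\<lambda>p. cp p j) p = of_int k * lagrange f (\<lambda>p. cp p j) p"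
    "lagrange (\<lambda>p. of_int k * f p) (\<lambda>p. cx p j) p = of_int k * lagrange f (\<lambda>p. cx p j) p" for p
    unfolding lagrange_cp lagrange_cx by (simp_all add: diff_rules holo h algebra_simps)
  then show "lagrange f (\<lambda>p. cp p j) \<in> graded_part C (k - 1)" "lagrange f (\<lambda>p. cx p j) \<in> graded_part C (k - 1)"
    unfolding graded_iff using S_lagrange[OF f(1) S_coord(3)] S_lagrange[OF f(1) S_coord(2)]
    by (auto simp: fun_eq_iff grading_of_bracket[OF h] f(2) algebra_simps)
qed

lemma graded_coord:
  "(\<lambda>p. k) \<in> graded_part C (- 2)" "(\<lambda>p. cx p i) \<in> graded_part C (- 1)" "(\<lambda>p. cp p i) \<in> graded_part C (- 1)"
  unfolding graded_iff lagrange_grading using S_coord by (auto simp: fun_eq_iff diff_rules sum.distrib)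

text \<open>The top generator is homogeneous of weight 4.\<close>

lemma graded_topgen: "T \<in> graded_part C 2"
proof -
  have sum_lin3: "(\<Sum>a\<in>UNIV. u * A a + v * B a + w * R a) = u * (\<Sum>a\<in>UNIV. A a) + v * (\<Sum>a\<in>UNIV. B a) + w * (\<Sum>a\<in>UNIV. R a)"
    for u v w :: complex and A B R :: "'m \<Rightarrow> complex"
    by (simp add: sum.distrib sum_distrib_left)
  have "lagrange grading_element T p = of_int 2 * T p" for p
  proof -
    let ?X = "jx p" and ?P = "jp p"
    define W where "W = (\<Sum>c\<in>UNIV. polar C ?X ?X c * polar D ?P ?P c)"
    define q where "q = dot ?P ?X"
    have jxp: "jxp p = cx p None * cp p None + q"
      by (simp add: q_def sum_option dot_def mult.commute)
    have 1: "(\<Sum>a\<in>UNIV. cp p (Some a) * d_dp (Some a) T p) = - (cu p * q) + 3/2 * cubic D ?P * cx p None + 9/2 * W"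
    proof -
      have ar: "P * (- (u * x) + 3/2 * c * z + 9/2 * R) = - u * (P * x) + 3/2 * z * (P * c) + 9/2 * (P * R)" for P u x c z R :: complex
          by (simp add: algebra_simps)
      have "(\<Sum>a\<in>UNIV. ?P a * (\<Sum>c\<in>UNIV. polar C ?X ?X c * polar D ?P (\<lambda>b. delta a b) c))
          = (\<Sum>c\<in>UNIV. polar C ?X ?X c * (\<Sum>a\<in>UNIV. ?P a * polar D ?P (\<lambda>b. delta a b) c))"
        unfolding sum_distrib_left by (subst sum.swap) (simp add: mult_ac)
      then have "(\<Sum>a\<in>UNIV. ?P a * (\<Sum>c\<in>UNIV. polar C ?X ?X c * polar D ?P (\<lambda>b. delta a b) c)) = W"
        unfolding polar_expand(2)[OF C D] W_def .
      moreover have "(\<Sum>a\<in>UNIV. cp p (Some a) * d_dp (Some a) T p)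
        = - cu p * dot ?P ?X + 3/2 * cx p None * dot ?P (polar D ?P ?P)
          + 9/2 * (\<Sum>a\<in>UNIV. ?P a * (\<Sum>c\<in>UNIV. polar C ?X ?X c * polar D ?P (\<lambda>b. delta a b) c))"
        unfolding topgen_dpa[OF C D] dot_def ar sum_lin3 ..
      ultimately show ?thesis by (simp add: q_def cubic_dot)
    qed
    have 2: "(\<Sum>a\<in>UNIV. cx p (Some a) * d_dx (Some a) T p) = cu p * q - q * jxp p - 3/2 * cubic C ?X * cp p None + 9/2 * W"
    proof -
      have ar: "x * (u * P - P * v - 3/2 * c * z + 9/2 * R) = (u - v) * (P * x) + - (3/2) * z * (x * c) + 9/2 * (x * R)" for P u x c z v R :: complex
          by (simp add: algebra_simps)
      have "(\<Sum>a\<in>UNIV. ?X a * (\<Sum>c\<in>UNIV. polar C ?X (\<lambda>b. delta a b) c * polar D ?P ?P c))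
          = (\<Sum>c\<in>UNIV. (\<Sum>a\<in>UNIV. ?X a * polar C ?X (\<lambda>b. delta a b) c) * polar D ?P ?P c)"
        unfolding sum_distrib_left sum_distrib_right by (subst sum.swap) (simp add: mult_ac)
      then have "(\<Sum>a\<in>UNIV. ?X a * (\<Sum>c\<in>UNIV. polar C ?X (\<lambda>b. delta a b) c * polar D ?P ?P c)) = W"
        unfolding polar_expand(1)[OF C D] W_def .
      moreover have "(\<Sum>a\<in>UNIV. cx p (Some a) * d_dx (Some a) T p)
        = (cu p - jxp p) * dot ?P ?X + - (3/2) * cp p None * dot ?X (polar C ?X ?X)
          + 9/2 * (\<Sum>a\<in>UNIV. ?X a * (\<Sum>c\<in>UNIV. polar C ?X (\<lambda>b. delta a b) c * polar D ?P ?P c))"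
        unfolding topgen_dxa[OF C D] dot_def ar sum_lin3 ..
      ultimately show ?thesis by (simp add: q_def cubic_dot algebra_simps)
    qed
    have "lagrange grading_element T p = grading_element p * grading_element p - 2 * T p
       + (cp p None * d_dp None T p + cx p None * d_dx None T p)
       + ((\<Sum>a\<in>UNIV. cp p (Some a) * d_dp (Some a) T p) + (\<Sum>a\<in>UNIV. cx p (Some a) * d_dx (Some a) T p))"
      unfolding lagrange_grading topgen_du' by (simp add: sum_option sum.distrib)
    also have "\<dots> = of_int 2 * T p"
      unfolding 1 2 topgen_dp0[OF C D] topgen_dx0[OF C D] topgen_def grading_element_eq W_def[symmetric] jxp
      by (simp add: algebra_simps)
    finally show ?thesis .
  qed
  then show ?thesis unfolding graded_iff using S_topgen by blast
qed

text \<open>The second derivatives of \<open>[Z, f]\<close> vanish because those of \<open>f\<close> are constant, and \<open>[Z, f]\<close>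
  vanishes to first order at the origin like \<open>f\<close>.\<close>

lemma degree_zero_graded:
  assumes f: "f \<in> S" and e: "d_du f = (\<lambda>p. m)" and f0: "f 0 = 0"
    and X0: "\<And>i. d_dx i f 0 = 0" and U0: "\<And>i. d_dp i f 0 = 0"
  shows "f \<in> graded_part C 0"
proof -
  note h = S_holo[OF f]
  define Kxx where "Kxx i j = d_dx i (d_dx j f) 0" for i j
  define Kpp where "Kpp i j = d_dp i (d_dp j f) 0" for i j
  define Kxp where "Kxp i j = d_dx i (d_dp j f) 0" for i j
  have K: "d_dx i (d_dx j f) = (\<lambda>p. Kxx i j)" "d_dp i (d_dp j f) = (\<lambda>p. Kpp i j)" "d_dx i (d_dp j f) = (\<lambda>p. Kxp i j)" for i j
    unfolding Kxx_def Kpp_def Kxp_def by (rule second_derivatives_constant[OF f e])+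
  have K': "d_dp i (d_dx j f) = (\<lambda>p. Kxp j i + delta i j * m)" for i j
    unfolding dp_dx_commute[OF h] K e ..
  have Ks: "Kxx i j = Kxx j i" "Kpp i j = Kpp j i" for i j
    unfolding Kxx_def Kpp_def using dx_commute[OF h, of i j] dp_commute[OF h, of i j] by simp_all
  define r where "r p = grading_element p * m - 2 * f p + (\<Sum>i\<in>UNIV. cp p i * d_dp i f p + cx p i * d_dx i f p)" for p
  have r: "lagrange grading_element f = r"
    unfolding lagrange_grading e r_def[abs_def] ..
  have hr: "holomorphic_fn r" unfolding r_def[abs_def] by (intro holo h)
  have Xr: "d_dx j r = (\<lambda>p. m * cp p j - d_dx j f p + (\<Sum>i\<in>UNIV. cp p i * Kxp j i + cx p i * Kxx j i))" for j
    unfolding r_def[abs_def] by (intro ext) (simp add: diff_rules holo h grading_op K algebra_simps sum.distrib)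
  have Ur: "d_dp j r = (\<lambda>p. - d_dp j f p + (\<Sum>i\<in>UNIV. cp p i * Kpp j i + cx p i * Kxp i j))" for j
    unfolding r_def[abs_def] by (intro ext) (simp add: diff_rules holo h grading_op K K' algebra_simps sum.distrib)
  have "r = (\<lambda>p. r 0 + ((\<Sum>i\<in>UNIV. d_dx i r 0 * cx p i) + (\<Sum>i\<in>UNIV. d_dp i r 0 * cp p i)))"
  proof (rule affine_expansion[OF hr])
    show "d_dx i (d_dx j r) = (\<lambda>p. 0)" for i j
      unfolding Xr by (intro ext) (simp add: diff_rules holo h K Ks[of i j])
    show "d_dp i (d_dp j r) = (\<lambda>p. 0)" for i j
      unfolding Ur by (intro ext) (simp add: diff_rules holo h K Ks[of i j])
    show "d_dx i (d_dp j r) = (\<lambda>p. 0)" for i j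
      unfolding Ur by (intro ext) (simp add: diff_rules holo h K)
    show "d_dp i (d_dx j r) = (\<lambda>p. 0)" for i j
      unfolding Xr by (intro ext) (simp add: diff_rules holo h K')
  qed
  moreover have "r 0 = 0" by (simp add: r_def grading_element_eq f0)
  moreover have "d_dx i r 0 = 0" "d_dp i r 0 = 0" for i unfolding Xr Ur by (simp_all add: X0 U0)
  ultimately have "r = (\<lambda>p. 0)" by simp
  then show ?thesis unfolding graded_iff r using f by simp
qed

text \<open>The degrees are removed from the top: \<open>f\<^sub>u\<^sub>u\<close> determines the multiple of \<open>T\<close>, the first
  derivatives of \<open>f\<^sub>u\<close> the combination of \<open>[T, x\<^sup>i]\<close> and \<open>[T, u\<^sub>i]\<close>, and the first derivatives at
  the origin the part of degree \<open>-1\<close>.\<close>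

theorem decomposition:
  assumes f: "f \<in> S"
  obtains k h1 h0 h' c where
    "f = (\<lambda>p. k * T p + h1 p + h0 p + h' p + c)"
    "h1 \<in> graded_part C 1" "h0 \<in> graded_part C 0" "h' \<in> graded_part C (- 1)"
    "h1 \<in> lie_generated gens" "h0 \<in> lie_generated gens" "h' \<in> lie_generated gens"
proof -
  note h = S_holo[OF f]
  \<comment> \<open>the second \<open>u\<close>-derivative of the top generator is 2\<close>
  define k where "k = d_du (d_du f) 0 / 2"
  define f1 where "f1 p = f p - k * T p" for p
  have f1: "f1 \<in> S" unfolding f1_def[abs_def] by (intro S_diff f S_scale S_topgen)
  note hf1 = S_holo[OF f1]
  have "d_du f1 = (\<lambda>p. d_du f p - k * grading_element p)"
    unfolding f1_def[abs_def] by (intro ext) (simp add: diff_rules holo h topgen_du')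
  then have "d_du (d_du f1) p = d_du (d_du f) p - 2 * k" for p
    by (simp add: diff_rules holo h grading_op)
  then have uu: "d_du (d_du f1) = (\<lambda>p. 0)"
    using fun_cong[OF du_du_constant[OF f]] by (intro ext) (simp add: k_def)
  define a where "a i = d_dx i (d_du f1) 0" for i
  define b where "b i = d_dp i (d_du f1) 0" for i
  define m where "m = d_du f1 0"
  have e1: "d_du f1 = (\<lambda>p. m + ((\<Sum>i\<in>UNIV. a i * cx p i) + (\<Sum>i\<in>UNIV. b i * cp p i)))"
    unfolding a_def b_def m_def
  proof (rule affine_expansion)
    show "holomorphic_fn (d_du f1)" by (intro holo hf1)
    show "d_dp i (d_dx j (d_du f1)) = (\<lambda>p. 0)" for i j
      unfolding dp_dx_commute[OF holo_op(3)[OF hf1]] du_hessian[OF f1] uu by simp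
  qed (simp_all add: du_hessian[OF f1] uu)
  define h1 where "h1 p = (\<Sum>i\<in>UNIV. - a i * lagrange T (\<lambda>p. cx p i) p) + (\<Sum>i\<in>UNIV. - b i * lagrange T (\<lambda>p. cp p i) p)" for p
  have h1_graded: "h1 \<in> graded_part C 1"
    unfolding h1_def[abs_def]
    using graded_bracket[OF graded_topgen] by (intro graded_lin graded_sum) simp_all
  have h1_gen: "h1 \<in> lie_generated gens"
    unfolding h1_def[abs_def] by (intro lie_lin(1) sum_generated lie_lin(2) lie_generated.bracket gens_generated)
  have h1: "h1 \<in> S" using h1_graded unfolding graded_iff by blast
  have uh1: "d_du h1 = (\<lambda>p. (\<Sum>i\<in>UNIV. a i * cx p i) + (\<Sum>i\<in>UNIV. b i * cp p i))"
  proof -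
    have "d_du (lagrange T (\<lambda>p. cx p i)) = (\<lambda>p. - cx p i)" "d_du (lagrange T (\<lambda>p. cp p i)) = (\<lambda>p. - cp p i)" for i
      unfolding lagrange_cx_op(3)[OF holo_topgen] lagrange_cp_op(3)[OF holo_topgen] topgen_du'
      unfolding lagrange_cx lagrange_cp grading_op by (intro ext, simp)+
    then show ?thesis unfolding h1_def[abs_def] by (intro ext) (simp add: diff_rules holo)
  qed
  define f2 where "f2 p = f1 p - h1 p" for p
  have f2: "f2 \<in> S" unfolding f2_def[abs_def] by (intro S_diff f1 h1)
  note hf2 = S_holo[OF f2]
  have e2: "d_du f2 = (\<lambda>p. m)"
    unfolding f2_def[abs_def] by (intro ext) (simp add: diff_rules hf1 S_holo[OF h1] e1 uh1)
  define h' where "h' p = (\<Sum>i\<in>UNIV. d_dx i f2 0 * cx p i) + (\<Sum>i\<in>UNIV. d_dp i f2 0 * cp p i)" for p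
  have h'_graded: "h' \<in> graded_part C (- 1)"
    unfolding h'_def[abs_def] by (intro graded_lin graded_sum graded_coord)
  have h'_gen: "h' \<in> lie_generated gens"
    unfolding h'_def[abs_def] by (intro lie_lin(1) sum_generated lie_lin(2) gens_generated)
  have h': "h' \<in> S" using h'_graded unfolding graded_iff by blast
  have oph': "d_dx j h' p = d_dx j f2 0" "d_dp j h' p = d_dp j f2 0" "d_du h' p = 0" for j p
    unfolding h'_def[abs_def] by (simp_all add: diff_rules holo)
  define h0 where "h0 p = f2 p - (h' p + f2 0)" for p
  have h0: "h0 \<in> S" unfolding h0_def[abs_def] by (intro S_diff S_add f2 h' S_coord)
  have oph0: "d_dx j h0 p = d_dx j f2 p - d_dx j f2 0" "d_dp j h0 p = d_dp j f2 p - d_dp j f2 0" "d_du h0 p = m" for j p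
    unfolding h0_def[abs_def] by (simp_all add: diff_rules holo hf2 S_holo[OF h'] oph' e2)
  then have e0: "d_du h0 = (\<lambda>p. m)" by blast
  have "h0 0 = 0" by (simp add: h0_def h'_def)
  then have h0_graded: "h0 \<in> graded_part C 0"
    by (intro degree_zero_graded[OF h0 e0]) (simp_all add: oph0)
  have h0_gen: "h0 \<in> lie_generated gens" by (rule degree_zero_generated[OF h0 e0])
  show ?thesis
    by (rule that[of k h1 h0 h' "f2 0"])
       (auto simp: f1_def f2_def h0_def h1_graded h0_graded h'_graded h1_gen h0_gen h'_gen)
qed

theorem generated_eq: "lie_generated gens = S"
proof
  show "lie_generated gens \<subseteq> S" by (rule subsetI) (rule generated_imp_S)
  show "S \<subseteq> lie_generated gens"
  proof
    fix f assume "f \<in> S"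
    then show "f \<in> lie_generated gens"
    proof (rule decomposition)
      fix k h1 h0 h' c
      assume dec: "f = (\<lambda>p. k * T p + h1 p + h0 p + h' p + c)"
        and h: "h1 \<in> lie_generated gens" "h0 \<in> lie_generated gens" "h' \<in> lie_generated gens"
      show ?thesis
        unfolding dec by (rule lie_lin(1) lie_lin(2) gens_generated(3) const_generated h)+
    qed
  qed
qed

lemma degrees: "{- 2..2 :: int} = {- 2, - 1, 0, 1, 2}" by auto

text \<open>Applying the bracket with the grading element repeatedly gives the Vandermonde system
  with nodes \<open>-2, ..., 2\<close> for the values of the components.\<close>

lemma graded_independent:
  assumes d: "\<And>k. k \<in> {- 2..2} \<Longrightarrow> d k \<in> graded_part C k" and 0: "\<And>p. (\<Sum>k=- 2..2. d k p) = 0"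
    and k: "k \<in> {- 2..2 :: int}"
  shows "d k = (\<lambda>p. 0)"
proof
  fix p
  have pw: "(\<Sum>k=- 2..2. of_int k ^ j * d k p) = 0" for j p
  proof (induction j arbitrary: p)
    case 0
    then show ?case using assms(2) by simp
  next
    case (Suc j)
    have hd: "holomorphic_fn (d k)" if "k \<in> {- 2..2}" for k
      using d[OF that] S_holo unfolding graded_iff by blast
    have z: "lagrange grading_element (\<lambda>p. \<Sum>k=- 2..2. of_int k ^ j * d k p) p = 0"
      unfolding Suc.IH lagrange_grading by (simp add: diff_rules)
    have l: "lagrange grading_element (\<lambda>p. \<Sum>k\<in>A. of_int k ^ j * d k p) p = (\<Sum>k\<in>A. of_int k ^ Suc j * d k p)"
      if "A \<subseteq> {- 2..2}" for A
    proof -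
      have "finite A" using that finite_subset by blast
      then show ?thesis using that
      proof (induction A)
        case empty
        then show ?case unfolding lagrange_grading by (simp add: diff_rules)
      next
        case (insert k A)
        have hk: "holomorphic_fn (d k)" and hA: "holomorphic_fn (\<lambda>p. \<Sum>k\<in>A. of_int k ^ j * d k p)"
          using insert.prems hd by (auto intro!: holo)
        have "lagrange grading_element (d k) p = of_int k * d k p"
          using d[of k] insert.prems unfolding graded_iff by (simp add: fun_eq_iff)
        moreover have "lagrange grading_element (\<lambda>p. of_int k ^ j * d k p + (\<Sum>k\<in>A. of_int k ^ j * d k p)) p
            = of_int k ^ j * lagrange grading_element (d k) p + lagrange grading_element (\<lambda>p. \<Sum>k\<in>A. of_int k ^ j * d k p) p"
          by (subst grading_lin(1)) (auto simp: grading_lin(2)[OF hk] intro!: holo hk hA)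
        ultimately show ?case using insert by (simp add: mult_ac)
      qed
    qed
    show ?case unfolding l[OF subset_refl, symmetric] by (rule z)
  qed
  define x where "x k = d k p" for k
  have e: "x (-2) + x (-1) + x 0 + x 1 + x 2 = 0" "- 2 * x (-2) - x (-1) + x 1 + 2 * x 2 = 0"
    "4 * x (-2) + x (-1) + x 1 + 4 * x 2 = 0" "- 8 * x (-2) - x (-1) + x 1 + 8 * x 2 = 0"
    "16 * x (-2) + x (-1) + x 1 + 16 * x 2 = 0"
    using pw[of 0 p] pw[of 1 p] pw[of 2 p] pw[of 3 p] pw[of 4 p]
    by (simp_all add: degrees x_def algebra_simps)
  have "12 * (x (-2) + x 2) = (16 * x (-2) + x (-1) + x 1 + 16 * x 2) - (4 * x (-2) + x (-1) + x 1 + 4 * x 2)"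
    by (simp add: algebra_simps)
  then have s2: "x (-2) + x 2 = 0" unfolding e diff_self mult_eq_0_iff by simp
  have "6 * (x 2 - x (-2)) = (- 8 * x (-2) - x (-1) + x 1 + 8 * x 2) - (- 2 * x (-2) - x (-1) + x 1 + 2 * x 2)"
    by (simp add: algebra_simps)
  then have d2: "x 2 - x (-2) = 0" unfolding e diff_self mult_eq_0_iff by simp
  have "2 * x 2 = (x (-2) + x 2) + (x 2 - x (-2))" by simp
  then have x2: "x 2 = 0" "x (-2) = 0" using s2 d2 by auto
  have s1: "x (-1) + x 1 = 0" "x 1 - x (-1) = 0" using e(2,3) x2 by auto
  have "2 * x 1 = (x (-1) + x 1) + (x 1 - x (-1))" by simp
  then have x1: "x 1 = 0" "x (-1) = 0" using s1 by auto
  have "x 0 = 0" using e(1) x1 x2 by simp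
  then show "d k p = 0" using k x1 x2 unfolding degrees by (auto simp: x_def)
qed

theorem grading:
  assumes f: "f \<in> S"
  shows "\<exists>!h. h \<in> (\<Pi>\<^sub>E k\<in>{- 2..2}. graded_part C k) \<and> f = (\<Sum>k=- 2..2. h k)"
proof -
  have fun_sum: "(\<Sum>k\<in>A. h k) p = (\<Sum>k\<in>A. h k p)" if "finite A" for h :: "int \<Rightarrow> 'm jet \<Rightarrow> complex" and A p
    using that by (induction A) auto
  obtain k h1 h0 h' c where dec: "f = (\<lambda>p. k * T p + h1 p + h0 p + h' p + c)"
    "h1 \<in> graded_part C 1" "h0 \<in> graded_part C 0" "h' \<in> graded_part C (- 1)"
    "h1 \<in> lie_generated gens" "h0 \<in> lie_generated gens" "h' \<in> lie_generated gens"
    by (rule decomposition[OF f])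
  define h where "h = (\<lambda>j\<in>{- 2..2 :: int}. if j = 2 then (\<lambda>p. k * T p) else if j = 1 then h1 else if j = 0 then h0
      else if j = - 1 then h' else (\<lambda>p. c))"
  show ?thesis
  proof (rule ex1I[of _ h])
    have "h \<in> (\<Pi>\<^sub>E k\<in>{- 2..2}. graded_part C k)"
      unfolding h_def degrees using dec graded_lin(2)[OF graded_topgen] graded_coord(1) by auto
    moreover have "f = (\<Sum>k=- 2..2. h k)"
      by (rule ext) (simp add: fun_sum dec(1), simp add: degrees h_def)
    ultimately show "h \<in> (\<Pi>\<^sub>E k\<in>{- 2..2}. graded_part C k) \<and> f = (\<Sum>k=- 2..2. h k)" ..
    fix g assume g: "g \<in> (\<Pi>\<^sub>E k\<in>{- 2..2}. graded_part C k) \<and> f = (\<Sum>k=- 2..2. g k)"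
    have hP: "h \<in> (\<Pi>\<^sub>E k\<in>{- 2..2}. graded_part C k)" by fact
    have fh: "f = (\<Sum>k=- 2..2. h k)" by fact
    have "(\<lambda>p. g j p + - 1 * h j p) = (\<lambda>p. 0)" if j: "j \<in> {- 2..2}" for j
    proof (rule graded_independent[OF _ _ j])
      show "(\<lambda>p. g j p + - 1 * h j p) \<in> graded_part C j" if "j \<in> {- 2..2}" for j
        using g hP that by (intro graded_lin) auto
      fix p
      have "(\<Sum>k=- 2..2. g k) p = (\<Sum>k=- 2..2. h k) p" using g fh by simp
      then show "(\<Sum>k=- 2..2. g k p + - 1 * h k p) = 0"
        by (simp add: fun_sum sum_subtractf)
    qed
    then have "g j = h j" if "j \<in> {- 2..2}" for j using that by (auto simp: fun_eq_iff)
    then show "g = h" using g hP by (intro PiE_ext) auto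
  qed
qed

theorem top_degree: "graded_part C 2 = {(\<lambda>p. c * T p) | c. True}"
proof
  show "{(\<lambda>p. c * T p) | c. True} \<subseteq> graded_part C 2"
    using graded_lin(2)[OF graded_topgen] by blast
  show "graded_part C 2 \<subseteq> {(\<lambda>p. c * T p) | c. True}"
  proof
    fix f assume f: "f \<in> graded_part C 2"
    then have "f \<in> S" unfolding graded_iff by blast
    then obtain k h1 h0 h' c where dec: "f = (\<lambda>p. k * T p + h1 p + h0 p + h' p + c)"
    "h1 \<in> graded_part C 1" "h0 \<in> graded_part C 0" "h' \<in> graded_part C (- 1)"
    "h1 \<in> lie_generated gens" "h0 \<in> lie_generated gens" "h' \<in> lie_generated gens"
      by (rule decomposition)
    define d where "d j = (if j = 2 then (\<lambda>p. k * T p - f p) else if j = 1 then h1 else if j = 0 then h0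
      else if j = - 1 then h' else (\<lambda>p. c))" for j :: int
    have "d 2 = (\<lambda>p. 0)"
    proof (rule graded_independent)
      show "d j \<in> graded_part C j" if "j \<in> {- 2..2}" for j
      proof -
        have "(\<lambda>p. k * T p - f p) \<in> graded_part C 2"
          using graded_lin(1)[OF graded_lin(2)[OF graded_topgen] graded_lin(2)[OF f], of k "- 1"] by simp
        then show ?thesis using that dec(2-4) graded_coord(1) unfolding degrees d_def by auto
      qed
      show "(\<Sum>k=- 2..2. d k p) = 0" for p
        by (simp add: degrees d_def dec(1))
    qed simp
    then have "f = (\<lambda>p. k * T p)" by (simp add: d_def fun_eq_iff)
    then show "f \<in> {(\<lambda>p. c * T p) | c. True}" by blast
  qed
qed

end

section \<open>The cubic forms are nonzero\<close>

text \<open>Laws that hold in \<open>\<complex>\<close> and pass to the doubled algebra, so that they hold for all four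
  algebras at once; they determine the powers and traces of the identity matrix.\<close>

class star_module = star_algebra +
  assumes ascale_add_right: "ascale c (x + y) = ascale c x + ascale c y"
    and ascale_add_left: "ascale (c + d) x = ascale c x + ascale d x"
    and ascale_ascale: "ascale c (ascale d x) = ascale (c * d) x"
    and ascale_one: "ascale 1 x = x"
    and amult_one_one: "amult aone aone = aone"
    and amult_zero: "amult x 0 = 0" "amult 0 x = 0"
    and aconj_one: "aconj aone = aone"
    and aconj_zero: "aconj 0 = 0"
    and areal_one: "areal aone = 1"
    and areal_ascale: "areal (ascale c x) = c * areal x"

instance complex :: star_module
  by standard (simp_all add: amult_complex_def aone_complex_def ascale_complex_def aconj_complex_def
      areal_complex_def algebra_simps)

instance dbl :: (star_module) star_module
  by standard
    (simp_all add: amult_dbl_def aone_dbl_def ascale_dbl_def aconj_dbl_def areal_dbl_def plus_dbl_def zero_dbl_def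
      ascale_add_right ascale_add_left ascale_ascale ascale_one amult_one_one amult_zero aconj_one aconj_zero
      areal_one areal_ascale)

lemma module_hscale: "module (hscale :: complex \<Rightarrow> 'a::star_module ^ 3 ^ 3 \<Rightarrow> 'a ^ 3 ^ 3)"
  by unfold_locales
    (simp_all add: hscale_def vec_eq_iff ascale_add_right ascale_add_left ascale_ascale ascale_one)

text \<open>At the identity matrix the characteristic equation reads \<open>1 - 3 + 3 - d = 0\<close>.\<close>

lemma hdet_hone: "hdet (hone :: 'a::star_module ^ 3 ^ 3) = 1"
proof -
  interpret module "hscale :: complex \<Rightarrow> 'a ^ 3 ^ 3 \<Rightarrow> 'a ^ 3 ^ 3" by (rule module_hscale)
  let ?e = "hone :: 'a ^ 3 ^ 3"
  have "hmult ?e ?e = ?e"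
    by (simp add: hmult_def hone_def vec_eq_iff forall_3 sum_3 amult_one_one amult_zero)
  then have jj: "jordan ?e ?e = ?e"
    by (simp add: jordan_def scale_right_distrib flip: scale_left_distrib)
  have tr: "htrace ?e = 3"
    by (simp add: htrace_def hone_def sum_3 areal_one)
  have "(jordan ?e (jordan ?e ?e) - hscale (htrace ?e) (jordan ?e ?e)
      - hscale (1/2 * (htrace (jordan ?e ?e) - (htrace ?e)\<^sup>2)) ?e - hscale d ?e = 0) \<longleftrightarrow> d = 1" for d
  proof -
    have "jordan ?e (jordan ?e ?e) - hscale (htrace ?e) (jordan ?e ?e)
      - hscale (1/2 * (htrace (jordan ?e ?e) - (htrace ?e)\<^sup>2)) ?e - hscale d ?e
      = hscale 1 ?e - hscale 3 ?e - hscale (- 3) ?e - hscale d ?e"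
      by (simp add: jj tr)
    also have "\<dots> = hscale (1 - d) ?e"
      by (simp only: scale_left_diff_distrib[symmetric]) simp
    finally have 1: "jordan ?e (jordan ?e ?e) - hscale (htrace ?e) (jordan ?e ?e)
      - hscale (1/2 * (htrace (jordan ?e ?e) - (htrace ?e)\<^sup>2)) ?e - hscale d ?e = hscale (1 - d) ?e" .
    have "ascale 0 (0 :: 'a) = 0" using ascale_add_left[of 0 0 "0 :: 'a"] by simp
    then have "areal (0 :: 'a) = 0" using areal_ascale[of 0 "0 :: 'a"] by simp
    moreover have "areal (hscale (1 - d) ?e $ 1 $ 1) = 1 - d"
      by (simp add: hscale_def hone_def areal_ascale areal_one)
    ultimately have "d = 1" if "hscale (1 - d) ?e = 0" using that by simp
    then show ?thesis unfolding 1 by auto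
  qed
  then show ?thesis unfolding hdet_def Let_def by simp
qed

lemma cubic_coeffs_nonzero:
  assumes "module sc" and cc: "cubic_coeffs sc W N C" and v: "v \<in> W" "N v \<noteq> 0"
  shows "\<exists>a b c. C a b c \<noteq> 0"
proof (rule ccontr)
  assume "\<not> ?thesis"
  then have 0: "cubic C t = 0" for t by (simp add: cubic_def)
  interpret module sc by fact
  obtain w where w: "inj w" "span (range w) = W" "\<And>t. N (\<Sum>a\<in>UNIV. sc (t a) (w a)) = cubic C t"
    using cc unfolding cubic_coeffs_def by blast
  have "v \<in> range (\<lambda>u. \<Sum>x\<in>range w. sc (u x) x)"
    using v(1) w(2) span_finite[of "range w"] by simp
  then obtain u where "v = (\<Sum>x\<in>range w. sc (u x) x)" by blast
  also have "\<dots> = (\<Sum>a\<in>UNIV. sc (u (w a)) (w a))"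
    by (simp add: sum.reindex[OF w(1)])
  finally have "N v = 0" using w(3)[of "\<lambda>a. u (w a)"] 0 by simp
  with v(2) show False by simp
qed

lemma symmetric3_data: "cubic_data G C \<Longrightarrow> symmetric3 C"
  by (cases G) (auto simp: js_data_def diagonal_data_def hermitian_data_def cubic_coeffs_def)

lemma hermitian_data_nonzero:
  assumes "hermitian_data TYPE('a::star_module) C" shows "\<exists>a b c. C a b c \<noteq> 0"
proof (rule cubic_coeffs_nonzero[OF module_hscale])
  show "cubic_coeffs hscale (hermitian :: ('a ^ 3 ^ 3) set) hdet C"
    using assms unfolding hermitian_data_def .
  show "(hone :: 'a ^ 3 ^ 3) \<in> hermitian"
    by (simp add: hermitian_def hone_def aconj_one aconj_zero)
  show "hdet (hone :: 'a ^ 3 ^ 3) \<noteq> 0" by (simp add: hdet_hone)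
qed

text \<open>A quadratic form that vanishes identically has zero polarization, so it is degenerate in
  positive dimension.\<close>

lemma js_data_nonzero:
  assumes "js_data m C" "m > 0" shows "\<exists>a b c. C a b c \<noteq> 0"
proof -
  let ?sc = "\<lambda>c (v, l). (\<lambda>i. c * v i, c * l) :: (nat \<Rightarrow> complex) \<times> complex"
  obtain B where B: "nondegenerate_symmetric m B"
    and cc: "cubic_coeffs ?sc (cspace m \<times> UNIV) (\<lambda>(v, l). bilin m B v v * l) C"
    using assms(1) unfolding js_data_def by blast
  have mod: "module ?sc"
    by unfold_locales (auto simp: fun_eq_iff algebra_simps)
  have "\<exists>v\<in>cspace m. bilin m B v v \<noteq> 0"
  proof (rule ccontr)
    assume "\<not> ?thesis"
    then have 0: "bilin m B v v = 0" if "v \<in> cspace m" for v using that by blast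
    have sym: "bilin m B v v' = bilin m B v' v" for v v'
    proof -
      have "bilin m B v v' = (\<Sum>j<m. \<Sum>i<m. B i j * v i * v' j)" unfolding bilin_def by (rule sum.swap)
      also have "\<dots> = bilin m B v' v"
        unfolding bilin_def using B unfolding nondegenerate_symmetric_def
        by (intro sum.cong refl) (simp add: mult_ac)
      finally show ?thesis .
    qed
    have "bilin m B v v' = 0" if "v \<in> cspace m" "v' \<in> cspace m" for v v'
    proof -
      have "(\<lambda>i. v i + v' i) \<in> cspace m" using that by (simp add: cspace_def)
      moreover have "bilin m B (\<lambda>i. v i + v' i) (\<lambda>i. v i + v' i) = bilin m B v v + bilin m B v v' + bilin m B v' v + bilin m B v' v'"
        by (simp add: bilin_def algebra_simps sum.distrib)
      ultimately show ?thesis using 0 that sym[of v' v] by simp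
    qed
    then have "v = 0" if "v \<in> cspace m" for v
      using B that unfolding nondegenerate_symmetric_def by blast
    moreover have "(\<lambda>i. if i = 0 then 1 else 0) \<in> cspace m" using assms(2) by (simp add: cspace_def)
    ultimately have "(\<lambda>i. if i = 0 then 1 else 0) = (0 :: nat \<Rightarrow> complex)" by blast
    from fun_cong[OF this, of 0] show False by simp
  qed
  then obtain v where v: "v \<in> cspace m" "bilin m B v v \<noteq> 0" by blast
  show ?thesis
    by (rule cubic_coeffs_nonzero[OF mod cc, of "(v, 1)"]) (use v in auto)
qed

lemma diagonal_data_nonzero:
  assumes "diagonal_data C" shows "\<exists>a b c. C a b c \<noteq> 0"
proof (rule cubic_coeffs_nonzero[OF _ assms[unfolded diagonal_data_def], of "mat 1"])
  show "module (\<lambda>c t. \<chi> i j. c * t $ i $ j :: complex ^ 3 ^ 3)"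
    by unfold_locales (simp_all add: vec_eq_iff algebra_simps)
  show "mat 1 \<in> {t :: complex ^ 3 ^ 3. \<forall>i j. i \<noteq> j \<longrightarrow> t $ i $ j = 0}" by (simp add: mat_def)
qed simp

lemma cubic_data_nonzero:
  assumes "cubic_data G C" shows "\<exists>a b c. C a b c \<noteq> 0"
proof (cases G)
  case (Type_B l)
  then show ?thesis using assms js_data_nonzero[of "2 * l - 5" C] by simp
next
  case (Type_D l)
  then show ?thesis using assms js_data_nonzero[of "2 * l - 6" C] diagonal_data_nonzero[of C] by auto
next
  case Type_G2
  show ?thesis
  proof (rule cubic_coeffs_nonzero)
    show "cubic_coeffs (*) (UNIV :: complex set) (\<lambda>t. t ^ 3 / 3) C" using assms Type_G2 by simp
    show "module ((*) :: complex \<Rightarrow> complex \<Rightarrow> complex)" by unfold_locales (simp_all add: algebra_simps)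
  qed (auto intro: UNIV_I[of 1])
qed (use assms hermitian_data_nonzero in auto)

theorem theorem3p4:
  fixes G :: simple_type
    and C D :: "'m::finite tensor3"
    and f :: "'m jet \<Rightarrow> complex"
  assumes "cubic_data G C"
    and "dual_cubic C D"
    and "f = (\<lambda>p. let X = (\<lambda>a. cx p (Some a)); P = (\<lambda>a. cp p (Some a)) in
               cu p * (cu p - (\<Sum>i\<in>UNIV. cx p i * cp p i))
               - 1/2 * cubic C X * cp p None
               + 1/2 * cubic D P * cx p None
               + 9/4 * (\<Sum>a\<in>UNIV. cubic1 C a X * cubic1 D a P))"
  shows "f \<in> symmetry_algebra C \<and>
    graded_part C 2 = {(\<lambda>p. c * f p) | c. True} \<and>
    (\<forall>g\<in>symmetry_algebra C. \<exists>!h. h \<in> (\<Pi>\<^sub>E k\<in>{-2..2}. graded_part C k) \<and> g = (\<Sum>k=-2..2. h k)) \<and>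
    lie_generated (range (\<lambda>i p. cx p i) \<union> range (\<lambda>i p. cp p i) \<union> {f}) = symmetry_algebra C"
proof -
  interpret dual_cubics C D
    by unfold_locales (rule symmetric3_data[OF assms(1)] assms(2) cubic_data_nonzero[OF assms(1)])+
  have f: "f = topgen C D"
    unfolding assms(3) by (intro ext) (simp add: topgen_def cubic1_polar Let_def)
  show ?thesis
    unfolding f using S_topgen top_degree grading generated_eq[unfolded gens_def] by (intro conjI ballI)
qed

end
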